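(* Suppose $U:\mathbb R\to[0,1]$ is measurable with $\mathbb E_\xi[\xi U(\xi)]\ne0$. Let $M=M(N)\le N$ and let $\boldsymbol G$ be an $M\times N$ matrix with i.i.d. standard Gaussian entries. Then, for $\tau=\exp(-12)$, $$\limsup_{N\to\infty}\frac1N\bigg|\mathbb E\bigg[\log_{N\tau}\Big(\frac{\boldsymbol Z(\eta)}{2^N}\Big)-\log_{N\tau}\Big(\frac{\boldsymbol Z}{2^N}\Big)\bigg]\bigg|\le o_\eta(1),$$ i.e. the left-hand side tends to $0$ as $\eta\downarrow0$.
   Context: $\xi$ is a standard Gaussian random variable. For $\eta>0$, $U_\eta(x)=\mathbb E_\xi U(x+\eta\xi)$. With $\mathbf g^1,\dots,\mathbf g^M$ the rows of $\boldsymbol G$, $$\boldsymbol Z=\sum_{J\in\{-1,+1\}^N}\prod_{a\le M}U\Big(\frac{(\mathbf g^a,J)}{N^{1/2}}\Big),\qquad \boldsymbol Z(\eta)=\sum_{J\in\{-1,+1\}^N}\prod_{a\le M}U_\eta\Big(\frac{(\mathbf g^a,J)}{N^{1/2}}\Big).$$ The truncated logarithm is $\log_A(x)=\max\{-A,\log x\}$ (with $\log0=-\infty$). *)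

theory Defs
  imports "HOL-Probability.Probability"
begin

abbreviation std_gaussian :: "real measure" where
  "std_gaussian \<equiv> density lborel std_normal_density"

definition gauss_smooth :: "real \<Rightarrow> (real \<Rightarrow> real) \<Rightarrow> real \<Rightarrow> real" where
  "gauss_smooth \<eta> U x = (\<integral>\<xi>. U (x + \<eta> * \<xi>) \<partial>std_gaussian)"

text \<open>The sign vectors \<open>{-1,+1}^N\<close> are the extensional functions from \<open>{..<N}\<close> to
  \<open>{-1, 1}\<close>, so that there are exactly \<open>2 ^ N\<close> of them. An \<open>M \<times> N\<close> matrix is a function
  \<open>g\<close> of which only the entries \<open>g a i\<close> with \<open>a < M\<close> and \<open>i < N\<close> matter.\<close>

definition sign_vectors :: "nat \<Rightarrow> (nat \<Rightarrow> real) set" where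
  "sign_vectors N = {..<N} \<rightarrow>\<^sub>E {-1, 1}"

definition partition_function ::
  "(real \<Rightarrow> real) \<Rightarrow> nat \<Rightarrow> nat \<Rightarrow> (nat \<Rightarrow> nat \<Rightarrow> real) \<Rightarrow> real" where
  "partition_function U M N g =
     (\<Sum>J\<in>sign_vectors N. \<Prod>a<M. U ((\<Sum>i<N. g a i * J i) / sqrt (real N)))"

text \<open>The case distinction implements the convention \<open>log 0 = -\<infinity>\<close>, since \<open>ln 0 = 0\<close> in the
  library. Only arguments \<open>x \<ge> 0\<close> are relevant.\<close>

definition trunc_log :: "real \<Rightarrow> real \<Rightarrow> real" where
  "trunc_log A x = (if x > 0 then max (- A) (ln x) else - A)"

definition iid_gaussian_matrix ::
  "'w measure \<Rightarrow> nat \<Rightarrow> nat \<Rightarrow> (nat \<Rightarrow> nat \<Rightarrow> 'w \<Rightarrow> real) \<Rightarrow> bool" where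
  "iid_gaussian_matrix P M N G \<longleftrightarrow>
     prob_space P \<and>
     prob_space.indep_vars P (\<lambda>_. borel) (\<lambda>(a, i). G a i) ({..<M} \<times> {..<N}) \<and>
     (\<forall>a<M. \<forall>i<N. distributed P lborel (G a i) std_normal_density)"

end

theory Submission
  imports Defs
begin

text \<open>
Replace \<open>U\<close> by \<open>gauss_smooth \<eta> U\<close> in one row of the matrix at a time. Conditionally on the other
rows, a partition function is \<open>W * F(g)\<close>, where \<open>g\<close> is the remaining row, \<open>F(g)\<close> is the average of
\<open>U((g, J) / sqrt N)\<close> over a probability measure \<open>\<nu>\<close> on the sign vectors, and \<open>2 ^ N * W\<close> is the total
weight. Below \<open>exp (- A)\<close>, where \<open>A = N \<tau>\<close>, the truncated logarithm is constant, so only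
\<open>W > exp (- A)\<close> matters. There \<open>\<nu>\<close> has density at most \<open>exp (N \<tau>)\<close> with respect to the uniform
measure, that is, \<open>\<nu>\<close> is spread out. There are at most \<open>N\<close> rows and the free energy is divided by \<open>N\<close>,
so it suffices to show that one replacement changes the expected truncated logarithm by an amount
that vanishes as \<open>N \<longrightarrow> \<infinity>\<close> and then \<open>\<eta> \<longrightarrow> 0\<close>, uniformly in \<open>\<nu>\<close> (\<open>trunc_log_row_replacement\<close>).

The averages of \<open>U\<close> and of its smoothing are close in \<open>L\<^sup>1\<close>, because \<open>(g, J) / sqrt N\<close> is a standard
Gaussian for every \<open>J\<close>. The difficulty is the singularity of the logarithm at 0, and the remedy is the
series \<open>- ln x = (\<Sum>k\<ge>1. (1 - x) ^ k / k)\<close>. Its terms with \<open>k \<le> K\<close> are Lipschitz, and the others are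
controlled by the moments \<open>E (1 - F) ^ k\<close>. Independent replicas \<open>J\<^sub>1, \<dots>, J\<^sub>k\<close> drawn from \<open>\<nu>\<close> give
\<open>E (1 - F) ^ k = E (\<Prod>l. 1 - U((g, J\<^sub>l) / sqrt N))\<close>, and the estimate \<open>spin_avg_small_ball\<close> comes from
adding the replicas one by one.

A vector drawn from \<open>\<nu>\<close> is, outside an event of probability \<open>exp (- N / 512)\<close>, almost orthogonal to the
span of at most \<open>N / 1024\<close> given vectors (\<open>spin_mass_near_subspace\<close>). The smallness of \<open>\<tau>\<close> is used
here: the uniform probability of the exceptional set must beat the density \<open>exp (N \<tau>)\<close>. Hence
\<open>(g, J\<^sub>l) / sqrt N = y + s t\<close>, where \<open>y\<close> has variance at most \<open>1 / 64\<close> and \<open>t\<close> is a standard Gaussian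
independent of \<open>y\<close> and of the earlier replicas. Averaging over \<open>t\<close> shows that the factor
\<open>1 - U(y + s t)\<close> is at most \<open>1 - b * exp (- 2 * y\<^sup>2)\<close> on average, where \<open>b > 0\<close> because \<open>U\<close> is not almost
everywhere zero. Since \<open>y\<close> has so small a variance, \<open>y\<^sup>2 > ln k / 4\<close> has probability only of order
\<open>k ^ (-4)\<close>; otherwise the replica gains a factor \<open>1 - b / sqrt k\<close>. Thus \<open>E (1 - F) ^ k\<close> is at most
\<open>exp (- b * sqrt k) + 2 / k ^ 3\<close>, up to an exponentially small error, for all \<open>k \<le> N / 1024\<close>
(\<open>add_one_spin_vector\<close>, \<open>spin_avg_replica_bound\<close>). This is summable against \<open>1 / k\<close>, and it is
\<open>o(1 / N)\<close> at \<open>k = N div 1024\<close>, which pays for the event where the logarithm is cut at \<open>- N \<tau>\<close>.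

The constant \<open>b\<close> depends continuously on \<open>U\<close> in \<open>L\<^sup>1\<close>, so the same estimates hold for the smoothed
function with \<open>b / 2\<close>, and the only remaining dependence on \<open>\<eta>\<close> is through the \<open>L\<^sup>1\<close> distance
(\<open>gauss_smooth_L1\<close>).
\<close>

section \<open>Rotation invariance of Gaussian vectors\<close>

text \<open>
For \<open>c \<noteq> 0\<close> the rotation is a composition of two maps, each of which is affine in one coordinate for a
fixed value of the other; their scaling factors \<open>c\<close> and \<open>1 / c\<close> cancel. For \<open>c = 0\<close> it is a swap with
a sign change.
\<close>

lemma lborel_rotation:
  fixes K :: "real \<times> real \<Rightarrow> ennreal"
  assumes K [measurable]: "K \<in> borel_measurable borel" and cs: "c\<^sup>2 + s\<^sup>2 = (1::real)"
  shows "(\<integral>\<^sup>+x. \<integral>\<^sup>+y. K (c * x + s * y, c * y - s * x) \<partial>lborel \<partial>lborel)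
       = (\<integral>\<^sup>+x. \<integral>\<^sup>+y. K (x, y) \<partial>lborel \<partial>lborel)"
proof -
  have Kp [measurable]: "K \<in> borel_measurable (borel \<Otimes>\<^sub>M borel)"
    using K by (simp add: borel_prod)
  have "(\<integral>\<^sup>+x. \<integral>\<^sup>+y. K (c * x + s * y, c * y - s * x) \<partial>lborel \<partial>lborel)
      = (\<integral>\<^sup>+y. \<integral>\<^sup>+x. K (s * y + c * x, c * y - s * x) \<partial>lborel \<partial>lborel)"
    by (subst lborel_pair.Fubini') (auto simp: add.commute)
  also have "\<dots> = (\<integral>\<^sup>+x. \<integral>\<^sup>+y. K (x, y) \<partial>lborel \<partial>lborel)"
  proof (cases "c = 0")
    case False
    have 1: "(\<integral>\<^sup>+x. K (s * y + c * x, c * y - s * x) \<partial>lborel)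
        = ennreal (1 / \<bar>c\<bar>) * (\<integral>\<^sup>+u. K (u, (y - s * u) / c) \<partial>lborel)" for y
    proof -
      have "(y - s * (s * y + c * x)) / c = c * y - s * x" for x
      proof -
        have "y - s * (s * y + c * x) = (1 - s\<^sup>2) * y - c * (s * x)"
          by (simp add: algebra_simps power2_eq_square)
        also have "1 - s\<^sup>2 = c * c" using cs by (simp add: power2_eq_square)
        finally show ?thesis using False by (simp add: field_simps)
      qed
      then have "(\<integral>\<^sup>+u. K (u, (y - s * u) / c) \<partial>lborel)
          = ennreal \<bar>c\<bar> * (\<integral>\<^sup>+x. K (s * y + c * x, c * y - s * x) \<partial>lborel)"
        by (subst nn_integral_real_affine[OF _ False, of _ "s * y"]) auto
      then show ?thesis
        using False by (simp add: mult.assoc[symmetric] ennreal_mult[symmetric])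
    qed
    have 2: "(\<integral>\<^sup>+y. K (u, (y - s * u) / c) \<partial>lborel)
        = ennreal \<bar>c\<bar> * (\<integral>\<^sup>+v. K (u, v) \<partial>lborel)" for u
    proof -
      have c': "1 / c \<noteq> 0" using False by simp
      have "(\<integral>\<^sup>+v. K (u, v) \<partial>lborel)
          = ennreal \<bar>1 / c\<bar> * (\<integral>\<^sup>+y. K (u, (y - s * u) / c) \<partial>lborel)"
        by (subst nn_integral_real_affine[OF _ c', of _ "- s * u / c"])
          (auto simp: diff_divide_distrib)
      then show ?thesis
        using False by (simp add: mult.assoc[symmetric] ennreal_mult[symmetric])
    qed
    have "(\<integral>\<^sup>+y. \<integral>\<^sup>+x. K (s * y + c * x, c * y - s * x) \<partial>lborel \<partial>lborel)
        = ennreal (1 / \<bar>c\<bar>) * (\<integral>\<^sup>+y. \<integral>\<^sup>+u. K (u, (y - s * u) / c) \<partial>lborel \<partial>lborel)"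
      unfolding 1 by (rule nn_integral_cmult) measurable
    also have "\<dots> = ennreal (1 / \<bar>c\<bar>) * (\<integral>\<^sup>+u. \<integral>\<^sup>+y. K (u, (y - s * u) / c) \<partial>lborel \<partial>lborel)"
      by (subst lborel_pair.Fubini') auto
    also have "\<dots> = ennreal (1 / \<bar>c\<bar>) * (ennreal \<bar>c\<bar> * (\<integral>\<^sup>+u. \<integral>\<^sup>+v. K (u, v) \<partial>lborel \<partial>lborel))"
      unfolding 2 by (subst nn_integral_cmult) auto
    also have "\<dots> = (\<integral>\<^sup>+u. \<integral>\<^sup>+v. K (u, v) \<partial>lborel \<partial>lborel)"
      using False by (simp add: mult.assoc[symmetric] ennreal_mult[symmetric])
    finally show ?thesis .
  next
    case True
    then have s: "\<bar>s\<bar> = 1" "s \<noteq> 0" "\<bar>-s\<bar> = 1" "-s \<noteq> 0"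
      using cs by (auto simp: power2_eq_1_iff)
    have 1: "(\<integral>\<^sup>+x. K (s * y, - s * x) \<partial>lborel) = (\<integral>\<^sup>+x. K (s * y, x) \<partial>lborel)" for y
      using nn_integral_real_affine[of "\<lambda>x. K (s * y, x)" "-s" 0] s by simp
    have "(\<integral>\<^sup>+y. \<integral>\<^sup>+x. K (s * y, x) \<partial>lborel \<partial>lborel) = (\<integral>\<^sup>+y. \<integral>\<^sup>+x. K (y, x) \<partial>lborel \<partial>lborel)"
      using nn_integral_real_affine[of "\<lambda>y. \<integral>\<^sup>+x. K (y, x) \<partial>lborel" s 0] s by simp
    with 1 True show ?thesis by simp
  qed
  finally show ?thesis .
qed

lemma gauss_rotation:
  fixes f :: "real \<times> real \<Rightarrow> ennreal"
  assumes f [measurable]: "f \<in> borel_measurable borel" and cs: "c\<^sup>2 + s\<^sup>2 = (1::real)"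
  shows "(\<integral>\<^sup>+x. \<integral>\<^sup>+y. f (c * x + s * y, c * y - s * x) \<partial>std_gaussian \<partial>std_gaussian)
       = (\<integral>\<^sup>+x. \<integral>\<^sup>+y. f (x, y) \<partial>std_gaussian \<partial>std_gaussian)"
proof -
  have fp [measurable]: "f \<in> borel_measurable (borel \<Otimes>\<^sub>M borel)"
    using f by (simp add: borel_prod)
  define K where "K = (\<lambda>(x, y). ennreal (std_normal_density x) * (ennreal (std_normal_density y) * f (x, y)))"
  have Kp [measurable]: "K \<in> borel_measurable (borel \<Otimes>\<^sub>M borel)"
    unfolding K_def by measurable
  then have K [measurable]: "K \<in> borel_measurable borel"
    by (simp add: borel_prod)
  have inv: "std_normal_density (c * x + s * y) * std_normal_density (c * y - s * x)
      = std_normal_density x * std_normal_density y" for x y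
  proof -
    have "(c * x + s * y)\<^sup>2 + (c * y - s * x)\<^sup>2 = (c\<^sup>2 + s\<^sup>2) * (x\<^sup>2 + y\<^sup>2)"
      by (simp add: power2_eq_square algebra_simps)
    then have "- (c * x + s * y)\<^sup>2 / 2 + - (c * y - s * x)\<^sup>2 / 2 = - x\<^sup>2 / 2 + - y\<^sup>2 / 2"
      using cs by simp
    then show ?thesis
      by (simp add: std_normal_density_def exp_add[symmetric] field_simps)
  qed
  have K_rot: "K (c * x + s * y, c * y - s * x)
      = ennreal (std_normal_density x) *
        (ennreal (std_normal_density y) * f (c * x + s * y, c * y - s * x))" for x y
    using inv[of x y] by (simp add: K_def mult.assoc[symmetric] ennreal_mult[symmetric])
  have "(\<integral>\<^sup>+x. \<integral>\<^sup>+y. f (c * x + s * y, c * y - s * x) \<partial>std_gaussian \<partial>std_gaussian)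
      = (\<integral>\<^sup>+x. \<integral>\<^sup>+y. K (c * x + s * y, c * y - s * x) \<partial>lborel \<partial>lborel)"
    unfolding K_rot by (simp add: nn_integral_density nn_integral_cmult)
  also have "\<dots> = (\<integral>\<^sup>+x. \<integral>\<^sup>+y. K (x, y) \<partial>lborel \<partial>lborel)"
    by (rule lborel_rotation[OF K cs])
  also have "\<dots> = (\<integral>\<^sup>+x. \<integral>\<^sup>+y. f (x, y) \<partial>std_gaussian \<partial>std_gaussian)"
    unfolding K_def by (simp add: nn_integral_density nn_integral_cmult)
  finally show ?thesis .
qed

definition gauss_vec :: "nat \<Rightarrow> (nat \<Rightarrow> real) measure" where
  "gauss_vec N = PiM {..<N} (\<lambda>_. std_gaussian)"

lemma prob_space_std_gaussian: "prob_space std_gaussian"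
  by (rule prob_space_normal_density) simp

interpretation gauss: prob_space std_gaussian
  by (rule prob_space_std_gaussian)

interpretation gauss_prod: product_sigma_finite "\<lambda>_. std_gaussian"
  by standard

lemma prob_space_gauss_vec: "prob_space (gauss_vec N)"
  unfolding gauss_vec_def by (intro prob_space_PiM prob_space_std_gaussian)

interpretation gauss_vec: prob_space "gauss_vec N"
  by (rule prob_space_gauss_vec)

lemma sets_gauss_vec [measurable_cong]: "sets (gauss_vec N) = sets (PiM {..<N} (\<lambda>_. borel))"
  unfolding gauss_vec_def by (intro sets_PiM_cong) auto

lemma space_gauss_vec: "space (gauss_vec N) = extensional {..<N}"
  by (simp add: gauss_vec_def space_PiM PiE_def)

definition dot :: "nat \<Rightarrow> (nat \<Rightarrow> real) \<Rightarrow> (nat \<Rightarrow> real) \<Rightarrow> real" where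
  "dot N x y = (\<Sum>i<N. x i * y i)"

lemma measurable_dot [measurable]:
  "(\<lambda>g. dot N g v) \<in> borel_measurable (gauss_vec N)"
  unfolding dot_def by measurable

definition givens :: "nat \<Rightarrow> nat \<Rightarrow> real \<Rightarrow> real \<Rightarrow> (nat \<Rightarrow> real) \<Rightarrow> nat \<Rightarrow> real" where
  "givens i j c s g = g(i := c * g i + s * g j, j := c * g j - s * g i)"

lemma measurable_givens [measurable]:
  assumes "i < N" "j < N"
  shows "givens i j c s \<in> measurable (gauss_vec N) (gauss_vec N)"
proof -
  have *: "givens i j c s g = (\<lambda>k\<in>{..<N}. if k = j then c * g j - s * g i else if k = i then c * g i + s * g j else g k)"
    if "g \<in> space (gauss_vec N)" for g
    using that assms by (auto simp: givens_def space_gauss_vec extensional_def fun_eq_iff)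
  have "(\<lambda>g. \<lambda>k\<in>{..<N}. if k = j then c * g j - s * g i else if k = i then c * g i + s * g j else g k)
     \<in> measurable (gauss_vec N) (PiM {..<N} (\<lambda>_. borel))"
    using assms by (intro measurable_restrict) auto
  then have "(\<lambda>g. \<lambda>k\<in>{..<N}. if k = j then c * g j - s * g i else if k = i then c * g i + s * g j else g k)
     \<in> measurable (gauss_vec N) (gauss_vec N)"
    by (subst measurable_cong_sets[OF refl sets_gauss_vec])
  then show ?thesis
    by (subst measurable_cong[OF *])
qed

lemma nn_integral_gauss_vec_coordinate:
  assumes i: "i < N" and f [measurable]: "f \<in> borel_measurable (gauss_vec N)"
  shows "(\<integral>\<^sup>+g. f g \<partial>gauss_vec N)
       = (\<integral>\<^sup>+y. \<integral>\<^sup>+g. f (g(i := y)) \<partial>PiM ({..<N} - {i}) (\<lambda>_. std_gaussian) \<partial>std_gaussian)"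
proof -
  have "insert i ({..<N} - {i}) = {..<N}" using i by auto
  then show ?thesis
    using gauss_prod.product_nn_integral_insert_rev[of "{..<N} - {i}" i f] f
    by (simp add: gauss_vec_def)
qed

text \<open>
Fubini reduces this to the two coordinates that move, where it is the rotation invariance of the
planar Gaussian measure.
\<close>

lemma nn_integral_givens:
  assumes ij: "i < N" "j < N" "i \<noteq> j" and cs: "c\<^sup>2 + s\<^sup>2 = 1"
    and f [measurable]: "f \<in> borel_measurable (gauss_vec N)"
  shows "(\<integral>\<^sup>+g. f (givens i j c s g) \<partial>gauss_vec N) = (\<integral>\<^sup>+g. f g \<partial>gauss_vec N)"
proof -
  define I where "I = {..<N} - {i, j}"
  define Q where "Q = PiM I (\<lambda>_. std_gaussian)"
  have I: "{..<N} = insert i (insert j I)" "finite I" "i \<notin> insert j I" "j \<notin> I"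
    using ij by (auto simp: I_def)
  interpret Q: prob_space Q
    unfolding Q_def by (intro prob_space_PiM prob_space_std_gaussian)
  have upd [measurable]: "(\<lambda>(x, y, g). g(j := y, i := x)) \<in> measurable (borel \<Otimes>\<^sub>M borel \<Otimes>\<^sub>M Q) (gauss_vec N)"
  proof -
    have *: "(case z of (x, y, g) \<Rightarrow> g(j := y, i := x))
        = (\<lambda>k\<in>{..<N}. if k = i then fst z else if k = j then fst (snd z) else snd (snd z) k)"
      if "z \<in> space (borel \<Otimes>\<^sub>M borel \<Otimes>\<^sub>M Q)" for z
      using that ij by (auto simp: Q_def I_def space_pair_measure space_PiM PiE_def extensional_def fun_eq_iff)
    have "(\<lambda>z. \<lambda>k\<in>{..<N}. if k = i then fst z else if k = j then fst (snd z) else snd (snd z) k)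
        \<in> measurable (borel \<Otimes>\<^sub>M borel \<Otimes>\<^sub>M Q) (PiM {..<N} (\<lambda>_. borel))"
    proof (rule measurable_restrict)
      fix k assume k: "k \<in> {..<N}"
      show "(\<lambda>z. if k = i then fst z else if k = j then fst (snd z) else snd (snd z) k)
          \<in> borel_measurable (borel \<Otimes>\<^sub>M borel \<Otimes>\<^sub>M Q)"
      proof (cases "k \<in> I")
        case True
        then have "(\<lambda>g. g k) \<in> measurable Q borel"
          unfolding Q_def using measurable_component_singleton[of k I "\<lambda>_. std_gaussian"]
          by simp
        then show ?thesis by measurable
      next
        case False
        then have "k = i \<or> k = j" using k by (auto simp: I_def)
        then show ?thesis using ij(3) ij(3)[symmetric] by (elim disjE) simp_all
      qed
    qed
    then have "(\<lambda>z. \<lambda>k\<in>{..<N}. if k = i then fst z else if k = j then fst (snd z) else snd (snd z) k)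
        \<in> measurable (borel \<Otimes>\<^sub>M borel \<Otimes>\<^sub>M Q) (gauss_vec N)"
      by (subst measurable_cong_sets[OF refl sets_gauss_vec])
    then show ?thesis
      by (subst measurable_cong[OF *])
  qed
  have two: "(\<integral>\<^sup>+g. h g \<partial>gauss_vec N)
      = (\<integral>\<^sup>+x. \<integral>\<^sup>+y. \<integral>\<^sup>+g. h (g(j := y, i := x)) \<partial>Q \<partial>std_gaussian \<partial>std_gaussian)"
    if [measurable]: "h \<in> borel_measurable (gauss_vec N)" for h
  proof -
    have hh: "h \<in> borel_measurable (PiM (insert i (insert j I)) (\<lambda>_. std_gaussian))"
      using that by (simp add: gauss_vec_def I)
    have 1: "(\<integral>\<^sup>+g. h g \<partial>gauss_vec N)
        = (\<integral>\<^sup>+x. \<integral>\<^sup>+g. h (g(i := x)) \<partial>PiM (insert j I) (\<lambda>_. std_gaussian) \<partial>std_gaussian)"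
      unfolding gauss_vec_def I(1)
      by (rule gauss_prod.product_nn_integral_insert_rev[OF _ I(3) hh]) (simp add: I)
    have 2: "(\<integral>\<^sup>+g. h (g(i := x)) \<partial>PiM (insert j I) (\<lambda>_. std_gaussian))
        = (\<integral>\<^sup>+y. \<integral>\<^sup>+g. h (g(j := y, i := x)) \<partial>Q \<partial>std_gaussian)" for x
    proof -
      have "(\<lambda>g. g(i := x)) \<in> measurable (PiM (insert j I) (\<lambda>_. std_gaussian)) (PiM (insert i (insert j I)) (\<lambda>_. std_gaussian))"
        by (rule measurable_fun_upd[where J = "insert j I"]) auto
      then have "(\<lambda>g. h (g(i := x))) \<in> borel_measurable (PiM (insert j I) (\<lambda>_. std_gaussian))"
        using hh by (rule measurable_compose)
      then show ?thesis
        unfolding Q_def using gauss_prod.product_nn_integral_insert_rev[OF I(2) I(4)] by simp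
    qed
    show ?thesis unfolding 1 2 ..
  qed
  define H where "H = (\<lambda>(x, y). \<integral>\<^sup>+g. f (g(j := y, i := x)) \<partial>Q)"
  have "(\<lambda>p. f (case p of ((x, y), g) \<Rightarrow> g(j := y, i := x))) \<in> borel_measurable ((borel \<Otimes>\<^sub>M borel) \<Otimes>\<^sub>M Q)"
  proof -
    have "(\<lambda>p. case (fst (fst p), snd (fst p), snd p) of (x, y, g) \<Rightarrow> g(j := y, i := x))
        \<in> measurable ((borel \<Otimes>\<^sub>M borel) \<Otimes>\<^sub>M Q) (gauss_vec N)"
      by (rule measurable_compose[OF _ upd]) measurable
    from measurable_compose[OF this f] show ?thesis
      by (simp add: case_prod_beta)
  qed
  then have Hp: "H \<in> borel_measurable (borel \<Otimes>\<^sub>M borel)"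
    unfolding H_def case_prod_beta by (intro Q.borel_measurable_nn_integral) (simp add: case_prod_beta)
  then have H: "H \<in> borel_measurable borel" by (simp add: borel_prod)
  have rot: "f (givens i j c s (g(j := y, i := x))) = f (g(j := c * y - s * x, i := c * x + s * y))" for g x y
    using ij(3) by (auto simp: givens_def fun_upd_twist intro!: arg_cong[of _ _ f])
  have "(\<integral>\<^sup>+g. f (givens i j c s g) \<partial>gauss_vec N)
      = (\<integral>\<^sup>+x. \<integral>\<^sup>+y. H (c * x + s * y, c * y - s * x) \<partial>std_gaussian \<partial>std_gaussian)"
    using ij by (subst two) (auto simp: rot H_def)
  also have "\<dots> = (\<integral>\<^sup>+x. \<integral>\<^sup>+y. H (x, y) \<partial>std_gaussian \<partial>std_gaussian)"
    by (rule gauss_rotation[OF H cs])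
  also have "\<dots> = (\<integral>\<^sup>+g. f g \<partial>gauss_vec N)"
    by (subst two) (auto simp: H_def)
  finally show ?thesis .
qed

text \<open>
For a unit vector \<open>v\<close>, the component of \<open>g\<close> along \<open>v\<close> is replaced by \<open>t\<close>.
\<close>

definition resample :: "nat \<Rightarrow> (nat \<Rightarrow> real) \<Rightarrow> real \<Rightarrow> (nat \<Rightarrow> real) \<Rightarrow> nat \<Rightarrow> real" where
  "resample N v t g = (\<lambda>i\<in>{..<N}. g i + (t - dot N g v) * v i)"

lemma measurable_resample [measurable]:
  "(\<lambda>(t, g). resample N v t g) \<in> measurable (borel \<Otimes>\<^sub>M gauss_vec N) (gauss_vec N)"
proof -
  have "(\<lambda>(t, g). resample N v t g) \<in> measurable (borel \<Otimes>\<^sub>M gauss_vec N) (PiM {..<N} (\<lambda>_. borel))"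
    unfolding resample_def case_prod_beta by (intro measurable_restrict) measurable
  then show ?thesis
    by (subst measurable_cong_sets[OF refl sets_gauss_vec])
qed

lemma measurable_resample' [measurable (raw)]:
  "t \<in> borel_measurable M \<Longrightarrow> h \<in> measurable M (gauss_vec N) \<Longrightarrow>
    (\<lambda>x. resample N v (t x) (h x)) \<in> measurable M (gauss_vec N)"
  using measurable_compose[of "\<lambda>x. (t x, h x)" M "borel \<Otimes>\<^sub>M gauss_vec N", OF _ measurable_resample[of N v]]
  by simp

lemma gauss_symmetric:
  fixes f :: "real \<Rightarrow> ennreal"
  assumes [measurable]: "f \<in> borel_measurable borel"
  shows "(\<integral>\<^sup>+t. f (- t) \<partial>std_gaussian) = (\<integral>\<^sup>+t. f t \<partial>std_gaussian)"
proof -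
  have "std_normal_density (- t) = std_normal_density t" for t
    by (simp add: std_normal_density_def)
  then have "(\<integral>\<^sup>+t. f (- t) \<partial>std_gaussian)
      = (\<integral>\<^sup>+t. ennreal (std_normal_density (- t)) * f (- t) \<partial>lborel)"
    by (simp add: nn_integral_density)
  also have "\<dots> = (\<integral>\<^sup>+t. ennreal (std_normal_density t) * f t \<partial>lborel)"
    using nn_integral_real_affine[of "\<lambda>t. ennreal (std_normal_density t) * f t" "-1" 0] by simp
  finally show ?thesis by (simp add: nn_integral_density)
qed

lemma givens_inverse:
  assumes "c\<^sup>2 + s\<^sup>2 = 1" "i \<noteq> j"
  shows "givens i j c (- s) (givens i j c s x) = x"
proof -
  have "c * (c * a + s * b) + - s * (c * b - s * a) = (c\<^sup>2 + s\<^sup>2) * a"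
    "c * (c * b - s * a) - - s * (c * a + s * b) = (c\<^sup>2 + s\<^sup>2) * b" for a b
    by (simp_all add: power2_eq_square algebra_simps)
  then show ?thesis
    using assms by (auto simp: givens_def fun_eq_iff)
qed

lemma dot_givens:
  assumes "c\<^sup>2 + s\<^sup>2 = 1" "i \<noteq> j" "i < N" "j < N"
  shows "dot N (givens i j c s x) (givens i j c s y) = dot N x y"
proof -
  have I: "{..<N} = insert i (insert j ({..<N} - {i, j}))" using assms by auto
  have "(c * x i + s * x j) * (c * y i + s * y j) + (c * x j - s * x i) * (c * y j - s * y i)
      = (c\<^sup>2 + s\<^sup>2) * (x i * y i + x j * y j)"
    by (simp add: power2_eq_square algebra_simps)
  moreover have "(\<Sum>k\<in>{..<N} - {i, j}. givens i j c s x k * givens i j c s y k)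
      = (\<Sum>k\<in>{..<N} - {i, j}. x k * y k)"
    by (intro sum.cong) (auto simp: givens_def)
  ultimately show ?thesis
    unfolding dot_def using assms
    by (subst (1 2) I) (simp add: givens_def)
qed

lemma resample_givens:
  assumes cs: "c\<^sup>2 + s\<^sup>2 = 1" "i \<noteq> j" "i < N" "j < N" and g: "g \<in> space (gauss_vec N)"
  shows "resample N v t g = givens i j c (- s) (resample N (givens i j c s v) t (givens i j c s g))"
proof -
  have "givens i j c s (resample N v t g) = resample N (givens i j c s v) t (givens i j c s g)"
    unfolding resample_def dot_givens[OF cs] using cs g
    by (auto simp: givens_def fun_eq_iff algebra_simps restrict_def space_gauss_vec extensional_def)
  then show ?thesis
    using givens_inverse[OF cs(1,2), of "resample N v t g"] by simp
qed

text \<open>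
The component of a Gaussian vector along a unit vector \<open>v\<close> is a standard Gaussian that is independent of
the orthogonal part, so it may be drawn afresh. This is clear when \<open>v\<close> is plus or minus the first
coordinate vector. The general case follows by induction on the length of the support of \<open>v\<close>: a plane
rotation of the last two coordinates of the support removes the last one, and the Gaussian measure is
invariant under it.
\<close>

lemma nn_integral_resample:
  assumes v: "dot N v v = 1" and f: "f \<in> borel_measurable (gauss_vec N)"
  shows "(\<integral>\<^sup>+g. \<integral>\<^sup>+t. f (resample N v t g) \<partial>std_gaussian \<partial>gauss_vec N) = (\<integral>\<^sup>+g. f g \<partial>gauss_vec N)"
proof -
  have "(\<integral>\<^sup>+g. \<integral>\<^sup>+t. f (resample N v t g) \<partial>std_gaussian \<partial>gauss_vec N) = (\<integral>\<^sup>+g. f g \<partial>gauss_vec N)"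
    if "k \<le> N" "\<forall>i<N. k \<le> i \<longrightarrow> v i = 0" "dot N v v = 1" "f \<in> borel_measurable (gauss_vec N)" for k
    using that
  proof (induction k arbitrary: v f)
    case 0
    then show ?case by (simp add: dot_def)
  next
    case (Suc k)
    note [measurable] = Suc.prems(4)
    have kN: "k < N" using Suc.prems(1) by simp
    show ?case
    proof (cases "k = 0")
      case True
      have N0: "0 < N" using kN by simp
      have v0: "v i = 0" if "i < N" "i \<noteq> 0" for i
        using Suc.prems(2) that True by auto
      have dot0: "dot N g v = g 0 * v 0" for g
      proof -
        have "dot N g v = (\<Sum>i\<in>{0}. g i * v i)"
          unfolding dot_def using v0 N0 by (intro sum.mono_neutral_right) auto
        then show ?thesis by simp
      qed
      have e: "v 0 * v 0 = 1" using Suc.prems(3) dot0[of v] by simp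
      then have "v 0 = 1 \<or> v 0 = -1"
        by (metis power2_eq_1_iff power2_eq_square)
      have res: "resample N v t g = g(0 := v 0 * t)" if "g \<in> extensional {..<N}" for g t
      proof
        fix i
        have "g 0 + (t - g 0 * v 0) * v 0 = v 0 * t"
          using e by (simp add: algebra_simps mult.assoc)
        then show "resample N v t g i = (g(0 := v 0 * t)) i"
          using that v0[of i] N0 by (auto simp: resample_def dot0 extensional_def)
      qed
      let ?Q = "PiM ({..<N} - {0}) (\<lambda>_. std_gaussian)"
      interpret Q: prob_space ?Q
        by (intro prob_space_PiM prob_space_std_gaussian)
      have upd: "(\<lambda>(t, g). g(0 := t)) \<in> measurable (std_gaussian \<Otimes>\<^sub>M ?Q) (gauss_vec N)"
      proof -
        have "insert 0 ({..<N} - {0}) = {..<N}" using N0 by auto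
        then show ?thesis
          unfolding gauss_vec_def
          using measurable_add_dim[of 0 "{..<N} - {0}" "\<lambda>_. std_gaussian"]
          by (auto simp: case_prod_beta intro!: measurable_fun_upd[where J = "{..<N} - {0}"])
      qed
      have m2 [measurable]: "(\<lambda>(t, g). f (g(0 := t))) \<in> borel_measurable (std_gaussian \<Otimes>\<^sub>M ?Q)"
      proof -
        have "(\<lambda>(t, g). f (g(0 := t))) = (\<lambda>x. f (case x of (t, g) \<Rightarrow> g(0 := t)))"
          by (simp add: fun_eq_iff split_beta)
        then show ?thesis
          using measurable_compose[OF upd Suc.prems(4)] by (simp only:)
      qed
      define h where "h = (\<lambda>t. \<integral>\<^sup>+g. f (g(0 := t)) \<partial>?Q)"
      have h [measurable]: "h \<in> borel_measurable borel"
      proof -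
        have "h \<in> borel_measurable std_gaussian"
          unfolding h_def by (rule Q.borel_measurable_nn_integral) (use m2 in simp)
        then show ?thesis by simp
      qed
      have "(\<integral>\<^sup>+g. \<integral>\<^sup>+t. f (resample N v t g) \<partial>std_gaussian \<partial>gauss_vec N)
          = (\<integral>\<^sup>+t. \<integral>\<^sup>+g. f (resample N v t g) \<partial>gauss_vec N \<partial>std_gaussian)"
        by (rule pair_sigma_finite.Fubini') (unfold_locales, measurable)
      also have "\<dots> = (\<integral>\<^sup>+t. h (v 0 * t) \<partial>std_gaussian)"
      proof (rule nn_integral_cong)
        fix t
        have "(\<integral>\<^sup>+g. f (resample N v t g) \<partial>gauss_vec N)
            = (\<integral>\<^sup>+y. \<integral>\<^sup>+g. f (resample N v t (g(0 := y))) \<partial>?Q \<partial>std_gaussian)"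
          by (rule nn_integral_gauss_vec_coordinate[OF N0]) measurable
        also have "\<dots> = (\<integral>\<^sup>+y. \<integral>\<^sup>+g. f (g(0 := v 0 * t)) \<partial>?Q \<partial>std_gaussian)"
        proof (intro nn_integral_cong)
          fix y g assume "g \<in> space ?Q"
          then have "g(0 := y) \<in> extensional {..<N}"
            using N0 by (auto simp: space_PiM PiE_def extensional_def)
          then show "f (resample N v t (g(0 := y))) = f (g(0 := v 0 * t))"
            by (simp add: res)
        qed
        also have "\<dots> = h (v 0 * t)"
          using gauss.emeasure_space_1 by (simp add: h_def)
        finally show "(\<integral>\<^sup>+g. f (resample N v t g) \<partial>gauss_vec N) = h (v 0 * t)" .
      qed
      also have "\<dots> = (\<integral>\<^sup>+t. h t \<partial>std_gaussian)"
        using \<open>v 0 = 1 \<or> v 0 = -1\<close> gauss_symmetric[OF h] by auto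
      also have "\<dots> = (\<integral>\<^sup>+g. f g \<partial>gauss_vec N)"
        unfolding h_def by (rule nn_integral_gauss_vec_coordinate[OF N0, symmetric]) measurable
      finally show ?thesis .
    next
      case False
      define i where "i = k - 1"
      have i: "i < N" "i \<noteq> k" "i < k" using False kN by (auto simp: i_def)
      (* The rotation by c = v i / r and s = v k / r moves the mass of coordinate k to coordinate i. *)
      define r where "r = sqrt ((v i)\<^sup>2 + (v k)\<^sup>2)"
      show ?thesis
      proof (cases "r = 0")
        case True
        then have "(v i)\<^sup>2 + (v k)\<^sup>2 = 0" by (simp add: r_def)
        then have "v k = 0" by (simp add: sum_power2_eq_zero_iff)
        then have "\<forall>l<N. k \<le> l \<longrightarrow> v l = 0"
          using Suc.prems(2) by (metis Suc_leI le_neq_implies_less)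
        then show ?thesis
          using Suc by auto
      next
        case False
        define c s where "c = v i / r" and "s = v k / r"
        have r2: "r\<^sup>2 = (v i)\<^sup>2 + (v k)\<^sup>2" by (simp add: r_def)
        have cs: "c\<^sup>2 + s\<^sup>2 = 1"
        proof -
          have "c\<^sup>2 + s\<^sup>2 = ((v i)\<^sup>2 + (v k)\<^sup>2) / r\<^sup>2"
            by (simp only: c_def s_def power_divide add_divide_distrib)
          also have "\<dots> = 1"
            unfolding r2[symmetric] using False by simp
          finally show ?thesis .
        qed
        have cs': "c\<^sup>2 + (- s)\<^sup>2 = 1" using cs by simp
        define v' where "v' = givens i k c s v"
        have "c * v k - s * v i = 0" by (simp add: c_def s_def)
        then have v'0: "\<forall>l<N. k \<le> l \<longrightarrow> v' l = 0"
          using Suc.prems(2) i by (auto simp: v'_def givens_def)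
        have v'1: "dot N v' v' = 1"
          unfolding v'_def using dot_givens[OF cs i(2) i(1) kN] Suc.prems(3) by simp
        have [measurable]: "givens i k c s \<in> measurable (gauss_vec N) (gauss_vec N)" for c s
          using i(1) kN by (rule measurable_givens)
        define f' where "f' = (\<lambda>g. f (givens i k c (- s) g))"
        have f' [measurable]: "f' \<in> borel_measurable (gauss_vec N)"
          unfolding f'_def by measurable
        have "(\<integral>\<^sup>+g. \<integral>\<^sup>+t. f (resample N v t g) \<partial>std_gaussian \<partial>gauss_vec N)
            = (\<integral>\<^sup>+g. \<integral>\<^sup>+t. f' (resample N v' t (givens i k c s g)) \<partial>std_gaussian \<partial>gauss_vec N)"
          unfolding f'_def v'_def
          by (intro nn_integral_cong) (simp add: resample_givens[OF cs i(2) i(1) kN, symmetric])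
        also have "\<dots> = (\<integral>\<^sup>+g. \<integral>\<^sup>+t. f' (resample N v' t g) \<partial>std_gaussian \<partial>gauss_vec N)"
          by (rule nn_integral_givens[OF i(1) kN i(2) cs]) measurable
        also have "\<dots> = (\<integral>\<^sup>+g. f' g \<partial>gauss_vec N)"
          by (rule Suc.IH[OF _ v'0 v'1 f']) (use kN in simp)
        also have "\<dots> = (\<integral>\<^sup>+g. f g \<partial>gauss_vec N)"
          unfolding f'_def by (rule nn_integral_givens[OF i(1) kN i(2) cs']) measurable
        finally show ?thesis .
      qed
    qed
  qed
  from this[of N] show ?thesis
    using v f by auto
qed

section \<open>Adding one sign vector\<close>

lemma dot_resample:
  "dot N (resample N v t g) x = dot N g x + (t - dot N g v) * dot N v x"
proof -
  define d where "d = dot N g v"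
  have "dot N (resample N v t g) x = (\<Sum>i<N. g i * x i + (t - d) * (v i * x i))"
    unfolding dot_def[of N "resample N v t g" x]
    by (intro sum.cong) (auto simp: resample_def d_def algebra_simps)
  then show ?thesis
    by (simp add: sum.distrib sum_distrib_left[symmetric] dot_def[symmetric] d_def)
qed

lemma nn_integral_gauss_dot:
  fixes f :: "real \<Rightarrow> ennreal"
  assumes v: "dot N v v = 1" and f [measurable]: "f \<in> borel_measurable borel"
  shows "(\<integral>\<^sup>+g. f (dot N g v) \<partial>gauss_vec N) = (\<integral>\<^sup>+t. f t \<partial>std_gaussian)"
proof -
  have res: "dot N (resample N v t g) v = t" for t g
    using v by (simp add: dot_resample)
  have "(\<integral>\<^sup>+g. f (dot N g v) \<partial>gauss_vec N)
      = (\<integral>\<^sup>+g. \<integral>\<^sup>+t. f (dot N (resample N v t g) v) \<partial>std_gaussian \<partial>gauss_vec N)"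
    by (rule nn_integral_resample[OF v, symmetric]) measurable
  also have "\<dots> = (\<integral>\<^sup>+t. f t \<partial>std_gaussian)"
    using gauss_vec.emeasure_space_1 by (simp add: res)
  finally show ?thesis .
qed

lemma gauss_exp_square: "(\<integral>\<^sup>+z. ennreal (exp (z\<^sup>2 / 4)) \<partial>std_gaussian) = ennreal (sqrt 2)"
proof -
  have "ennreal (std_normal_density z) * ennreal (exp (z\<^sup>2 / 4))
      = ennreal (sqrt 2) * ennreal (normal_density 0 (sqrt 2) z)" for z
  proof -
    have "exp (- z\<^sup>2 / 2) * exp (z\<^sup>2 / 4) = exp (- z\<^sup>2 / 4)"
      by (simp add: exp_add[symmetric])
    moreover have "sqrt 2 * sqrt (2 * pi) = sqrt (4 * pi)"
      by (simp add: real_sqrt_mult[symmetric])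
    ultimately have "std_normal_density z * exp (z\<^sup>2 / 4) = sqrt 2 * normal_density 0 (sqrt 2) z"
      by (simp add: normal_density_def field_simps real_sqrt_mult)
    then show ?thesis
      by (simp add: ennreal_mult[symmetric])
  qed
  then have "(\<integral>\<^sup>+z. ennreal (exp (z\<^sup>2 / 4)) \<partial>std_gaussian)
      = ennreal (sqrt 2) * (\<integral>\<^sup>+z. ennreal (normal_density 0 (sqrt 2) z) \<partial>lborel)"
    by (simp add: nn_integral_density nn_integral_cmult)
  also have "(\<integral>\<^sup>+z. ennreal (normal_density 0 (sqrt 2) z) \<partial>lborel) = 1"
    by (subst nn_integral_eq_integral) auto
  finally show ?thesis by simp
qed

lemma gauss_integrable_bounded:
  fixes f :: "real \<Rightarrow> real"
  assumes "f \<in> borel_measurable borel" "\<And>x. \<bar>f x\<bar> \<le> B"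
  shows "integrable std_gaussian f"
  by (rule gauss.integrable_const_bound[where B = B]) (use assms in auto)

text \<open>
The only quantity of \<open>V\<close> that enters the lower bounds. The weight \<open>exp (- 3 * x\<^sup>2 / 2)\<close> together with the
Gaussian density is a multiple of \<open>exp (- 2 * x\<^sup>2)\<close>, which is what survives of the density of
\<open>y + s * t\<close> when the dependence on \<open>y\<close> is pulled out as a factor.
\<close>

definition gauss_mass :: "(real \<Rightarrow> real) \<Rightarrow> real" where
  "gauss_mass V = (\<integral>x. V x * exp (- 3 * x\<^sup>2 / 2) \<partial>std_gaussian)"

lemma gauss_mass_bounds:
  assumes V [measurable]: "V \<in> borel_measurable borel" and V01: "\<And>x. V x \<in> {0..1}"
  shows "0 \<le> gauss_mass V" "gauss_mass V \<le> 1"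
    "integrable std_gaussian (\<lambda>x. V x * exp (- 3 * x\<^sup>2 / 2))"
proof -
  have 1: "0 \<le> V x * exp (- 3 * x\<^sup>2 / 2)" "V x * exp (- 3 * x\<^sup>2 / 2) \<le> 1" for x
    using V01[of x] by (auto intro!: mult_le_one)
  show i: "integrable std_gaussian (\<lambda>x. V x * exp (- 3 * x\<^sup>2 / 2))"
    by (rule gauss_integrable_bounded[where B = 1]) (use 1 in auto)
  show "0 \<le> gauss_mass V"
    unfolding gauss_mass_def using 1 by (intro Bochner_Integration.integral_nonneg) auto
  show "gauss_mass V \<le> 1"
    unfolding gauss_mass_def using i 1 by (intro gauss.integral_le_const) auto
qed

text \<open>
The density of \<open>y + s * t\<close> at \<open>x\<close> contains \<open>exp (- (x - y)\<^sup>2 / (2 * s\<^sup>2))\<close>, and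
\<open>(x - y)\<^sup>2 / (2 * s\<^sup>2) \<le> (x - y)\<^sup>2 \<le> 2 * x\<^sup>2 + 2 * y\<^sup>2\<close>.
\<close>

lemma gauss_affine_lower_bound:
  assumes V [measurable]: "V \<in> borel_measurable borel" and V01: "\<And>x. V x \<in> {0..1}"
    and s: "1 / 2 \<le> s\<^sup>2" "s\<^sup>2 \<le> 1"
  shows "exp (- 2 * y\<^sup>2) * gauss_mass V \<le> (\<integral>t. V (y + s * t) \<partial>std_gaussian)"
proof -
  have V0: "0 \<le> V x" "V x \<le> 1" for x using V01[of x] by auto
  have s0: "s \<noteq> 0" using s by auto
  define h where "h = (\<lambda>x. exp (- 2 * y\<^sup>2) * (V x * exp (- 3 * x\<^sup>2 / 2)) * std_normal_density x)"
  have [measurable]: "h \<in> borel_measurable borel" unfolding h_def by measurable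
  have pt: "\<bar>s\<bar> * h (y + s * t) \<le> std_normal_density t * V (y + s * t)" for t
  proof -
    define x where "x = y + s * t"
    have "t\<^sup>2 \<le> 2 * (s * t)\<^sup>2"
      using mult_right_mono[OF s(1), of "t\<^sup>2"] by (simp add: power_mult_distrib)
    also have "(s * t)\<^sup>2 = (x - y)\<^sup>2" by (simp add: x_def)
    also have "2 * (x - y)\<^sup>2 \<le> 4 * x\<^sup>2 + 4 * y\<^sup>2"
      using zero_le_power2[of "x + y"] by (simp add: power2_eq_square algebra_simps)
    finally have t: "t\<^sup>2 \<le> 4 * x\<^sup>2 + 4 * y\<^sup>2" .
    have "exp (- 2 * y\<^sup>2) * exp (- 3 * x\<^sup>2 / 2) * exp (- x\<^sup>2 / 2) \<le> exp (- t\<^sup>2 / 2)"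
      using t by (simp add: exp_add[symmetric])
    then have "exp (- 2 * y\<^sup>2) * exp (- 3 * x\<^sup>2 / 2) * std_normal_density x \<le> std_normal_density t"
      unfolding std_normal_density_def
      using mult_left_mono[of _ _ "1 / sqrt (2 * pi)"] by fastforce
    then have *: "h x \<le> std_normal_density t * V x"
      unfolding h_def using mult_right_mono[OF _ V0(1)[of x]] by (fastforce simp: mult_ac)
    have "\<bar>s\<bar> \<le> 1" using s(2) abs_le_square_iff[of s 1] by simp
    moreover have "0 \<le> h x" using V0 by (simp add: h_def)
    ultimately have "\<bar>s\<bar> * h x \<le> h x" by (rule mult_left_le_one_le[rotated 2]) simp
    with * show ?thesis unfolding x_def by linarith
  qed
  have h0: "0 \<le> h x" for x using V0 by (simp add: h_def)
  have "ennreal (exp (- 2 * y\<^sup>2) * gauss_mass V)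
      = (\<integral>\<^sup>+x. ennreal (exp (- 2 * y\<^sup>2) * (V x * exp (- 3 * x\<^sup>2 / 2))) \<partial>std_gaussian)"
    unfolding gauss_mass_def using gauss_mass_bounds(3)[OF V V01] V0
    by (subst integral_mult_right_zero[symmetric], subst nn_integral_eq_integral) auto
  also have "\<dots> = (\<integral>\<^sup>+x. ennreal (h x) \<partial>lborel)"
    unfolding h_def using V0
    by (subst nn_integral_density) (auto simp: ennreal_mult[symmetric] mult_ac)
  also have "\<dots> = (\<integral>\<^sup>+t. ennreal \<bar>s\<bar> * ennreal (h (y + s * t)) \<partial>lborel)"
    by (subst nn_integral_real_affine[OF _ s0, of _ y]) (auto simp: nn_integral_cmult)
  also have "\<dots> \<le> (\<integral>\<^sup>+t. ennreal (std_normal_density t) * ennreal (V (y + s * t)) \<partial>lborel)"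
    using pt h0 V0 by (intro nn_integral_mono) (auto simp: ennreal_mult[symmetric] intro!: ennreal_leI)
  also have "\<dots> = (\<integral>\<^sup>+t. ennreal (V (y + s * t)) \<partial>std_gaussian)"
    by (subst nn_integral_density) auto
  also have "\<dots> = ennreal (\<integral>t. V (y + s * t) \<partial>std_gaussian)"
    using V0 by (intro nn_integral_eq_integral gauss_integrable_bounded[where B = 1]) auto
  finally show ?thesis
    using V0 by (subst (asm) ennreal_le_iff) (auto intro!: Bochner_Integration.integral_nonneg)
qed

lemma dot_commute: "dot N x y = dot N y x"
  by (simp add: dot_def mult.commute)

lemma dot_self_nonneg: "0 \<le> dot N x x"
  by (simp add: dot_def sum_nonneg)

lemma dot_self_eq_0: "dot N x x = 0 \<Longrightarrow> i < N \<Longrightarrow> x i = 0"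
  unfolding dot_def by (subst (asm) sum_nonneg_eq_0_iff) auto

text \<open>
The variable \<open>dot N g w / sqrt r\<close> is Gaussian of variance at most \<open>1 / 64\<close>, so 16 times its square is
dominated by a quarter of the square of a standard Gaussian.
\<close>

lemma gauss_dot_exp_square:
  assumes w: "64 * dot N w w \<le> r" and r: "0 < r"
  shows "(\<integral>\<^sup>+g. ennreal (exp (16 * (dot N g w)\<^sup>2 / r)) \<partial>gauss_vec N) \<le> 2"
proof (cases "dot N w w = 0")
  case True
  then have "dot N g w = 0" for g
    using dot_self_eq_0[OF True] by (simp add: dot_def)
  then show ?thesis
    using gauss_vec.emeasure_space_1 by simp
next
  case False
  define a where "a = dot N w w"
  have a: "0 < a" using False dot_self_nonneg[of N w] by (simp add: a_def)
  define u where "u = (\<lambda>i. w i / sqrt a)"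
  have u: "dot N u u = 1"
    using a by (simp add: dot_def u_def a_def[unfolded dot_def] sum_divide_distrib[symmetric])
  have gw: "dot N g w = sqrt a * dot N g u" for g
    using a by (simp add: dot_def u_def sum_distrib_left)
  have le: "16 * (sqrt a * z)\<^sup>2 / r \<le> z\<^sup>2 / 4" for z
  proof -
    have "64 * a * z\<^sup>2 \<le> r * z\<^sup>2"
      using w by (intro mult_right_mono) (auto simp: a_def)
    then show ?thesis using a r by (simp add: field_simps power_mult_distrib)
  qed
  have "(\<integral>\<^sup>+g. ennreal (exp (16 * (dot N g w)\<^sup>2 / r)) \<partial>gauss_vec N)
      = (\<integral>\<^sup>+z. ennreal (exp (16 * (sqrt a * z)\<^sup>2 / r)) \<partial>std_gaussian)"
    unfolding gw by (rule nn_integral_gauss_dot[OF u]) measurable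
  also have "\<dots> \<le> (\<integral>\<^sup>+z. ennreal (exp (z\<^sup>2 / 4)) \<partial>std_gaussian)"
    using le by (intro nn_integral_mono) (auto intro!: ennreal_leI)
  also have "\<dots> \<le> ennreal 2"
    unfolding gauss_exp_square by (intro ennreal_leI) (simp add: real_le_lsqrt)
  finally show ?thesis by simp
qed

text \<open>
The effect of one further replica \<open>J\<close>. The function \<open>H\<close> stands for the product over the earlier
replicas, and it is unchanged when the component of \<open>g\<close> along \<open>v\<close> is resampled. If \<open>J\<close> is almost parallel
to \<open>v\<close>, resampling turns \<open>dot N g J / sqrt N\<close> into \<open>y + s * t\<close> with a fresh Gaussian \<open>t\<close>, \<open>s\<^sup>2 \<ge> 63 / 64\<close>,
and \<open>y\<close> of variance \<open>1 - s\<^sup>2\<close>. The average of \<open>1 - V(y + s * t)\<close> over \<open>t\<close> is at most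
\<open>1 - gauss_mass V / sqrt k\<close> unless \<open>y\<^sup>2 > ln k / 4\<close>, and this event has probability of order \<open>k ^ (-4)\<close>
by the exponential Chebyshev inequality.
\<close>

lemma add_one_spin_vector:
  fixes k N :: nat
  assumes V [measurable]: "V \<in> borel_measurable borel" and V01: "\<And>x. V x \<in> {0..1}"
    and H [measurable]: "H \<in> borel_measurable (gauss_vec N)" and H01: "\<And>g. H g \<in> {0..1}"
    and Hv: "\<And>g t. H (resample N v t g) = H g"
    and v: "dot N v v = 1" and N: "0 < N" and J: "dot N J J = N"
    and Jv: "63 / 64 * N \<le> (dot N J v)\<^sup>2" and k: "0 < k"
  shows "(\<integral>g. H g * (1 - V (dot N g J / sqrt N)) \<partial>gauss_vec N)
      \<le> (1 - gauss_mass V / sqrt k) * (\<integral>g. H g \<partial>gauss_vec N) + 2 / real k ^ 4"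
proof -
  define b where "b = gauss_mass V"
  have b: "0 \<le> b" "b \<le> 1" using gauss_mass_bounds[OF V V01] by (auto simp: b_def)
  have H0: "0 \<le> H g" "H g \<le> 1" for g using H01[of g] by auto
  have V0: "0 \<le> V x" "V x \<le> 1" for x using V01[of x] by auto
  have HV: "0 \<le> H g * (1 - V x)" "H g * (1 - V x) \<le> 1" for g x
    using H0[of g] V0[of x] by (auto intro!: mult_le_one)
  define a where "a = dot N J v"
  define s where "s = a / sqrt N"
  define w where "w = (\<lambda>i. J i - a * v i)"
  define y where "y = (\<lambda>g. dot N g w / sqrt N)"
  have [measurable]: "y \<in> borel_measurable (gauss_vec N)" unfolding y_def by measurable
  have ww: "dot N w w = N - a\<^sup>2"
  proof -
    have "dot N w w = dot N J J - 2 * a * dot N J v + a\<^sup>2 * dot N v v"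
      by (simp add: dot_def w_def sum.distrib sum_subtractf sum_distrib_left algebra_simps power2_eq_square)
    then show ?thesis using v J by (simp add: a_def power2_eq_square)
  qed
  have s2: "s\<^sup>2 = a\<^sup>2 / N" by (simp add: s_def power_divide)
  have s: "1 / 2 \<le> s\<^sup>2" "s\<^sup>2 \<le> 1"
    unfolding s2 using Jv N dot_self_nonneg[of N w] ww by (auto simp: a_def field_simps)
  have X: "dot N (resample N v t g) J / sqrt N = y g + s * t" for t g
  proof -
    have "dot N g w = dot N g J - a * dot N g v"
      by (simp add: dot_def w_def sum_subtractf sum_distrib_left algebra_simps)
    then show ?thesis
      unfolding dot_resample y_def s_def
      by (simp add: a_def dot_commute[of N v J] add_divide_distrib[symmetric] algebra_simps)
  qed
  define q where "q = 1 - b / sqrt k"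
  have q: "0 \<le> q"
  proof -
    have "b / sqrt k \<le> 1 / 1" using b k by (intro frac_le) auto
    then show ?thesis by (simp add: q_def)
  qed
  have avg: "(\<integral>t. 1 - V (y + s * t) \<partial>std_gaussian) \<le> q + exp (16 * y\<^sup>2) / real k ^ 4" for y
  proof -
    (* The threshold ln k / 4 for y^2 makes exp (- 2 * y^2) at least 1 / sqrt k below it and the
       second summand at least 1 above it. *)
    have "(\<integral>t. 1 - V (y + s * t) \<partial>std_gaussian) = 1 - (\<integral>t. V (y + s * t) \<partial>std_gaussian)"
      using V0 gauss.prob_space
      by (subst Bochner_Integration.integral_diff) (auto intro!: gauss_integrable_bounded[where B = 1])
    also have "\<dots> \<le> 1 - exp (- 2 * y\<^sup>2) * b"
      using gauss_affine_lower_bound[OF V V01 s, of y] by (simp add: b_def)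
    also have "\<dots> \<le> q + exp (16 * y\<^sup>2) / real k ^ 4"
    proof (cases "4 * y\<^sup>2 \<le> ln k")
      case True
      have "1 / sqrt k = exp (- (ln k / 2))"
        using k by (simp add: exp_minus ln_sqrt[symmetric] inverse_eq_divide)
      also have "\<dots> \<le> exp (- 2 * y\<^sup>2)" using True by simp
      finally have "1 / sqrt k * b \<le> exp (- 2 * y\<^sup>2) * b" using b by (intro mult_right_mono)
      then have "1 - exp (- 2 * y\<^sup>2) * b \<le> q" by (simp add: q_def)
      moreover have "0 \<le> exp (16 * y\<^sup>2) / real k ^ 4" by simp
      ultimately show ?thesis by linarith
    next
      case False
      have "real k ^ 4 = exp (4 * ln k)"
        using k exp_of_nat_mult[of 4 "ln (real k)"] by simp
      also have "\<dots> \<le> exp (16 * y\<^sup>2)" using False by simp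
      finally have "1 \<le> exp (16 * y\<^sup>2) / real k ^ 4" using k by simp
      then show ?thesis using b q by (smt (verit) mult_nonneg_nonneg exp_ge_zero)
    qed
    finally show ?thesis .
  qed
  have int: "integrable (gauss_vec N) (\<lambda>g. H g * (1 - V (dot N g J / sqrt N)))" "integrable (gauss_vec N) H"
    using H0 HV by (auto intro!: gauss_vec.integrable_const_bound[where B = 1])
  have "ennreal (\<integral>g. H g * (1 - V (dot N g J / sqrt N)) \<partial>gauss_vec N)
      = (\<integral>\<^sup>+g. ennreal (H g * (1 - V (dot N g J / sqrt N))) \<partial>gauss_vec N)"
    using int H0 V0 by (subst nn_integral_eq_integral) auto
  also have "\<dots> = (\<integral>\<^sup>+g. \<integral>\<^sup>+t. ennreal (H (resample N v t g) * (1 - V (dot N (resample N v t g) J / sqrt N)))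
      \<partial>std_gaussian \<partial>gauss_vec N)"
    by (rule nn_integral_resample[OF v, symmetric]) measurable
  also have "\<dots> = (\<integral>\<^sup>+g. ennreal (H g * (\<integral>t. 1 - V (y g + s * t) \<partial>std_gaussian)) \<partial>gauss_vec N)"
    unfolding Hv X
  proof (rule nn_integral_cong)
    fix g
    show "(\<integral>\<^sup>+t. ennreal (H g * (1 - V (y g + s * t))) \<partial>std_gaussian)
        = ennreal (H g * (\<integral>t. 1 - V (y g + s * t) \<partial>std_gaussian))"
      using HV[of g] V0
      by (subst nn_integral_eq_integral) (auto intro!: gauss_integrable_bounded[where B = 1])
  qed
  also have "\<dots> \<le> (\<integral>\<^sup>+g. ennreal q * ennreal (H g) + ennreal (1 / real k ^ 4) * ennreal (exp (16 * (dot N g w)\<^sup>2 / N)) \<partial>gauss_vec N)"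
  proof (rule nn_integral_mono)
    fix g
    have "H g * (\<integral>t. 1 - V (y g + s * t) \<partial>std_gaussian) \<le> H g * (q + exp (16 * (y g)\<^sup>2) / real k ^ 4)"
      using avg H0 by (intro mult_left_mono)
    also have "\<dots> \<le> q * H g + exp (16 * (y g)\<^sup>2) / real k ^ 4"
      using mult_right_mono[OF H0(2)[of g], of "exp (16 * (y g)\<^sup>2) / real k ^ 4"] by (simp add: algebra_simps)
    also have "\<dots> = q * H g + (1 / real k ^ 4) * exp (16 * (dot N g w)\<^sup>2 / N)"
      by (simp add: y_def power_divide)
    finally show "ennreal (H g * (\<integral>t. 1 - V (y g + s * t) \<partial>std_gaussian))
        \<le> ennreal q * ennreal (H g) + ennreal (1 / real k ^ 4) * ennreal (exp (16 * (dot N g w)\<^sup>2 / N))"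
      using q H0 by (simp add: ennreal_mult[symmetric] ennreal_plus[symmetric] ennreal_leI del: ennreal_plus)
  qed
  also have "\<dots> = ennreal q * (\<integral>\<^sup>+g. ennreal (H g) \<partial>gauss_vec N)
      + ennreal (1 / real k ^ 4) * (\<integral>\<^sup>+g. ennreal (exp (16 * (dot N g w)\<^sup>2 / N)) \<partial>gauss_vec N)"
    by (simp add: nn_integral_add nn_integral_cmult)
  also have "\<dots> \<le> ennreal q * ennreal (\<integral>g. H g \<partial>gauss_vec N) + ennreal (1 / real k ^ 4) * 2"
  proof (intro add_mono mult_left_mono)
    show "(\<integral>\<^sup>+g. ennreal (H g) \<partial>gauss_vec N) \<le> ennreal (\<integral>g. H g \<partial>gauss_vec N)"
      using int H0 by (subst nn_integral_eq_integral) auto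
    show "(\<integral>\<^sup>+g. ennreal (exp (16 * (dot N g w)\<^sup>2 / N)) \<partial>gauss_vec N) \<le> 2"
      by (rule gauss_dot_exp_square) (use N Jv ww in \<open>auto simp: a_def\<close>)
  qed auto
  also have "\<dots> = ennreal (q * (\<integral>g. H g \<partial>gauss_vec N) + 2 / real k ^ 4)"
  proof -
    have "0 \<le> (\<integral>g. H g \<partial>gauss_vec N)" using H0 by (intro Bochner_Integration.integral_nonneg) auto
    moreover have "ennreal (1 / real k ^ 4) * 2 = ennreal (2 / real k ^ 4)"
      by (subst ennreal_numeral[symmetric], subst ennreal_mult[symmetric]) auto
    ultimately show ?thesis using q by (simp add: ennreal_mult ennreal_plus)
  qed
  finally show ?thesis
    using q H0 unfolding q_def b_def
    by (subst (asm) ennreal_le_iff) (auto intro!: Bochner_Integration.integral_nonneg add_nonneg_nonneg mult_nonneg_nonneg)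
qed

section \<open>Sign vectors near a low-dimensional subspace\<close>

text \<open>
The logarithm of \<open>cosh h\<close> is the log-moment generating function of a fair sign, so this is a case of
Hoeffding's lemma.
\<close>

lemma cosh_le_exp_half_square: "exp h + exp (- h) \<le> 2 * exp (h\<^sup>2 / 2)" for h :: real
proof -
  have *: "exp h + exp (- h) \<le> 2 * exp (h\<^sup>2 / 2)" if h: "0 \<le> h" for h :: real
  proof -
    have e: "1 + (1 / 2) * (exp (2 * h) - 1) = (1 + exp (2 * h)) / 2"
      by argo
    have "- (2 * h) * (1 / 2) + ln (1 + (1 / 2) * (exp (2 * h) - 1)) \<le> (2 * h)\<^sup>2 / 8"
      by (rule Hoeffdings_lemma_aux) (use h in auto)
    then have "ln ((1 + exp (2 * h)) / 2) \<le> h + h\<^sup>2 / 2"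
      unfolding e power_mult_distrib by simp
    then have "(1 + exp (2 * h)) / 2 \<le> exp (h + h\<^sup>2 / 2)"
      by (subst (asm) exp_le_cancel_iff[symmetric]) (simp add: add_pos_pos)
    then have "exp (- h) * ((1 + exp (2 * h)) / 2) \<le> exp (- h) * exp (h + h\<^sup>2 / 2)"
      by (intro mult_left_mono) auto
    then show ?thesis by (simp add: exp_add[symmetric] algebra_simps)
  qed
  show ?thesis
    using *[of h] *[of "- h"] by (cases "0 \<le> h") auto
qed

lemma gauss_mgf: "(\<integral>\<^sup>+z. ennreal (exp (a * z)) \<partial>std_gaussian) = ennreal (exp (a\<^sup>2 / 2))"
proof -
  have "ennreal (std_normal_density z) * ennreal (exp (a * z))
      = ennreal (exp (a\<^sup>2 / 2)) * ennreal (normal_density a 1 z)" for z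
  proof -
    have "exp (- z\<^sup>2 / 2) * exp (a * z) = exp (a\<^sup>2 / 2) * exp (- (z - a)\<^sup>2 / 2)"
      unfolding exp_add[symmetric] by (simp add: power2_eq_square field_simps)
    then have "std_normal_density z * exp (a * z) = exp (a\<^sup>2 / 2) * normal_density a 1 z"
      by (simp add: normal_density_def)
    then show ?thesis by (simp add: ennreal_mult[symmetric])
  qed
  then have "(\<integral>\<^sup>+z. ennreal (exp (a * z)) \<partial>std_gaussian)
      = ennreal (exp (a\<^sup>2 / 2)) * (\<integral>\<^sup>+z. ennreal (normal_density a 1 z) \<partial>lborel)"
    by (simp add: nn_integral_density nn_integral_cmult)
  also have "(\<integral>\<^sup>+z. ennreal (normal_density a 1 z) \<partial>lborel) = 1"
    by (subst nn_integral_eq_integral) auto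
  finally show ?thesis by simp
qed

definition orthonormal :: "nat \<Rightarrow> nat \<Rightarrow> (nat \<Rightarrow> nat \<Rightarrow> real) \<Rightarrow> bool" where
  "orthonormal N d e \<longleftrightarrow> (\<forall>i<d. \<forall>j<d. dot N (e i) (e j) = (if i = j then 1 else 0))"

lemma dot_sum_left: "dot N (\<lambda>n. \<Sum>i<d. c i * e i n) x = (\<Sum>i<d. c i * dot N (e i) x)"
proof -
  have "dot N (\<lambda>n. \<Sum>i<d. c i * e i n) x = (\<Sum>n<N. \<Sum>i<d. c i * (e i n * x n))"
    by (simp add: dot_def sum_distrib_right mult.assoc)
  also have "\<dots> = (\<Sum>i<d. c i * dot N (e i) x)"
    by (subst sum.swap) (simp add: dot_def sum_distrib_left)
  finally show ?thesis .
qed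

lemma dot_diff_left: "dot N (\<lambda>n. x n - y n) z = dot N x z - dot N y z"
  by (simp add: dot_def sum_subtractf algebra_simps)

lemma dot_scale_left: "dot N (\<lambda>n. x n / c) z = dot N x z / c"
  by (simp add: dot_def sum_divide_distrib)

lemma dot_cong_left: "(\<And>n. n < N \<Longrightarrow> x n = y n) \<Longrightarrow> dot N x z = dot N y z"
  by (simp add: dot_def)

definition residual :: "nat \<Rightarrow> nat \<Rightarrow> (nat \<Rightarrow> nat \<Rightarrow> real) \<Rightarrow> (nat \<Rightarrow> real) \<Rightarrow> nat \<Rightarrow> real" where
  "residual N d e J = (\<lambda>n. J n - (\<Sum>i<d. dot N J (e i) * e i n))"

lemma dot_residual_orthogonal:
  assumes e: "orthonormal N d e" and j: "j < d"
  shows "dot N (residual N d e J) (e j) = 0"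
proof -
  have "(\<Sum>i<d. dot N J (e i) * dot N (e i) (e j)) = (\<Sum>i<d. if i = j then dot N J (e i) else 0)"
    using e j by (intro sum.cong) (auto simp: orthonormal_def)
  also have "\<dots> = dot N J (e j)" using j by simp
  finally show ?thesis
    unfolding residual_def dot_diff_left dot_sum_left by simp
qed

lemma dot_residual:
  assumes e: "orthonormal N d e"
  shows "dot N (residual N d e J) J = dot N J J - (\<Sum>i<d. (dot N J (e i))\<^sup>2)"
    and "dot N (residual N d e J) (residual N d e J) = dot N J J - (\<Sum>i<d. (dot N J (e i))\<^sup>2)"
proof -
  show 1: "dot N (residual N d e J) J = dot N J J - (\<Sum>i<d. (dot N J (e i))\<^sup>2)"
    unfolding residual_def dot_diff_left dot_sum_left
    by (simp add: power2_eq_square dot_commute)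
  have "dot N (residual N d e J) (residual N d e J)
      = dot N J (residual N d e J) - (\<Sum>i<d. dot N J (e i) * dot N (e i) (residual N d e J))"
    by (subst (1) residual_def) (simp add: dot_diff_left dot_sum_left)
  also have "(\<Sum>i<d. dot N J (e i) * dot N (e i) (residual N d e J)) = 0"
    using dot_residual_orthogonal[OF e]
    by (intro sum.neutral) (simp add: dot_commute[of N _ "residual N d e J"])
  finally show "dot N (residual N d e J) (residual N d e J) = dot N J J - (\<Sum>i<d. (dot N J (e i))\<^sup>2)"
    using 1 by (simp add: dot_commute)
qed

text \<open>
Gram--Schmidt orthogonalisation with respect to \<open>dot N\<close>. Linearly dependent vectors are skipped, hence
\<open>d\<close> may be smaller than the number of vectors.
\<close>

lemma gram_schmidt:
  "\<exists>d e. d \<le> length Js \<and> orthonormal N d e \<and>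
    (\<forall>J\<in>set Js. \<exists>c. \<forall>n<N. J n = (\<Sum>i<d. c i * e i n))"
proof (induction Js)
  case Nil
  show ?case by (intro exI[of _ 0]) (simp add: orthonormal_def)
next
  case (Cons J Js)
  then obtain d e where d: "d \<le> length Js" and e: "orthonormal N d e"
    and span: "\<And>J. J \<in> set Js \<Longrightarrow> \<exists>c. \<forall>n<N. J n = (\<Sum>i<d. c i * e i n)" by blast
  define r where "r = residual N d e J"
  show ?case
  proof (cases "dot N r r = 0")
    case True
    have "J n = (\<Sum>i<d. dot N J (e i) * e i n)" if "n < N" for n
      using dot_self_eq_0[OF True that] by (simp add: r_def residual_def)
    then show ?thesis
      using d e span by (intro exI[of _ d] exI[of _ e]) auto
  next
    case False
    define a where "a = sqrt (dot N r r)"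
    have a: "a \<noteq> 0" "a * a = dot N r r"
      using False dot_self_nonneg[of N r] by (auto simp: a_def)
    define e' where "e' = e(d := (\<lambda>n. r n / a))"
    have re: "dot N r (e j) = 0" if "j < d" for j
      unfolding r_def by (rule dot_residual_orthogonal[OF e that])
    have "orthonormal N (Suc d) e'"
      unfolding orthonormal_def
    proof (intro allI impI)
      fix i j assume ij: "i < Suc d" "j < Suc d"
      consider "i < d" "j < d" | "i = d" "j < d" | "i < d" "j = d" | "i = d" "j = d"
        using ij by linarith
      then show "dot N (e' i) (e' j) = (if i = j then 1 else 0)"
      proof cases
        case 1 then show ?thesis using e by (auto simp: orthonormal_def e'_def)
      next
        case 2 then show ?thesis using re by (simp add: e'_def dot_scale_left)
      next
        case 3 then show ?thesis
          using re dot_commute[of N "e i"] by (simp add: e'_def dot_scale_left)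
      next
        case 4
        have "dot N (\<lambda>n. r n / a) (\<lambda>n. r n / a) = dot N r r / a / a"
          unfolding dot_scale_left by (subst dot_commute) (simp add: dot_scale_left)
        then show ?thesis using 4 a False by (simp add: e'_def field_simps)
      qed
    qed
    moreover have "\<exists>c. \<forall>n<N. J' n = (\<Sum>i<Suc d. c i * e' i n)" if "J' \<in> set (J # Js)" for J'
    proof (cases "J' = J")
      case True
      have "J n = (\<Sum>i<Suc d. (if i = d then a else dot N J (e i)) * e' i n)" for n
      proof -
        have "(\<Sum>i<d. (if i = d then a else dot N J (e i)) * e' i n) = (\<Sum>i<d. dot N J (e i) * e i n)"
          by (intro sum.cong) (auto simp: e'_def)
        then show ?thesis using a by (simp add: e'_def r_def residual_def)
      qed
      then show ?thesis using True by (intro exI[of _ "\<lambda>i. if i = d then a else dot N J (e i)"]) blast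
    next
      case False
      then obtain c where c: "\<forall>n<N. J' n = (\<Sum>i<d. c i * e i n)" using span \<open>J' \<in> set (J # Js)\<close> by auto
      have "(\<Sum>i<Suc d. (if i = d then 0 else c i) * e' i n) = (\<Sum>i<d. c i * e i n)" for n
      proof -
        have "(\<Sum>i<d. (if i = d then 0 else c i) * e' i n) = (\<Sum>i<d. c i * e i n)"
          by (intro sum.cong) (auto simp: e'_def)
        then show ?thesis by simp
      qed
      then show ?thesis using c by (intro exI[of _ "\<lambda>i. if i = d then 0 else c i"]) auto
    qed
    ultimately show ?thesis
      using d by (intro exI[of _ "Suc d"] exI[of _ e']) auto
  qed
qed

text \<open>
The witness is the normalised residual of \<open>J\<close>, along which \<open>J\<close> has its whole distance to the span of
the orthonormal system.
\<close>

lemma orthogonal_direction: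
  assumes e: "orthonormal N d e" and J: "dot N J J = N" and N: "0 < N"
    and good: "(\<Sum>i<d. (dot N J (e i))\<^sup>2) \<le> N / 64"
  obtains v where "dot N v v = 1" "\<And>i. i < d \<Longrightarrow> dot N v (e i) = 0" "63 / 64 * N \<le> (dot N J v)\<^sup>2"
proof -
  define r where "r = residual N d e J"
  define a where "a = sqrt (dot N r r)"
  have rr: "63 / 64 * N \<le> dot N r r" and rJ: "dot N r J = dot N r r"
    unfolding r_def dot_residual[OF e] using J good by simp_all
  then have rr0: "0 < dot N r r" using N by (smt (verit) mult_pos_pos of_nat_0_less_iff divide_pos_pos)
  then have a: "0 < a" "a * a = dot N r r" using rr0 by (auto simp: a_def)
  define v where "v = (\<lambda>n. r n / a)"
  show ?thesis
  proof (rule that)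
    have "dot N v v = dot N r r / a / a"
      unfolding v_def dot_scale_left by (subst dot_commute) (simp add: dot_scale_left)
    then show "dot N v v = 1" using a rr0 by (simp add: field_simps)
    show "dot N v (e i) = 0" if "i < d" for i
      unfolding v_def dot_scale_left r_def dot_residual_orthogonal[OF e that] by simp
    have "dot N J v = a"
      unfolding v_def by (subst dot_commute) (use a rJ in \<open>simp add: dot_scale_left field_simps\<close>)
    then show "63 / 64 * N \<le> (dot N J v)\<^sup>2"
      using a rr by (simp add: power2_eq_square)
  qed
qed

lemma finite_sign_vectors: "finite (sign_vectors N)"
  unfolding sign_vectors_def by (intro finite_PiE) auto

lemma card_sign_vectors: "card (sign_vectors N) = 2 ^ N"
  unfolding sign_vectors_def by (subst card_PiE) (auto simp: numeral_2_eq_2)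

lemma sign_vectors_dot_self: "J \<in> sign_vectors N \<Longrightarrow> dot N J J = N"
proof -
  assume J: "J \<in> sign_vectors N"
  have "J n * J n = 1" if "n < N" for n
  proof -
    have "J n \<in> {-1, 1}" using J that by (auto simp: sign_vectors_def PiE_iff)
    then show ?thesis by auto
  qed
  then show ?thesis by (simp add: dot_def)
qed

lemma sign_vectors_exp_linear:
  "(\<Sum>J\<in>sign_vectors N. exp (dot N J h)) \<le> 2 ^ N * exp (dot N h h / 2)"
proof -
  have "(\<Sum>J\<in>sign_vectors N. exp (dot N J h)) = (\<Sum>J\<in>sign_vectors N. \<Prod>n<N. exp (J n * h n))"
    by (simp add: dot_def exp_sum)
  also have "\<dots> = (\<Prod>n<N. \<Sum>s\<in>{-1, 1}. exp (s * h n))"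
    unfolding sign_vectors_def by (subst prod_sum_PiE) auto
  also have "\<dots> \<le> (\<Prod>n<N. 2 * exp ((h n)\<^sup>2 / 2))"
    using cosh_le_exp_half_square[of "h _"]
    by (intro prod_mono) (auto simp: add.commute intro: add_nonneg_nonneg)
  also have "\<dots> = 2 ^ N * exp (dot N h h / 2)"
    by (simp add: prod.distrib exp_sum[symmetric] dot_def power2_eq_square sum_divide_distrib)
  finally show ?thesis .
qed

text \<open>
For a uniformly random sign vector, the squared length of the projection onto a \<open>d\<close>-dimensional space has
an exponential moment that grows only exponentially in \<open>d\<close>. Each factor \<open>exp (a\<^sup>2 / 4)\<close> is written as the
moment generating function of a Gaussian at \<open>a / sqrt 2\<close>. This makes the exponent linear in \<open>J\<close>, so that
the sum over \<open>J\<close> factorises over coordinates and is sub-Gaussian. By orthonormality what remains is a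
product of \<open>d\<close> one-dimensional Gaussian integrals.
\<close>

lemma sign_vectors_exp_projection:
  assumes e: "orthonormal N d e"
  shows "(\<Sum>J\<in>sign_vectors N. exp ((\<Sum>i<d. (dot N J (e i))\<^sup>2) / 4)) \<le> 2 ^ N * exp (d / 2)"
proof -
  define h where "h = (\<lambda>z::nat \<Rightarrow> real. \<lambda>n. \<Sum>i<d. (z i / sqrt 2) * e i n)"
  have hh: "dot N (h z) (h z) / 2 = (\<Sum>i<d. (z i)\<^sup>2 / 4)" for z
  proof -
    have 1: "dot N (e i) (h z) = z i / sqrt 2" if "i < d" for i
    proof -
      have "dot N (e i) (h z) = (\<Sum>j<d. (z j / sqrt 2) * dot N (e j) (e i))"
        unfolding h_def by (subst dot_commute) (rule dot_sum_left)
      also have "\<dots> = (\<Sum>j<d. if j = i then z j / sqrt 2 else 0)"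
        using e that by (intro sum.cong) (auto simp: orthonormal_def)
      finally show ?thesis using that by simp
    qed
    have "dot N (h z) (h z) = (\<Sum>i<d. (z i / sqrt 2) * dot N (e i) (h z))"
      by (subst (1) h_def) (rule dot_sum_left)
    also have "\<dots> = (\<Sum>i<d. (z i)\<^sup>2 / 2)"
      using 1 by (intro sum.cong) (auto simp: power2_eq_square)
    finally show ?thesis by (simp add: sum_divide_distrib)
  qed
  have "ennreal (exp ((\<Sum>i<d. (dot N J (e i))\<^sup>2) / 4)) = (\<integral>\<^sup>+z. ennreal (exp (dot N J (h z))) \<partial>gauss_vec d)" for J
  proof -
    have "ennreal (exp ((\<Sum>i<d. (dot N J (e i))\<^sup>2) / 4))
        = (\<Prod>i<d. ennreal (exp ((dot N J (e i) / sqrt 2)\<^sup>2 / 2)))"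
      by (subst prod_ennreal) (auto simp: exp_sum[symmetric] sum_divide_distrib power_divide)
    also have "\<dots> = (\<Prod>i<d. \<integral>\<^sup>+t. ennreal (exp (dot N J (e i) / sqrt 2 * t)) \<partial>std_gaussian)"
      unfolding gauss_mgf ..
    also have "\<dots> = (\<integral>\<^sup>+z. (\<Prod>i<d. ennreal (exp (dot N J (e i) / sqrt 2 * z i))) \<partial>gauss_vec d)"
      unfolding gauss_vec_def by (rule gauss_prod.product_nn_integral_prod[symmetric]) auto
    also have "\<dots> = (\<integral>\<^sup>+z. ennreal (exp (dot N J (h z))) \<partial>gauss_vec d)"
    proof (rule nn_integral_cong)
      fix z :: "nat \<Rightarrow> real"
      have "(\<Sum>i<d. dot N J (e i) / sqrt 2 * z i) = dot N J (h z)"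
        unfolding h_def
        by (subst (2) dot_commute, subst dot_sum_left) (simp add: dot_commute[of N _ J] mult.commute)
      then show "(\<Prod>i<d. ennreal (exp (dot N J (e i) / sqrt 2 * z i))) = ennreal (exp (dot N J (h z)))"
        by (subst prod_ennreal) (auto simp: exp_sum[symmetric])
    qed
    finally show ?thesis .
  qed
  then have "ennreal (\<Sum>J\<in>sign_vectors N. exp ((\<Sum>i<d. (dot N J (e i))\<^sup>2) / 4))
      = (\<Sum>J\<in>sign_vectors N. \<integral>\<^sup>+z. ennreal (exp (dot N J (h z))) \<partial>gauss_vec d)"
    by (subst sum_ennreal[symmetric]) auto
  also have "\<dots> = (\<integral>\<^sup>+z. (\<Sum>J\<in>sign_vectors N. ennreal (exp (dot N J (h z)))) \<partial>gauss_vec d)"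
  proof (rule nn_integral_sum[symmetric])
    fix J
    have "(\<lambda>z. dot N J (h z)) \<in> borel_measurable (gauss_vec d)"
      unfolding dot_def h_def by measurable
    then show "(\<lambda>z. ennreal (exp (dot N J (h z)))) \<in> borel_measurable (gauss_vec d)" by measurable
  qed
  also have "\<dots> \<le> (\<integral>\<^sup>+z. ennreal (2 ^ N) * (\<Prod>i<d. ennreal (exp ((z i)\<^sup>2 / 4))) \<partial>gauss_vec d)"
  proof (rule nn_integral_mono)
    fix z :: "nat \<Rightarrow> real"
    have "(\<Sum>J\<in>sign_vectors N. exp (dot N J (h z))) \<le> 2 ^ N * exp (dot N (h z) (h z) / 2)"
      by (rule sign_vectors_exp_linear)
    also have "\<dots> = 2 ^ N * (\<Prod>i<d. exp ((z i)\<^sup>2 / 4))"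
      unfolding hh by (simp add: exp_sum)
    finally show "(\<Sum>J\<in>sign_vectors N. ennreal (exp (dot N J (h z))))
        \<le> ennreal (2 ^ N) * (\<Prod>i<d. ennreal (exp ((z i)\<^sup>2 / 4)))"
      by (subst sum_ennreal, simp) (subst prod_ennreal, simp, subst ennreal_mult[symmetric], auto intro: ennreal_leI prod_nonneg)
  qed
  also have "\<dots> = ennreal (2 ^ N) * (\<integral>\<^sup>+z. (\<Prod>i<d. ennreal (exp ((z i)\<^sup>2 / 4))) \<partial>gauss_vec d)"
    by (rule nn_integral_cmult) measurable
  also have "(\<integral>\<^sup>+z. (\<Prod>i<d. ennreal (exp ((z i)\<^sup>2 / 4))) \<partial>gauss_vec d) = (\<Prod>i<d. ennreal (sqrt 2))"
    unfolding gauss_vec_def gauss_exp_square[symmetric]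
    by (rule gauss_prod.product_nn_integral_prod) auto
  also have "(\<Prod>i<d. ennreal (sqrt 2)) \<le> ennreal (exp (d / 2))"
  proof -
    have "sqrt 2 \<le> exp (1 / 2)"
    proof (rule real_le_lsqrt)
      have "2 \<le> exp (1 :: real)" using exp_ge_add_one_self[of 1] by simp
      also have "\<dots> = (exp (1 / 2))\<^sup>2" by (simp add: power2_eq_square exp_add[symmetric])
      finally show "2 \<le> (exp (1 / 2 :: real))\<^sup>2" .
    qed auto
    then have "sqrt 2 ^ d \<le> exp (1 / 2) ^ d" by (intro power_mono) auto
    also have "\<dots> = exp (d / 2)" by (simp add: exp_of_nat_mult[symmetric])
    finally show ?thesis by (simp add: ennreal_power ennreal_leI)
  qed
  finally have "ennreal (\<Sum>J\<in>sign_vectors N. exp ((\<Sum>i<d. (dot N J (e i))\<^sup>2) / 4)) \<le> ennreal (2 ^ N) * ennreal (exp (d / 2))"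
    by (simp add: mult_left_mono)
  then show ?thesis
    by (simp add: ennreal_mult[symmetric] del: ennreal_power)
qed

text \<open>
Chebyshev's inequality with the exponential moment of the squared projection. The uniform measure of the
exceptional set is at most \<open>exp (d / 2 - N / 256)\<close>, which for \<open>d \<le> N / 1024\<close> beats the density
\<open>exp (N / 4096)\<close>: \<open>1 / 4096 + 1 / 2048 - 1 / 256 \<le> - 1 / 512\<close>.
\<close>

lemma spin_mass_near_subspace:
  fixes d N :: nat
  assumes le: "\<And>J. J \<in> sign_vectors N \<Longrightarrow> \<nu> J \<le> exp (N / 4096) / 2 ^ N"
    and e: "orthonormal N d e" and d: "1024 * d \<le> N"
  shows "(\<Sum>J | J \<in> sign_vectors N \<and> N / 64 < (\<Sum>i<d. (dot N J (e i))\<^sup>2). \<nu> J) \<le> exp (- (N / 512))"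
proof -
  define p where "p = (\<lambda>J. \<Sum>i<d. (dot N J (e i))\<^sup>2)"
  define c where "c = exp (N / 4096) / 2 ^ N * exp (- (N / 256))"
  have c: "0 \<le> c" by (simp add: c_def)
  have "(\<Sum>J | J \<in> sign_vectors N \<and> N / 64 < p J. \<nu> J)
      \<le> (\<Sum>J | J \<in> sign_vectors N \<and> N / 64 < p J. c * exp (p J / 4))"
  proof (rule sum_mono)
    fix J assume J: "J \<in> {J \<in> sign_vectors N. N / 64 < p J}"
    have "1 \<le> exp (- (N / 256)) * exp (p J / 4)"
      using J unfolding exp_add[symmetric] by simp
    then have "exp (N / 4096) / 2 ^ N * 1 \<le> exp (N / 4096) / 2 ^ N * (exp (- (N / 256)) * exp (p J / 4))"
      by (intro mult_left_mono) auto
    then show "\<nu> J \<le> c * exp (p J / 4)"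
      using le[of J] J by (simp add: c_def)
  qed
  also have "\<dots> \<le> (\<Sum>J\<in>sign_vectors N. c * exp (p J / 4))"
    using c by (intro sum_mono2) (auto simp: finite_sign_vectors)
  also have "\<dots> \<le> c * (2 ^ N * exp (d / 2))"
    unfolding sum_distrib_left[symmetric] p_def
    using c by (intro mult_left_mono sign_vectors_exp_projection[OF e])
  also have "\<dots> = exp (N / 4096 - N / 256 + d / 2)"
    unfolding c_def diff_conv_add_uminus exp_add by simp
  also have "\<dots> \<le> exp (- (N / 512))"
    using d by simp
  finally show ?thesis by (simp add: p_def)
qed

section \<open>Moments of a weighted average over sign vectors\<close>

definition spin_avg :: "nat \<Rightarrow> ((nat \<Rightarrow> real) \<Rightarrow> real) \<Rightarrow> (real \<Rightarrow> real) \<Rightarrow> (nat \<Rightarrow> real) \<Rightarrow> real" where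
  "spin_avg N \<nu> V g = (\<Sum>J\<in>sign_vectors N. \<nu> J * V (dot N g J / sqrt N))"

lemma measurable_spin_avg [measurable]:
  assumes [measurable]: "V \<in> borel_measurable borel"
  shows "spin_avg N \<nu> V \<in> borel_measurable (gauss_vec N)"
  unfolding spin_avg_def[abs_def] by measurable

lemma spin_avg_bounds:
  assumes V01: "\<And>x. V x \<in> {0..1::real}"
    and nn: "\<And>J. J \<in> sign_vectors N \<Longrightarrow> 0 \<le> \<nu> J" and sum1: "(\<Sum>J\<in>sign_vectors N. \<nu> J) = 1"
  shows "spin_avg N \<nu> V g \<in> {0..1}"
proof -
  have "0 \<le> spin_avg N \<nu> V g"
    unfolding spin_avg_def using nn V01 by (intro sum_nonneg mult_nonneg_nonneg) auto
  moreover have "spin_avg N \<nu> V g \<le> (\<Sum>J\<in>sign_vectors N. \<nu> J)"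
    unfolding spin_avg_def using nn V01 by (intro sum_mono mult_left_le) auto
  ultimately show ?thesis using sum1 by simp
qed

text \<open>
Here \<open>1 - spin_avg N \<nu> V g\<close> is the \<open>\<nu>\<close>-average of \<open>1 - V(dot N g J / sqrt N)\<close>, so its \<open>m\<close>-th power is the
average over \<open>m\<close> further independent replicas. One of them at a time is moved into the list \<open>Js\<close> of
explicit replicas. It is either close to their span, which has \<open>\<nu>\<close>-probability at most
\<open>exp (- (N / 512))\<close>, or it gains a factor \<open>1 - gauss_mass V / sqrt k\<close>. The list is kept general
because the induction needs the bound for all initial lists.
\<close>

lemma spin_avg_replica_bound:
  fixes k N m :: nat
  assumes V [measurable]: "V \<in> borel_measurable borel" and V01: "\<And>x. V x \<in> {0..1}"
    and nn: "\<And>J. J \<in> sign_vectors N \<Longrightarrow> 0 \<le> \<nu> J" and sum1: "(\<Sum>J\<in>sign_vectors N. \<nu> J) = 1"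
    and le: "\<And>J. J \<in> sign_vectors N \<Longrightarrow> \<nu> J \<le> exp (N / 4096) / 2 ^ N"
    and k: "0 < k" "1024 * k \<le> N"
    and Js: "set Js \<subseteq> sign_vectors N" "length Js + m \<le> k"
  shows "(\<integral>g. (\<Prod>J\<leftarrow>Js. 1 - V (dot N g J / sqrt N)) * (1 - spin_avg N \<nu> V g) ^ m \<partial>gauss_vec N)
      \<le> (1 - gauss_mass V / sqrt k) ^ m * (\<integral>g. (\<Prod>J\<leftarrow>Js. 1 - V (dot N g J / sqrt N)) \<partial>gauss_vec N)
        + m * (2 / real k ^ 4 + exp (- (N / 512)))"
  using Js
proof (induction m arbitrary: Js)
  case 0
  then show ?case by simp
next
  case (Suc m)
  define q where "q = 1 - gauss_mass V / sqrt k"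
  define T where "T = 2 / real k ^ 4"
  define \<beta> where "\<beta> = exp (- (real N / 512))"
  have T: "0 \<le> T" by (simp add: T_def)
  have q: "0 \<le> q" "q \<le> 1"
  proof -
    have b: "0 \<le> gauss_mass V" "gauss_mass V \<le> 1" by (fact gauss_mass_bounds[OF V V01])+
    have "gauss_mass V / sqrt k \<le> 1 / 1" using b k by (intro frac_le) auto
    then show "0 \<le> q" "q \<le> 1" using b by (auto simp: q_def)
  qed
  have N: "0 < N" using k by simp
  define H where "H = (\<lambda>Js g. \<Prod>J\<leftarrow>Js. 1 - V (dot N g J / sqrt N))"
  have H01: "H Js g \<in> {0..1}" for Js g
    unfolding H_def
  proof (induction Js)
    case (Cons J Js)
    then show ?case using V01[of "dot N g J / sqrt N"] by (auto intro: mult_le_one)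
  qed simp
  have [measurable]: "H Js \<in> borel_measurable (gauss_vec N)" for Js
    unfolding H_def by (induction Js) simp_all
  define F where "F = (\<lambda>g. 1 - spin_avg N \<nu> V g)"
  have F01: "F g \<in> {0..1}" for g
    using spin_avg_bounds[OF V01 nn sum1, where g = g] by (simp add: F_def)
  have [measurable]: "F \<in> borel_measurable (gauss_vec N)" unfolding F_def by measurable
  have int: "integrable (gauss_vec N) (\<lambda>g. H Js g * F g ^ j)" for Js j
  proof (rule gauss_vec.integrable_const_bound[where B = 1])
    have "\<bar>H Js g * F g ^ j\<bar> \<le> 1" for g
      using H01[of Js g] F01[of g] by (simp add: mult_le_one power_le_one)
    then show "AE g in gauss_vec N. norm (H Js g * F g ^ j) \<le> 1" by simp
  qed measurable
  have intH: "integrable (gauss_vec N) (H Js)" for Js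
    using int[of Js 0] by simp
  define E where "E = (\<lambda>Js. \<integral>g. H Js g \<partial>gauss_vec N)"
  have E01: "0 \<le> E Js" "E Js \<le> 1" for Js
    unfolding E_def using H01 intH[of Js]
    by (auto intro!: Bochner_Integration.integral_nonneg gauss_vec.integral_le_const)
  obtain d e where d: "d \<le> length Js" and e: "orthonormal N d e"
    and span: "\<And>J. J \<in> set Js \<Longrightarrow> \<exists>c. \<forall>n<N. J n = (\<Sum>i<d. c i * e i n)"
    using gram_schmidt[of Js N] by blast
  define bad where "bad = {J. J \<in> sign_vectors N \<and> N / 64 < (\<Sum>i<d. (dot N J (e i))\<^sup>2)}"
  have bad: "(\<Sum>J\<in>bad. \<nu> J) \<le> \<beta>"
    unfolding bad_def \<beta>_def by (rule spin_mass_near_subspace[OF le e]) (use d k Suc.prems in auto)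
  (* A bad replica is charged with the trivial bound 1; its weight under nu is what is small. *)
  have one: "E (J # Js) \<le> q * E Js + T + of_bool (J \<in> bad)" if J: "J \<in> sign_vectors N" for J
  proof (cases "J \<in> bad")
    case True
    then show ?thesis using E01[of "J # Js"] E01[of Js] q T
      by (simp add: add_increasing)
  next
    case False
    then have "(\<Sum>i<d. (dot N J (e i))\<^sup>2) \<le> N / 64" using J by (auto simp: bad_def)
    then obtain v where v: "dot N v v = 1" "\<And>i. i < d \<Longrightarrow> dot N v (e i) = 0" "63 / 64 * N \<le> (dot N J v)\<^sup>2"
      using orthogonal_direction[OF e sign_vectors_dot_self[OF J] N] by blast
    have vJ: "dot N v J' = 0" if J': "J' \<in> set Js" for J'
    proof -
      obtain c where "\<forall>n<N. J' n = (\<Sum>i<d. c i * e i n)" using span[OF J'] by blast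
      then have "dot N J' v = dot N (\<lambda>n. \<Sum>i<d. c i * e i n) v" by (intro dot_cong_left) auto
      also have "\<dots> = 0" unfolding dot_sum_left using v(2) by (intro sum.neutral) (simp add: dot_commute[of N _ v])
      finally show ?thesis by (simp add: dot_commute)
    qed
    have Hv: "H Js (resample N v t g) = H Js g" for g t
      unfolding H_def using vJ by (intro arg_cong[of _ _ prod_list] map_cong) (auto simp: dot_resample)
    have "E (J # Js) = (\<integral>g. H Js g * (1 - V (dot N g J / sqrt N)) \<partial>gauss_vec N)"
      by (simp add: E_def H_def mult.commute)
    also have "\<dots> \<le> q * E Js + T"
      unfolding q_def T_def E_def
      by (rule add_one_spin_vector[where H = "H Js", OF V V01 _ H01 Hv v(1) N sign_vectors_dot_self[OF J] v(3) k(1)]) measurable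
    finally show ?thesis using False by simp
  qed
  have decomp: "H Js g * F g ^ Suc m = (\<Sum>J\<in>sign_vectors N. \<nu> J * (H (J # Js) g * F g ^ m))" for g
  proof -
    have "F g = (\<Sum>J\<in>sign_vectors N. \<nu> J * (1 - V (dot N g J / sqrt N)))"
      unfolding F_def spin_avg_def by (simp add: sum_subtractf right_diff_distrib sum1)
    then show ?thesis
      by (simp add: H_def sum_distrib_left sum_distrib_right mult_ac)
  qed
  have "(\<integral>g. H Js g * F g ^ Suc m \<partial>gauss_vec N)
      = (\<Sum>J\<in>sign_vectors N. \<nu> J * (\<integral>g. H (J # Js) g * F g ^ m \<partial>gauss_vec N))"
    unfolding decomp using int by (subst Bochner_Integration.integral_sum) auto
  also have "\<dots> \<le> (\<Sum>J\<in>sign_vectors N. \<nu> J * (q ^ m * E (J # Js) + m * (T + \<beta>)))"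
  proof (intro sum_mono mult_left_mono nn)
    fix J assume "J \<in> sign_vectors N"
    then show "(\<integral>g. H (J # Js) g * F g ^ m \<partial>gauss_vec N) \<le> q ^ m * E (J # Js) + m * (T + \<beta>)"
      using Suc.IH[of "J # Js"] Suc.prems
      unfolding H_def F_def E_def q_def T_def \<beta>_def by simp
  qed
  also have "\<dots> = q ^ m * (\<Sum>J\<in>sign_vectors N. \<nu> J * E (J # Js)) + m * (T + \<beta>)"
  proof -
    have "(\<Sum>J\<in>sign_vectors N. \<nu> J * (m * (T + \<beta>))) = m * (T + \<beta>)"
      unfolding sum_distrib_right[symmetric] sum1 by simp
    then show ?thesis
      by (simp add: ring_distribs(1) sum.distrib sum_distrib_left mult.left_commute)
  qed
  also have "(\<Sum>J\<in>sign_vectors N. \<nu> J * E (J # Js)) \<le> q * E Js + (T + \<beta>)"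
  proof -
    have "(\<Sum>J\<in>sign_vectors N. \<nu> J * E (J # Js))
        \<le> (\<Sum>J\<in>sign_vectors N. \<nu> J * (q * E Js + T) + (if J \<in> bad then \<nu> J else 0))"
    proof (intro sum_mono)
      fix J assume J: "J \<in> sign_vectors N"
      show "\<nu> J * E (J # Js) \<le> \<nu> J * (q * E Js + T) + (if J \<in> bad then \<nu> J else 0)"
        using mult_left_mono[OF one[OF J] nn[OF J]] by (auto simp: algebra_simps)
    qed
    also have "\<dots> = (q * E Js + T) + (\<Sum>J\<in>bad. \<nu> J)"
    proof -
      have "(\<Sum>J\<in>sign_vectors N. if J \<in> bad then \<nu> J else 0) = (\<Sum>J\<in>bad. \<nu> J)"
        by (subst sum.inter_filter[symmetric, OF finite_sign_vectors]) (auto simp: bad_def intro: sum.cong)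
      then show ?thesis
        unfolding sum.distrib sum_distrib_right[symmetric] sum1 by simp
    qed
    finally show ?thesis using bad by simp
  qed
  then have "q ^ m * (\<Sum>J\<in>sign_vectors N. \<nu> J * E (J # Js)) + m * (T + \<beta>)
      \<le> q ^ m * (q * E Js + (T + \<beta>)) + m * (T + \<beta>)"
    using q by (intro add_right_mono mult_left_mono) auto
  also have "\<dots> \<le> q ^ Suc m * E Js + Suc m * (T + \<beta>)"
  proof -
    have "q ^ m * (T + \<beta>) \<le> 1 * (T + \<beta>)"
      using q T by (intro mult_right_mono power_le_one) (auto simp: \<beta>_def)
    then show ?thesis by (simp add: algebra_simps)
  qed
  finally show ?case
    unfolding H_def F_def E_def q_def T_def \<beta>_def .
qed

text \<open>
A quantitative form of the statement that a spread-out average is rarely close to 0: by Markov's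
inequality the left-hand side controls the probability that the average is at most \<open>1 / k\<close>.
\<close>

lemma spin_avg_small_ball:
  fixes k N :: nat
  assumes V: "V \<in> borel_measurable borel" and V01: "\<And>x. V x \<in> {0..1}"
    and nn: "\<And>J. J \<in> sign_vectors N \<Longrightarrow> 0 \<le> \<nu> J" and sum1: "(\<Sum>J\<in>sign_vectors N. \<nu> J) = 1"
    and le: "\<And>J. J \<in> sign_vectors N \<Longrightarrow> \<nu> J \<le> exp (N / 4096) / 2 ^ N"
    and k: "0 < k" "1024 * k \<le> N"
  shows "(\<integral>g. (1 - spin_avg N \<nu> V g) ^ k \<partial>gauss_vec N)
      \<le> exp (- gauss_mass V * sqrt k) + 2 / real k ^ 3 + k * exp (- (N / 512))"
proof -
  define q where "q = 1 - gauss_mass V / sqrt k"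
  have b: "0 \<le> gauss_mass V" "gauss_mass V \<le> 1" by (fact gauss_mass_bounds[OF V V01])+
  have q0: "0 \<le> q"
  proof -
    have "gauss_mass V / sqrt k \<le> 1 / 1" using b k by (intro frac_le) auto
    then show "0 \<le> q" by (simp add: q_def)
  qed
  have "q ^ k \<le> exp (- (gauss_mass V / sqrt k)) ^ k"
    using q0 exp_ge_add_one_self[of "- (gauss_mass V / sqrt k)"] by (intro power_mono) (auto simp: q_def)
  also have "\<dots> = exp (- gauss_mass V * sqrt k)"
  proof -
    have "real k * (gauss_mass V / sqrt k) = gauss_mass V * sqrt k"
      using k by (simp add: field_simps)
    then show ?thesis by (simp add: exp_of_nat_mult[symmetric])
  qed
  finally have q: "q ^ k \<le> exp (- gauss_mass V * sqrt k)" .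
  have "(\<integral>g. (1 - spin_avg N \<nu> V g) ^ k \<partial>gauss_vec N) \<le> q ^ k + k * (2 / real k ^ 4 + exp (- (N / 512)))"
    using spin_avg_replica_bound[OF V V01 nn sum1 le k, of "[]" k] gauss_vec.prob_space
    by (simp add: q_def)
  also have "k * (2 / real k ^ 4 + exp (- (N / 512))) = 2 / real k ^ 3 + k * exp (- (N / 512))"
    using k by (simp add: field_simps power_numeral_reduce)
  finally show ?thesis using q by simp
qed

section \<open>The truncated logarithm\<close>

lemma neg_ln_series:
  assumes "0 < x" "x \<le> (1::real)"
  shows "(\<lambda>k. (1 - x) ^ k / k) sums (- ln x)"
proof -
  have "\<bar>- (1 - x)\<bar> < 1" using assms by auto
  from sums_minus[OF ln_series'[OF this]] show ?thesis by simp
qed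

definition ln_partial :: "nat \<Rightarrow> real \<Rightarrow> real" where
  "ln_partial n x = (\<Sum>k\<le>n. (1 - x) ^ k / k)"

text \<open>
The remainder of the series after \<open>n\<close> terms is at most \<open>(1 - x) ^ n\<close> times the whole series, because
\<open>1 / (k + n) \<le> 1 / k\<close>.
\<close>

lemma neg_ln_remainder:
  assumes x: "0 < x" "x \<le> 1"
  shows "ln_partial n x \<le> - ln x" "- ln x \<le> ln_partial n x + (1 - x) ^ n * (- ln x)"
proof -
  define a where "a = (\<lambda>k. (1 - x) ^ k / real k)"
  have a: "a sums (- ln x)" unfolding a_def by (rule neg_ln_series[OF x])
  have a0: "0 \<le> a k" for k using x by (simp add: a_def)
  have P: "ln_partial n x = (\<Sum>k<Suc n. a k)"
    by (simp add: ln_partial_def a_def lessThan_Suc_atMost)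
  have summ: "summable a" and sa: "suminf a = - ln x"
    using a by (auto simp: sums_iff)
  have tail: "- ln x - ln_partial n x = (\<Sum>k. a (k + Suc n))"
    using suminf_split_initial_segment[OF summ, of "Suc n"] unfolding P sa by simp
  have summ': "summable (\<lambda>k. a (k + Suc n))" using summ by (simp only: summable_iff_shift)
  show "ln_partial n x \<le> - ln x"
    using suminf_nonneg[OF summ'] a0 tail by simp
  have "(\<Sum>k. a (k + Suc n)) \<le> (\<Sum>k. (1 - x) ^ n * a (Suc k))"
  proof (rule suminf_le[OF _ summ'])
    show "summable (\<lambda>k. (1 - x) ^ n * a (Suc k))"
      using summ by (intro summable_mult) (simp add: summable_Suc_iff)
    fix k
    have "(1 - x) ^ (k + Suc n) / real (k + Suc n) \<le> (1 - x) ^ (k + Suc n) / real (Suc k)"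
      using x by (intro divide_left_mono) auto
    then show "a (k + Suc n) \<le> (1 - x) ^ n * a (Suc k)"
      by (simp add: a_def power_add mult_ac)
  qed
  also have "\<dots> = (1 - x) ^ n * (- ln x)"
  proof -
    have "(\<Sum>k. a (Suc k)) = - ln x"
      using suminf_split_head[OF summ] sa by (simp add: a_def)
    then show ?thesis using summ by (subst suminf_mult) (auto simp: summable_Suc_iff)
  qed
  finally show "- ln x \<le> ln_partial n x + (1 - x) ^ n * (- ln x)"
    using tail by simp
qed

lemma ln_partial_nonneg: "x \<le> 1 \<Longrightarrow> 0 \<le> ln_partial n x"
  by (simp add: ln_partial_def sum_nonneg)

text \<open>
For \<open>x > exp (- A)\<close> the remainder of the series is at most \<open>A * (1 - x) ^ n\<close>. For smaller \<open>x\<close> the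
truncated logarithm is \<open>- A\<close>, and Bernoulli's inequality gives \<open>(1 - x) ^ n \<ge> 1 / 2\<close>, so that the
right-hand side is at least \<open>A\<close>.
\<close>

lemma trunc_log_ln_partial:
  assumes x: "x \<in> {0..1}" and A: "0 \<le> A" and nA: "n * exp (- A) \<le> 1 / 2"
  shows "\<bar>trunc_log A x + min A (ln_partial n x)\<bar> \<le> 2 * A * (1 - x) ^ n"
proof -
  have p: "0 \<le> (1 - x) ^ n" "0 \<le> ln_partial n x" using x ln_partial_nonneg by auto
  have Ap: "0 \<le> A * (1 - x) ^ n" using A p by simp
  show ?thesis
  proof (cases "exp (- A) < x")
    case True
    then have x0: "0 < x" by (smt (verit) exp_gt_zero)
    then have "- A < ln x" "ln x \<le> 0"
      using True x ln_less_cancel_iff[of "exp (- A)" x] by auto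
    then have l: "- ln x \<le> A" "0 \<le> - ln x" by linarith+
    have t: "trunc_log A x = ln x" using l x0 by (simp add: trunc_log_def)
    have "(1 - x) ^ n * (- ln x) \<le> (1 - x) ^ n * A" using l p by (intro mult_left_mono)
    moreover have "ln_partial n x \<le> - ln x" "- ln x \<le> ln_partial n x + (1 - x) ^ n * (- ln x)"
      using neg_ln_remainder[of x n] x0 x by auto
    ultimately show ?thesis unfolding t using l Ap by (simp add: mult_ac)
  next
    case False
    have t: "trunc_log A x = - A"
    proof (cases "x > 0")
      case True
      then have "ln x \<le> - A" using False by (simp add: not_less ln_le_cancel_iff[of x "exp (-A)", symmetric])
      then show ?thesis using True by (simp add: trunc_log_def)
    qed (simp add: trunc_log_def)
    have "n * x \<le> n * exp (- A)" using False by (intro mult_left_mono) auto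
    then have "1 / 2 \<le> 1 + n * (- x)" using nA by simp
    also have "\<dots> \<le> (1 + - x) ^ n" by (rule Bernoulli_inequality) (use x in auto)
    finally have "1 / 2 \<le> (1 - x) ^ n" by simp
    then have "2 * A * (1 / 2) \<le> 2 * A * (1 - x) ^ n" using A by (intro mult_left_mono) auto
    then show ?thesis unfolding t using A p by auto
  qed
qed

text \<open>
Each term \<open>(1 - x) ^ k / k\<close> is 1-Lipschitz on the unit interval. This is used for \<open>k \<le> K\<close>, and the other
terms are estimated by their size. The term with \<open>k = 0\<close> vanishes since division by 0 gives 0.
\<close>

lemma ln_partial_diff:
  assumes x: "x \<in> {0..1}" and y: "y \<in> {0..1}" and K: "K \<le> n"
  shows "\<bar>ln_partial n x - ln_partial n y\<bar>
    \<le> K * \<bar>x - y\<bar> + (\<Sum>k\<in>{K<..n}. ((1 - x) ^ k + (1 - y) ^ k) / k)"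
proof -
  have "{..n} = {..K} \<union> {K<..n}" using K by auto
  then have split: "ln_partial n z = ln_partial K z + (\<Sum>k\<in>{K<..n}. (1 - z) ^ k / k)" for z
    unfolding ln_partial_def by (simp add: sum.union_disjoint Int_def)
  have 1: "\<bar>ln_partial K x - ln_partial K y\<bar> \<le> K * \<bar>x - y\<bar>"
  proof -
    have "\<bar>ln_partial K x - ln_partial K y\<bar> \<le> (\<Sum>k\<le>K. \<bar>(1 - x) ^ k / k - (1 - y) ^ k / k\<bar>)"
      unfolding ln_partial_def sum_subtractf[symmetric] by (rule sum_abs)
    also have "\<dots> \<le> (\<Sum>k\<le>K. if k = 0 then 0 else \<bar>x - y\<bar>)"
    proof (rule sum_mono)
      fix k
      have "norm ((1 - x) ^ k - (1 - y) ^ k) \<le> k * norm ((1 - x) - (1 - y))"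
        using x y by (intro norm_power_diff) auto
      then show "\<bar>(1 - x) ^ k / k - (1 - y) ^ k / k\<bar> \<le> (if k = 0 then 0 else \<bar>x - y\<bar>)"
        by (auto simp: diff_divide_distrib[symmetric] divide_le_eq abs_minus_commute mult.commute)
    qed
    also have "\<dots> = K * \<bar>x - y\<bar>"
      by (induction K) (auto simp: algebra_simps)
    finally show ?thesis .
  qed
  have 2: "\<bar>(\<Sum>k\<in>{K<..n}. (1 - x) ^ k / k) - (\<Sum>k\<in>{K<..n}. (1 - y) ^ k / k)\<bar>
      \<le> (\<Sum>k\<in>{K<..n}. ((1 - x) ^ k + (1 - y) ^ k) / k)"
  proof -
    have "0 \<le> (\<Sum>k\<in>{K<..n}. (1 - z) ^ k / k)" if "z \<in> {0..1}" for z
      using that by (intro sum_nonneg) auto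
    from this[OF x] this[OF y] show ?thesis
      by (simp add: add_divide_distrib sum.distrib)
  qed
  show ?thesis using 1 2 unfolding split[of x] split[of y] by linarith
qed

lemma trunc_log_diff:
  assumes x: "x \<in> {0..1}" and y: "y \<in> {0..1}" and A: "0 \<le> A" and nA: "n * exp (- A) \<le> 1 / 2"
    and K: "K \<le> n"
  shows "\<bar>trunc_log A x - trunc_log A y\<bar>
    \<le> K * \<bar>x - y\<bar> + (\<Sum>k\<in>{K<..n}. ((1 - x) ^ k + (1 - y) ^ k) / k) + 2 * A * ((1 - x) ^ n + (1 - y) ^ n)"
proof -
  let ?p = "min A (ln_partial n x)" and ?q = "min A (ln_partial n y)"
  have "\<bar>trunc_log A x - trunc_log A y\<bar> \<le> \<bar>?p - ?q\<bar> + (\<bar>trunc_log A x + ?p\<bar> + \<bar>trunc_log A y + ?q\<bar>)"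
  proof -
    have "\<bar>s - t\<bar> \<le> \<bar>p - q\<bar> + (\<bar>s + p\<bar> + \<bar>t + q\<bar>)" for s t p q :: real by linarith
    then show ?thesis .
  qed
  also have "\<bar>?p - ?q\<bar> \<le> \<bar>ln_partial n x - ln_partial n y\<bar>"
    by linarith
  also have "\<dots> \<le> K * \<bar>x - y\<bar> + (\<Sum>k\<in>{K<..n}. ((1 - x) ^ k + (1 - y) ^ k) / k)"
    by (rule ln_partial_diff[OF x y K])
  also have "\<bar>trunc_log A x + ?p\<bar> + \<bar>trunc_log A y + ?q\<bar> \<le> 2 * A * (1 - x) ^ n + 2 * A * (1 - y) ^ n"
    by (intro add_mono trunc_log_ln_partial x y A nA)
  finally show ?thesis by (simp add: distrib_left)
qed

text \<open>
Up to the constant \<open>ln W\<close>, multiplication by \<open>W \<le> 1\<close> only raises the level of truncation, and truncation is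
1-Lipschitz.
\<close>

lemma trunc_log_scale:
  assumes W: "0 < W" "W \<le> 1" and A: "0 \<le> A" and x: "0 \<le> x" and y: "0 \<le> y"
  shows "\<bar>trunc_log A (W * x) - trunc_log A (W * y)\<bar> \<le> \<bar>trunc_log A x - trunc_log A y\<bar>"
proof -
  have lnW: "ln W \<le> 0" using W by simp
  have "trunc_log A (W * z) = max (- A) (ln W + trunc_log A z)" if "0 \<le> z" for z
  proof (cases "z = 0")
    case False
    then have "trunc_log A (W * z) = max (- A) (ln W + ln z)" "trunc_log A z = max (- A) (ln z)"
      using W that by (auto simp: trunc_log_def ln_mult)
    then show ?thesis using lnW by linarith
  qed (use lnW in \<open>simp add: trunc_log_def\<close>)
  then show ?thesis using x y by simp
qed

lemma trunc_log_bounds: "0 \<le> A \<Longrightarrow> x \<le> 1 \<Longrightarrow> trunc_log A x \<in> {- A..0}"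
  by (auto simp: trunc_log_def)

lemma trunc_log_small: "x \<le> exp (- A) \<Longrightarrow> trunc_log A x = - A"
proof (cases "x > 0")
  case True
  assume "x \<le> exp (- A)"
  then have "ln x \<le> - A" using True by (simp add: ln_le_cancel_iff[of x "exp (-A)", symmetric])
  then show ?thesis using True by (simp add: trunc_log_def)
qed (simp add: trunc_log_def)

lemma measurable_trunc_log [measurable]: "trunc_log A \<in> borel_measurable borel"
  unfolding trunc_log_def[abs_def] by measurable

section \<open>Replacing the activation function in one row\<close>

text \<open>
The bound of \<open>spin_avg_small_ball\<close> for the \<open>k\<close>-th moment, with a lower bound \<open>b\<close> for \<open>gauss_mass\<close>.
\<close>

definition replica_error :: "real \<Rightarrow> nat \<Rightarrow> nat \<Rightarrow> real" where
  "replica_error b N k = exp (- b * sqrt k) + 2 / real k ^ 3 + k * exp (- (N / 512))"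

lemma replica_error_nonneg: "0 \<le> replica_error b N k"
  by (simp add: replica_error_def)

text \<open>
The effect of one row on the expected logarithm truncated at \<open>- A\<close>, when the activation functions are at \<open>L\<^sup>1\<close>
distance \<open>\<epsilon>\<close>, \<open>K\<close> terms of the logarithmic series are treated by their Lipschitz constant, and the series
is cut at \<open>n\<close>.
\<close>

definition row_error :: "real \<Rightarrow> real \<Rightarrow> nat \<Rightarrow> nat \<Rightarrow> nat \<Rightarrow> real \<Rightarrow> real" where
  "row_error A b N K n \<epsilon> =
     K * \<epsilon> + (\<Sum>k\<in>{K<..n}. 2 * replica_error b N k / k) + 4 * A * replica_error b N n"

text \<open>
For each sign vector \<open>J\<close> the variable \<open>dot N g J / sqrt N\<close> is a standard Gaussian, so the \<open>L\<^sup>1\<close> distance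
does not increase under averaging over \<open>J\<close>.
\<close>

lemma spin_avg_L1_diff:
  assumes V [measurable]: "V \<in> borel_measurable borel" and V01: "\<And>x. V x \<in> {0..1}"
    and U [measurable]: "U \<in> borel_measurable borel" and U01: "\<And>x. U x \<in> {0..1}"
    and nn: "\<And>J. J \<in> sign_vectors N \<Longrightarrow> 0 \<le> \<nu> J" and sum1: "(\<Sum>J\<in>sign_vectors N. \<nu> J) = 1"
    and N: "0 < N"
  shows "(\<integral>g. \<bar>spin_avg N \<nu> V g - spin_avg N \<nu> U g\<bar> \<partial>gauss_vec N) \<le> (\<integral>x. \<bar>V x - U x\<bar> \<partial>std_gaussian)"
proof -
  define f where "f = (\<lambda>x. \<bar>V x - U x\<bar>)"
  have [measurable]: "f \<in> borel_measurable borel" unfolding f_def by measurable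
  have f01: "0 \<le> f x" "f x \<le> 1" for x using V01[of x] U01[of x] by (auto simp: f_def)
  have int: "integrable (gauss_vec N) (\<lambda>g. f (dot N g J / sqrt N))" for J
    by (rule gauss_vec.integrable_const_bound[where B = 1]) (use f01 in auto)
  have eq: "(\<integral>g. f (dot N g J / sqrt N) \<partial>gauss_vec N) = (\<integral>x. f x \<partial>std_gaussian)"
    if J: "J \<in> sign_vectors N" for J
  proof -
    define u where "u = (\<lambda>n. J n / sqrt N)"
    have u: "dot N u u = 1"
    proof -
      have "dot N u u = dot N J J / sqrt N / sqrt N"
        unfolding u_def dot_scale_left by (subst dot_commute) (simp add: dot_scale_left)
      then show ?thesis using sign_vectors_dot_self[OF J] N by (simp add: field_simps)
    qed
    have gu: "dot N g J / sqrt N = dot N g u" for g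
      unfolding u_def by (subst (1 2) dot_commute) (simp add: dot_scale_left)
    have "ennreal (\<integral>g. f (dot N g J / sqrt N) \<partial>gauss_vec N) = (\<integral>\<^sup>+g. ennreal (f (dot N g J / sqrt N)) \<partial>gauss_vec N)"
      using int f01 by (subst nn_integral_eq_integral) auto
    also have "\<dots> = (\<integral>\<^sup>+x. ennreal (f x) \<partial>std_gaussian)"
      unfolding gu by (rule nn_integral_gauss_dot[OF u]) measurable
    also have "\<dots> = ennreal (\<integral>x. f x \<partial>std_gaussian)"
      using f01 by (intro nn_integral_eq_integral gauss_integrable_bounded[where B = 1]) auto
    finally show ?thesis
      using f01 by (subst (asm) ennreal_inj) (auto intro!: Bochner_Integration.integral_nonneg)
  qed
  have pt: "\<bar>spin_avg N \<nu> V g - spin_avg N \<nu> U g\<bar> \<le> (\<Sum>J\<in>sign_vectors N. \<nu> J * f (dot N g J / sqrt N))" for g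
    unfolding spin_avg_def sum_subtractf[symmetric] right_diff_distrib[symmetric] f_def
    by (intro order_trans[OF sum_abs] sum_mono) (simp add: abs_mult nn)
  have intm: "integrable (gauss_vec N) (\<lambda>g. \<bar>spin_avg N \<nu> V g - spin_avg N \<nu> U g\<bar>)"
  proof (rule gauss_vec.integrable_const_bound[where B = 1])
    have "\<bar>spin_avg N \<nu> V g - spin_avg N \<nu> U g\<bar> \<le> 1" for g
      using spin_avg_bounds[where V = V and g = g, OF V01 nn sum1] spin_avg_bounds[where V = U and g = g, OF U01 nn sum1] by auto
    then show "AE g in gauss_vec N. norm \<bar>spin_avg N \<nu> V g - spin_avg N \<nu> U g\<bar> \<le> 1" by simp
  qed measurable
  have "(\<integral>g. \<bar>spin_avg N \<nu> V g - spin_avg N \<nu> U g\<bar> \<partial>gauss_vec N)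
      \<le> (\<integral>g. (\<Sum>J\<in>sign_vectors N. \<nu> J * f (dot N g J / sqrt N)) \<partial>gauss_vec N)"
    using int pt intm by (intro integral_mono) auto
  also have "\<dots> = (\<Sum>J\<in>sign_vectors N. \<nu> J * (\<integral>x. f x \<partial>std_gaussian))"
    using int eq by (subst Bochner_Integration.integral_sum) (auto intro!: sum.cong)
  also have "\<dots> = (\<integral>x. f x \<partial>std_gaussian)"
    unfolding sum_distrib_right[symmetric] sum1 by simp
  finally show ?thesis by (simp add: f_def)
qed

lemma trunc_log_spin_avg_diff:
  fixes n N K :: nat
  assumes V [measurable]: "V \<in> borel_measurable borel" and V01: "\<And>x. V x \<in> {0..1}"
    and U [measurable]: "U \<in> borel_measurable borel" and U01: "\<And>x. U x \<in> {0..1}"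
    and bV: "b \<le> gauss_mass V" and bU: "b \<le> gauss_mass U"
    and nn: "\<And>J. J \<in> sign_vectors N \<Longrightarrow> 0 \<le> \<nu> J" and sum1: "(\<Sum>J\<in>sign_vectors N. \<nu> J) = 1"
    and le: "\<And>J. J \<in> sign_vectors N \<Longrightarrow> \<nu> J \<le> exp (N / 4096) / 2 ^ N"
    and n: "0 < n" "1024 * n \<le> N" and K: "K \<le> n" and A: "0 \<le> A" and nA: "n * exp (- A) \<le> 1 / 2"
  shows "(\<integral>g. \<bar>trunc_log A (spin_avg N \<nu> V g) - trunc_log A (spin_avg N \<nu> U g)\<bar> \<partial>gauss_vec N)
      \<le> row_error A b N K n (\<integral>x. \<bar>V x - U x\<bar> \<partial>std_gaussian)"
proof -
  let ?x = "spin_avg N \<nu> V" and ?y = "spin_avg N \<nu> U"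
  have N: "0 < N" using n by simp
  have x01: "?x g \<in> {0..1}" and y01: "?y g \<in> {0..1}" for g
    using spin_avg_bounds[where V = V, OF V01 nn sum1] spin_avg_bounds[where V = U, OF U01 nn sum1] by blast+
  have int: "integrable (gauss_vec N) (\<lambda>g. (1 - ?x g) ^ k)" "integrable (gauss_vec N) (\<lambda>g. (1 - ?y g) ^ k)" for k
    using x01 y01 by (auto intro!: gauss_vec.integrable_const_bound[where B = 1] simp: power_le_one power_abs[symmetric])
  have intd: "integrable (gauss_vec N) (\<lambda>g. \<bar>?x g - ?y g\<bar>)"
  proof (rule gauss_vec.integrable_const_bound[where B = 1])
    have "\<bar>?x g - ?y g\<bar> \<le> 1" for g using x01[of g] y01[of g] by auto
    then show "AE g in gauss_vec N. norm \<bar>?x g - ?y g\<bar> \<le> 1" by simp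
  qed measurable
  have intt: "integrable (gauss_vec N) (\<lambda>g. \<bar>trunc_log A (?x g) - trunc_log A (?y g)\<bar>)"
  proof (rule gauss_vec.integrable_const_bound[where B = A])
    have "\<bar>trunc_log A (?x g) - trunc_log A (?y g)\<bar> \<le> A" for g
      using trunc_log_bounds[OF A, of "?x g"] trunc_log_bounds[OF A, of "?y g"] x01[of g] y01[of g] by auto
    then show "AE g in gauss_vec N. norm \<bar>trunc_log A (?x g) - trunc_log A (?y g)\<bar> \<le> A" by simp
  qed measurable
  have mom: "(\<integral>g. (1 - ?x g) ^ k \<partial>gauss_vec N) \<le> replica_error b N k"
      "(\<integral>g. (1 - ?y g) ^ k \<partial>gauss_vec N) \<le> replica_error b N k" if k: "0 < k" "k \<le> n" for k
  proof -
    have k2: "1024 * k \<le> N" using k n by simp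
    have "exp (- gauss_mass V * sqrt k) \<le> exp (- b * sqrt k)" "exp (- gauss_mass U * sqrt k) \<le> exp (- b * sqrt k)"
      using bV bU by (auto intro!: mult_right_mono)
    then show "(\<integral>g. (1 - ?x g) ^ k \<partial>gauss_vec N) \<le> replica_error b N k"
        "(\<integral>g. (1 - ?y g) ^ k \<partial>gauss_vec N) \<le> replica_error b N k"
      using spin_avg_small_ball[OF V V01 nn sum1 le k(1) k2] spin_avg_small_ball[OF U U01 nn sum1 le k(1) k2]
      unfolding replica_error_def by linarith+
  qed
  have "(\<integral>g. \<bar>trunc_log A (?x g) - trunc_log A (?y g)\<bar> \<partial>gauss_vec N)
      \<le> (\<integral>g. K * \<bar>?x g - ?y g\<bar> + (\<Sum>k\<in>{K<..n}. ((1 - ?x g) ^ k + (1 - ?y g) ^ k) / k)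
        + 2 * A * ((1 - ?x g) ^ n + (1 - ?y g) ^ n) \<partial>gauss_vec N)"
    using int intd intt trunc_log_diff[OF x01 y01 A nA K]
    by (intro integral_mono) auto
  also have "\<dots> = K * (\<integral>g. \<bar>?x g - ?y g\<bar> \<partial>gauss_vec N)
      + (\<Sum>k\<in>{K<..n}. ((\<integral>g. (1 - ?x g) ^ k \<partial>gauss_vec N) + (\<integral>g. (1 - ?y g) ^ k \<partial>gauss_vec N)) / k)
      + 2 * A * ((\<integral>g. (1 - ?x g) ^ n \<partial>gauss_vec N) + (\<integral>g. (1 - ?y g) ^ n \<partial>gauss_vec N))"
    using int intd by simp
  also have "\<dots> \<le> row_error A b N K n (\<integral>x. \<bar>V x - U x\<bar> \<partial>std_gaussian)"
    unfolding row_error_def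
  proof (intro add_mono sum_mono divide_right_mono)
    show "K * (\<integral>g. \<bar>?x g - ?y g\<bar> \<partial>gauss_vec N) \<le> K * (\<integral>x. \<bar>V x - U x\<bar> \<partial>std_gaussian)"
      by (intro mult_left_mono spin_avg_L1_diff[OF V V01 U U01 nn sum1 N]) auto
    show "(\<integral>g. (1 - ?x g) ^ k \<partial>gauss_vec N) + (\<integral>g. (1 - ?y g) ^ k \<partial>gauss_vec N) \<le> 2 * replica_error b N k"
      if "k \<in> {K<..n}" for k
      using mom[of k] that by simp
    have "2 * A * ((\<integral>g. (1 - ?x g) ^ n \<partial>gauss_vec N) + (\<integral>g. (1 - ?y g) ^ n \<partial>gauss_vec N)) \<le> 2 * A * (2 * replica_error b N n)"
      using mom[of n] n A by (intro mult_left_mono) auto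
    then show "2 * A * ((\<integral>g. (1 - ?x g) ^ n \<partial>gauss_vec N) + (\<integral>g. (1 - ?y g) ^ n \<partial>gauss_vec N)) \<le> 4 * A * replica_error b N n"
      by simp
  qed auto
  finally show ?thesis .
qed

text \<open>
If the total weight is at most \<open>exp (- A) * 2 ^ N\<close>, both logarithms are truncated and the difference is 0.
Otherwise the normalised weights have density at most \<open>exp A\<close> with respect to the uniform measure, and
\<open>trunc_log_scale\<close> removes the normalisation.
\<close>

lemma trunc_log_row_replacement:
  fixes n N K :: nat
  assumes V [measurable]: "V \<in> borel_measurable borel" and V01: "\<And>x. V x \<in> {0..1}"
    and U [measurable]: "U \<in> borel_measurable borel" and U01: "\<And>x. U x \<in> {0..1}"
    and bV: "b \<le> gauss_mass V" and bU: "b \<le> gauss_mass U"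
    and w: "\<And>J. J \<in> sign_vectors N \<Longrightarrow> w J \<in> {0..1}"
    and n: "0 < n" "1024 * n \<le> N" and K: "K \<le> n" and A: "0 \<le> A" "A \<le> N / 4096" and nA: "n * exp (- A) \<le> 1 / 2"
  shows "(\<integral>g. \<bar>trunc_log A ((\<Sum>J\<in>sign_vectors N. w J * V (dot N g J / sqrt N)) / 2 ^ N)
          - trunc_log A ((\<Sum>J\<in>sign_vectors N. w J * U (dot N g J / sqrt N)) / 2 ^ N)\<bar> \<partial>gauss_vec N)
      \<le> row_error A b N K n (\<integral>x. \<bar>V x - U x\<bar> \<partial>std_gaussian)" (is "?lhs \<le> ?R")
proof -
  define W where "W = (\<Sum>J\<in>sign_vectors N. w J) / 2 ^ N"
  have W1: "W \<le> 1"
  proof -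
    have "(\<Sum>J\<in>sign_vectors N. w J) \<le> (\<Sum>J\<in>sign_vectors N. 1)" using w by (intro sum_mono) auto
    then show ?thesis by (simp add: W_def card_sign_vectors)
  qed
  have W_ge: "(\<Sum>J\<in>sign_vectors N. w J * X (dot N g J / sqrt N)) / 2 ^ N \<le> W"
    if "\<And>x. X x \<in> {0..1}" for X :: "real \<Rightarrow> real" and g
    unfolding W_def using that w by (intro divide_right_mono sum_mono mult_left_le) auto
  show ?thesis
  proof (cases "W \<le> exp (- A)")
    case True
    have tl: "trunc_log A ((\<Sum>J\<in>sign_vectors N. w J * X (dot N g J / sqrt N)) / 2 ^ N) = - A"
      if "\<And>x. X x \<in> {0..1}" for X :: "real \<Rightarrow> real" and g
      by (rule trunc_log_small) (use W_ge[of X g, OF that] True in linarith)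
    have "0 \<le> ?R"
      unfolding row_error_def
      by (intro add_nonneg_nonneg sum_nonneg mult_nonneg_nonneg divide_nonneg_nonneg replica_error_nonneg
           Bochner_Integration.integral_nonneg) (use A in auto)
    then show ?thesis unfolding tl[of V, OF V01] tl[of U, OF U01] by simp
  next
    case False
    then have W0: "0 < W" "exp (- A) < W" using exp_gt_zero[of "- A"] by linarith+
    define \<nu> where "\<nu> = (\<lambda>J. w J / (W * 2 ^ N))"
    have nn: "0 \<le> \<nu> J" if "J \<in> sign_vectors N" for J
      using w[OF that] W0 by (simp add: \<nu>_def)
    have sum1: "(\<Sum>J\<in>sign_vectors N. \<nu> J) = 1"
    proof -
      have "(\<Sum>J\<in>sign_vectors N. w J) = W * 2 ^ N" by (simp add: W_def)
      then show ?thesis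
        unfolding \<nu>_def sum_divide_distrib[symmetric] using W0 by simp
    qed
    have le: "\<nu> J \<le> exp (N / 4096) / 2 ^ N" if J: "J \<in> sign_vectors N" for J
    proof -
      have "1 = exp (N / 4096) * exp (- (N / 4096))" by (simp add: exp_add[symmetric])
      also have "\<dots> \<le> exp (N / 4096) * W"
        using W0 A by (intro mult_left_mono order_trans[OF _ less_imp_le[OF W0(2)]]) auto
      finally have "w J \<le> exp (N / 4096) * W" using w[OF J] by auto
      then show ?thesis using W0 by (simp add: \<nu>_def field_simps)
    qed
    have eq: "(\<Sum>J\<in>sign_vectors N. w J * X (dot N g J / sqrt N)) / 2 ^ N = W * spin_avg N \<nu> X g" for X g
      unfolding spin_avg_def \<nu>_def using W0 by (simp add: sum_distrib_left sum_divide_distrib)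
    have x01: "spin_avg N \<nu> V g \<in> {0..1}" and y01: "spin_avg N \<nu> U g \<in> {0..1}" for g
      using spin_avg_bounds[where V = V, OF V01 nn sum1] spin_avg_bounds[where V = U, OF U01 nn sum1] by blast+
    have bd: "\<bar>trunc_log A x - trunc_log A y\<bar> \<le> A" if "x \<le> 1" "y \<le> 1" for x y
      using trunc_log_bounds[OF A(1) that(1)] trunc_log_bounds[OF A(1) that(2)] by auto
    have W_spin: "W * spin_avg N \<nu> V g \<le> 1" "W * spin_avg N \<nu> U g \<le> 1" for g
      using x01[of g] y01[of g] W0 W1 by (auto intro!: mult_le_one)
    have "?lhs \<le> (\<integral>g. \<bar>trunc_log A (spin_avg N \<nu> V g) - trunc_log A (spin_avg N \<nu> U g)\<bar> \<partial>gauss_vec N)"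
      unfolding eq
    proof (rule integral_mono)
      show "integrable (gauss_vec N) (\<lambda>g. \<bar>trunc_log A (W * spin_avg N \<nu> V g) - trunc_log A (W * spin_avg N \<nu> U g)\<bar>)"
        by (rule gauss_vec.integrable_const_bound[where B = A])
          (use bd[OF W_spin] in auto)
      show "integrable (gauss_vec N) (\<lambda>g. \<bar>trunc_log A (spin_avg N \<nu> V g) - trunc_log A (spin_avg N \<nu> U g)\<bar>)"
        by (rule gauss_vec.integrable_const_bound[where B = A])
          (use bd x01 y01 in auto)
      show "\<bar>trunc_log A (W * spin_avg N \<nu> V g) - trunc_log A (W * spin_avg N \<nu> U g)\<bar>
          \<le> \<bar>trunc_log A (spin_avg N \<nu> V g) - trunc_log A (spin_avg N \<nu> U g)\<bar>" for g
        using x01[of g] y01[of g] by (intro trunc_log_scale W0(1) W1 A(1)) auto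
    qed
    also have "\<dots> \<le> ?R"
      by (rule trunc_log_spin_avg_diff[OF V V01 U U01 bV bU nn sum1 le n K A(1) nA])
    finally show ?thesis .
  qed
qed

section \<open>Gaussian smoothing in mean\<close>

text \<open>
Small translates of the Gaussian density are dominated by one wider Gaussian density, so that
approximation in a single measure controls all small translations at once.
\<close>

lemma std_normal_density_shift_le:
  assumes "\<bar>h\<bar> \<le> 1"
  shows "std_normal_density (x - h) \<le> 3 * normal_density 0 (sqrt 2) x"
proof -
  have "x\<^sup>2 \<le> 2 * (x - h)\<^sup>2 + 2 * h\<^sup>2"
    using zero_le_power2[of "x - 2 * h"] by (simp add: power2_eq_square algebra_simps)
  moreover have "h\<^sup>2 \<le> 1" using assms abs_le_square_iff[of h 1] by simp
  ultimately have "exp (- (x - h)\<^sup>2 / 2) \<le> exp (1 / 2 + - x\<^sup>2 / 4)" by simp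
  also have "\<dots> = exp (1 / 2) * exp (- x\<^sup>2 / 4)" by (rule exp_add)
  finally have 1: "exp (- (x - h)\<^sup>2 / 2) \<le> exp (1 / 2) * exp (- x\<^sup>2 / 4)" .
  have 2: "exp (1 / 2) * sqrt 2 \<le> (3::real)"
  proof (rule power2_le_imp_le)
    have "(exp (1 / 2 :: real))\<^sup>2 = exp 1"
      by (simp add: power2_eq_square exp_add[symmetric])
    then have "(exp (1 / 2) * sqrt 2)\<^sup>2 = exp 1 * (2::real)"
      by (simp add: power_mult_distrib)
    also have "\<dots> \<le> 3\<^sup>2" using exp_le by simp
    finally show "(exp (1 / 2) * sqrt 2)\<^sup>2 \<le> (3::real)\<^sup>2" .
  qed simp
  have 3: "1 / sqrt (2 * pi) = sqrt 2 * (1 / sqrt (4 * pi))"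
  proof -
    have "sqrt (4 * pi) = sqrt 2 * sqrt (2 * pi)" by (simp add: real_sqrt_mult[symmetric])
    then show ?thesis by simp
  qed
  have "std_normal_density (x - h) \<le> 1 / sqrt (2 * pi) * (exp (1 / 2) * exp (- x\<^sup>2 / 4))"
    unfolding std_normal_density_def using 1 by (intro mult_left_mono) auto
  also have "\<dots> = (exp (1 / 2) * sqrt 2) * (1 / sqrt (4 * pi) * exp (- x\<^sup>2 / 4))"
    unfolding 3 by simp
  also have "\<dots> \<le> 3 * (1 / sqrt (4 * pi) * exp (- x\<^sup>2 / 4))"
    using 2 by (intro mult_right_mono) auto
  also have "1 / sqrt (4 * pi) * exp (- x\<^sup>2 / 4) = normal_density 0 (sqrt 2) x"
    by (simp add: normal_density_def)
  finally show ?thesis .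
qed

text \<open>
A measurable function is an almost everywhere limit of continuous ones. Clipping them to the unit
interval keeps the limit and permits dominated convergence.
\<close>

lemma continuous_approximation:
  fixes U :: "real \<Rightarrow> real"
  assumes U [measurable]: "U \<in> borel_measurable borel" and U01: "\<And>x. U x \<in> {0..1}" and e: "0 < e"
  obtains c where "continuous_on UNIV c" "\<And>x. c x \<in> {0..1}"
    "(\<integral>x. normal_density 0 (sqrt 2) x * \<bar>U x - c x\<bar> \<partial>lborel) < e"
proof -
  have "U \<in> borel_measurable lebesgue"
    by (rule measurable_completion) measurable
  then have "U measurable_on UNIV"
    by (rule lebesgue_measurable_imp_measurable_on) simp
  then obtain Z g where Z: "negligible Z" and gc: "\<And>n. continuous_on UNIV (g n)"
    and lim: "\<And>x. x \<notin> Z \<Longrightarrow> (\<lambda>n. g n x) \<longlonglongrightarrow> U x"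
    unfolding measurable_on_def by auto
  define c where "c = (\<lambda>n x. max 0 (min 1 (g n x)))"
  have cc: "continuous_on UNIV (c n)" for n
    unfolding c_def by (intro continuous_intros gc)
  have c01: "c n x \<in> {0..1}" for n x by (auto simp: c_def)
  have [measurable]: "c n \<in> borel_measurable borel" for n
    using cc by (rule borel_measurable_continuous_onI)
  have climit: "(\<lambda>n. c n x) \<longlonglongrightarrow> U x" if "x \<notin> Z" for x
  proof -
    have "(\<lambda>n. c n x) \<longlonglongrightarrow> max 0 (min 1 (U x))"
      unfolding c_def by (intro tendsto_intros lim that)
    then show ?thesis using U01[of x] by simp
  qed
  have "AE x in lebesgue. x \<notin> Z"
    using Z by (simp add: negligible_iff_null_sets AE_not_in)
  then have ae: "AE x in lborel. x \<notin> Z"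
    by (simp add: AE_completion_iff)
  let ?r = "normal_density 0 (sqrt 2)"
  have "(\<lambda>n. \<integral>x. ?r x * \<bar>U x - c n x\<bar> \<partial>lborel) \<longlonglongrightarrow> integral\<^sup>L (lborel :: real measure) (\<lambda>_. 0)"
  proof (rule integral_dominated_convergence[where w = ?r])
    show "AE x in lborel. (\<lambda>n. ?r x * \<bar>U x - c n x\<bar>) \<longlonglongrightarrow> 0"
      using ae
    proof eventually_elim
      case (elim x)
      have "(\<lambda>n. ?r x * \<bar>U x - c n x\<bar>) \<longlonglongrightarrow> ?r x * \<bar>U x - U x\<bar>"
        by (intro tendsto_intros climit elim)
      then show ?case by simp
    qed
    show "AE x in lborel. norm (?r x * \<bar>U x - c n x\<bar>) \<le> ?r x" for n
    proof (rule AE_I2)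
      fix x
      have "\<bar>U x - c n x\<bar> \<le> 1" using U01[of x] c01[of n x] by auto
      then show "norm (?r x * \<bar>U x - c n x\<bar>) \<le> ?r x"
        by (simp add: abs_mult mult_left_le)
    qed
  qed auto
  then have "eventually (\<lambda>n. (\<integral>x. ?r x * \<bar>U x - c n x\<bar> \<partial>lborel) < e) sequentially"
    using e by (intro order_tendstoD(2)) auto
  then obtain n where "(\<integral>x. ?r x * \<bar>U x - c n x\<bar> \<partial>lborel) < e"
    by (auto simp: eventually_sequentially)
  then show ?thesis using that[of "c n"] cc c01 by blast
qed

lemma gauss_shift_integral_le:
  fixes f :: "real \<Rightarrow> real"
  assumes f [measurable]: "f \<in> borel_measurable borel" and f01: "\<And>x. f x \<in> {0..1}" and h: "\<bar>h\<bar> \<le> 1"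
  shows "(\<integral>x. f (x + h) \<partial>std_gaussian) \<le> 3 * (\<integral>x. normal_density 0 (sqrt 2) x * f x \<partial>lborel)"
proof -
  have f0: "0 \<le> f x" "f x \<le> 1" for x using f01[of x] by auto
  have int: "integrable lborel (\<lambda>x. normal_density \<mu> \<sigma> x * f x)" if "0 < \<sigma>" for \<mu> \<sigma>
    by (rule Bochner_Integration.integrable_bound[OF integrable_normal_density[OF that, of \<mu>]])
      (use f0 in \<open>auto simp: abs_mult mult_left_le\<close>)
  have sh: "std_normal_density (x - h) = normal_density h 1 x" for x
    by (simp add: normal_density_def)
  have "(\<integral>x. f (x + h) \<partial>std_gaussian) = (\<integral>x. std_normal_density x * f (x + h) \<partial>lborel)"
    by (subst integral_density) auto
  also have "\<dots> = (\<integral>x. std_normal_density (x - h) * f x \<partial>lborel)"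
    using lborel_integral_real_affine[of 1 "\<lambda>x. std_normal_density (x - h) * f x" h]
    by (simp add: add.commute)
  also have "\<dots> \<le> (\<integral>x. 3 * (normal_density 0 (sqrt 2) x * f x) \<partial>lborel)"
  proof (rule integral_mono)
    show "integrable lborel (\<lambda>x. std_normal_density (x - h) * f x)"
      unfolding sh using int by simp
    show "integrable lborel (\<lambda>x. 3 * (normal_density 0 (sqrt 2) x * f x))"
      using int by simp
    show "std_normal_density (x - h) * f x \<le> 3 * (normal_density 0 (sqrt 2) x * f x)" for x
      using mult_right_mono[OF std_normal_density_shift_le[OF h, of x] f0(1)[of x]] by simp
  qed
  finally show ?thesis by simp
qed

text \<open>
Continuity of translations in the mean: it holds for a continuous function by dominated convergence, and
passes to \<open>U\<close> by approximation in a measure that dominates all small translates of the Gaussian measure.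
\<close>

lemma gauss_L1_translation:
  fixes U :: "real \<Rightarrow> real"
  assumes U [measurable]: "U \<in> borel_measurable borel" and U01: "\<And>x. U x \<in> {0..1}" and h: "h \<longlonglongrightarrow> 0"
  shows "(\<lambda>m. \<integral>x. \<bar>U (x + h m) - U x\<bar> \<partial>std_gaussian) \<longlonglongrightarrow> 0"
proof (rule tendstoI)
  fix e :: real assume e: "0 < e"
  then have e9: "0 < e / 9" by simp
  obtain c where cc: "continuous_on UNIV c" and c01: "\<And>x. c x \<in> {0..1}"
    and small: "(\<integral>x. normal_density 0 (sqrt 2) x * \<bar>U x - c x\<bar> \<partial>lborel) < e / 9"
    using continuous_approximation[OF U U01 e9] by blast
  have [measurable]: "c \<in> borel_measurable borel"
    using cc by (rule borel_measurable_continuous_onI)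
  have Uc: "\<bar>U x - c x\<bar> \<in> {0..1}" for x using U01[of x] c01[of x] by auto
  have near: "(\<integral>x. \<bar>U (x + s) - c (x + s)\<bar> \<partial>std_gaussian) < e / 3" if "\<bar>s\<bar> \<le> 1" for s
    using gauss_shift_integral_le[of "\<lambda>x. \<bar>U x - c x\<bar>" s] Uc that small by simp
  have "(\<lambda>m. \<integral>x. \<bar>c (x + h m) - c x\<bar> \<partial>std_gaussian) \<longlonglongrightarrow> (\<integral>x. 0 \<partial>std_gaussian)"
  proof (rule integral_dominated_convergence[where w = "\<lambda>_. 1"])
    show "AE x in std_gaussian. (\<lambda>m. \<bar>c (x + h m) - c x\<bar>) \<longlonglongrightarrow> 0"
    proof (rule AE_I2)
      fix x
      have "(\<lambda>m. x + h m) \<longlonglongrightarrow> x + 0" by (intro tendsto_intros h)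
      then have "(\<lambda>m. c (x + h m)) \<longlonglongrightarrow> c x"
        using continuous_on_tendsto_compose[OF cc, of "\<lambda>m. x + h m" x] by simp
      then have "(\<lambda>m. \<bar>c (x + h m) - c x\<bar>) \<longlonglongrightarrow> \<bar>c x - c x\<bar>" by (intro tendsto_intros)
      then show "(\<lambda>m. \<bar>c (x + h m) - c x\<bar>) \<longlonglongrightarrow> 0" by simp
    qed
    show "AE x in std_gaussian. norm \<bar>c (x + h m) - c x\<bar> \<le> 1" for m
    proof (rule AE_I2)
      fix x show "norm \<bar>c (x + h m) - c x\<bar> \<le> 1" using c01[of x] c01[of "x + h m"] by auto
    qed
  qed auto
  then have "eventually (\<lambda>m. (\<integral>x. \<bar>c (x + h m) - c x\<bar> \<partial>std_gaussian) < e / 3) sequentially"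
    using e by (intro order_tendstoD(2)) auto
  moreover have "eventually (\<lambda>m. \<bar>h m\<bar> < 1) sequentially"
    using tendstoD[OF h, of 1] by (simp add: dist_real_def)
  ultimately show "eventually (\<lambda>m. dist (\<integral>x. \<bar>U (x + h m) - U x\<bar> \<partial>std_gaussian) 0 < e) sequentially"
  proof eventually_elim
    case (elim m)
    have b: "\<bar>U x - c y\<bar> \<le> 1" "\<bar>U x - U y\<bar> \<le> 1" "\<bar>c x - c y\<bar> \<le> 1" for x y
      using U01[of x] U01[of y] c01[of x] c01[of y] by auto
    have int: "integrable std_gaussian (\<lambda>x. \<bar>U (x + s) - c (x + s)\<bar>)" for s
      by (rule gauss_integrable_bounded[where B = 1]) (use b in auto)
    have int2: "integrable std_gaussian (\<lambda>x. \<bar>c (x + h m) - c x\<bar>)" "integrable std_gaussian (\<lambda>x. \<bar>U (x + h m) - U x\<bar>)"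
      by (rule gauss_integrable_bounded[where B = 1]; use b in auto)+
    have "(\<integral>x. \<bar>U (x + h m) - U x\<bar> \<partial>std_gaussian)
        \<le> (\<integral>x. \<bar>U (x + h m) - c (x + h m)\<bar> + \<bar>c (x + h m) - c x\<bar> + \<bar>U (x + 0) - c (x + 0)\<bar> \<partial>std_gaussian)"
    proof (rule integral_mono)
      show "integrable std_gaussian (\<lambda>x. \<bar>U (x + h m) - c (x + h m)\<bar> + \<bar>c (x + h m) - c x\<bar> + \<bar>U (x + 0) - c (x + 0)\<bar>)"
        by (intro Bochner_Integration.integrable_add int int2)
      show "\<bar>U (x + h m) - U x\<bar> \<le> \<bar>U (x + h m) - c (x + h m)\<bar> + \<bar>c (x + h m) - c x\<bar> + \<bar>U (x + 0) - c (x + 0)\<bar>" for x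
        by simp
    qed (rule int2)
    also have "\<dots> = (\<integral>x. \<bar>U (x + h m) - c (x + h m)\<bar> \<partial>std_gaussian) + (\<integral>x. \<bar>c (x + h m) - c x\<bar> \<partial>std_gaussian)
        + (\<integral>x. \<bar>U (x + 0) - c (x + 0)\<bar> \<partial>std_gaussian)"
      using int[of "h m"] int[of 0] int2 by simp
    also have "\<dots> < e / 3 + e / 3 + e / 3"
      using near[of "h m"] near[of 0] elim by linarith
    finally have "(\<integral>x. \<bar>U (x + h m) - U x\<bar> \<partial>std_gaussian) < e" by simp
    moreover have "0 \<le> (\<integral>x. \<bar>U (x + h m) - U x\<bar> \<partial>std_gaussian)"
      by (intro Bochner_Integration.integral_nonneg) auto
    ultimately show ?case by simp
  qed
qed

lemma measurable_gauss_smooth [measurable]: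
  assumes [measurable]: "U \<in> borel_measurable borel"
  shows "gauss_smooth \<eta> U \<in> borel_measurable borel"
  unfolding gauss_smooth_def[abs_def] by measurable

lemma gauss_smooth_bounds:
  assumes [measurable]: "U \<in> borel_measurable borel" and U01: "\<And>x. U x \<in> {0..1}"
  shows "gauss_smooth \<eta> U x \<in> {0..1}"
proof -
  have U0: "0 \<le> U x" "U x \<le> 1" for x using U01[of x] by auto
  have "integrable std_gaussian (\<lambda>\<xi>. U (x + \<eta> * \<xi>))"
    by (rule gauss_integrable_bounded[where B = 1]) (use U0 in auto)
  then show ?thesis
    unfolding gauss_smooth_def
    using U0 by (auto intro!: Bochner_Integration.integral_nonneg gauss.integral_le_const)
qed

lemma gauss_mass_diff:
  assumes V [measurable]: "V \<in> borel_measurable borel" and V01: "\<And>x. V x \<in> {0..1}"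
    and U [measurable]: "U \<in> borel_measurable borel" and U01: "\<And>x. U x \<in> {0..1}"
  shows "\<bar>gauss_mass V - gauss_mass U\<bar> \<le> (\<integral>x. \<bar>V x - U x\<bar> \<partial>std_gaussian)"
proof -
  have d: "\<bar>V x - U x\<bar> \<le> 1" for x using V01[of x] U01[of x] by auto
  have i: "integrable std_gaussian (\<lambda>x. \<bar>V x - U x\<bar>)"
    by (rule gauss_integrable_bounded[where B = 1]) (measurable, simp only: abs_abs d)
  have iV: "integrable std_gaussian (\<lambda>x. V x * exp (- 3 * x\<^sup>2 / 2))"
    by (rule gauss_mass_bounds(3)[OF V V01])
  have iU: "integrable std_gaussian (\<lambda>x. U x * exp (- 3 * x\<^sup>2 / 2))"
    by (rule gauss_mass_bounds(3)[OF U U01])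
  note iD = Bochner_Integration.integrable_diff[OF iV iU]
  have eq: "gauss_mass V - gauss_mass U = (\<integral>x. V x * exp (- 3 * x\<^sup>2 / 2) - U x * exp (- 3 * x\<^sup>2 / 2) \<partial>std_gaussian)"
    unfolding gauss_mass_def by (rule Bochner_Integration.integral_diff[OF iV iU, symmetric])
  have "\<bar>gauss_mass V - gauss_mass U\<bar> \<le> (\<integral>x. \<bar>V x * exp (- 3 * x\<^sup>2 / 2) - U x * exp (- 3 * x\<^sup>2 / 2)\<bar> \<partial>std_gaussian)"
    unfolding eq by (rule integral_abs_bound)
  also have "\<dots> \<le> (\<integral>x. \<bar>V x - U x\<bar> \<partial>std_gaussian)"
  proof (rule integral_mono)
    show "integrable std_gaussian (\<lambda>x. \<bar>V x * exp (- 3 * x\<^sup>2 / 2) - U x * exp (- 3 * x\<^sup>2 / 2)\<bar>)"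
      by (rule integrable_abs[OF iD])
    show "\<bar>V x * exp (- 3 * x\<^sup>2 / 2) - U x * exp (- 3 * x\<^sup>2 / 2)\<bar> \<le> \<bar>V x - U x\<bar>" for x
    proof -
      have "\<bar>V x - U x\<bar> * exp (- 3 * x\<^sup>2 / 2) \<le> \<bar>V x - U x\<bar> * 1"
        by (intro mult_left_mono) auto
      then show ?thesis by (simp add: left_diff_distrib[symmetric] abs_mult)
    qed
  qed (rule i)
  finally show ?thesis .
qed

text \<open>
If the mass vanished, \<open>U\<close> would vanish almost everywhere, and so would the integral of \<open>\<xi> * U \<xi>\<close>.
\<close>

lemma gauss_mass_pos:
  assumes U [measurable]: "U \<in> borel_measurable borel" and U01: "\<And>x. U x \<in> {0..1}"
    and nz: "(\<integral>\<xi>. \<xi> * U \<xi> \<partial>std_gaussian) \<noteq> 0"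
  shows "0 < gauss_mass U"
proof (rule ccontr)
  assume "\<not> 0 < gauss_mass U"
  then have 0: "gauss_mass U = 0" using gauss_mass_bounds(1)[OF U U01] by simp
  have "AE x in std_gaussian. U x * exp (- 3 * x\<^sup>2 / 2) = 0"
  proof (rule integral_nonneg_eq_0_iff_AE[THEN iffD1])
    show "integrable std_gaussian (\<lambda>x. U x * exp (- 3 * x\<^sup>2 / 2))"
      by (rule gauss_mass_bounds(3)[OF U U01])
    have "0 \<le> U x * exp (- 3 * x\<^sup>2 / 2)" for x using U01[of x] by simp
    then show "AE x in std_gaussian. 0 \<le> U x * exp (- 3 * x\<^sup>2 / 2)" by simp
    show "(\<integral>x. U x * exp (- 3 * x\<^sup>2 / 2) \<partial>std_gaussian) = 0"
      using 0 by (simp only: gauss_mass_def)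
  qed
  then have "AE x in std_gaussian. x * U x = 0"
  proof (rule eventually_mono)
    fix x assume "U x * exp (- 3 * x\<^sup>2 / 2) = 0"
    then have "U x = 0" by (simp only: mult_eq_0_iff exp_not_eq_zero simp_thms)
    then show "x * U x = 0" by simp
  qed
  then have "(\<integral>\<xi>. \<xi> * U \<xi> \<partial>std_gaussian) = 0" by (rule integral_eq_zero_AE)
  with nz show False by simp
qed

text \<open>
The smoothed function is an average of translates of \<open>U\<close> by \<open>\<eta> * t\<close>, so this follows from the continuity of
translations and dominated convergence in \<open>t\<close>.
\<close>

lemma gauss_smooth_L1:
  fixes U :: "real \<Rightarrow> real"
  assumes U [measurable]: "U \<in> borel_measurable borel" and U01: "\<And>x. U x \<in> {0..1}"
  shows "((\<lambda>\<eta>. \<integral>x. \<bar>gauss_smooth \<eta> U x - U x\<bar> \<partial>std_gaussian) \<longlongrightarrow> 0) (at_right 0)"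
  unfolding tendsto_at_iff_sequentially comp_def
proof (intro allI impI)
  fix \<eta> :: "nat \<Rightarrow> real" assume \<eta>: "\<eta> \<longlonglongrightarrow> 0"
  have U0: "0 \<le> U x" "U x \<le> 1" for x using U01[of x] by auto
  have Ud: "\<bar>U x - U y\<bar> \<le> 1" for x y using U0[of x] U0[of y] by auto
  have S: "gauss_smooth s U x \<in> {0..1}" for s x by (rule gauss_smooth_bounds[OF U U01])
  define L where "L = (\<lambda>s. \<integral>x. \<bar>U (x + s) - U x\<bar> \<partial>std_gaussian)"
  have [measurable]: "L \<in> borel_measurable borel" unfolding L_def by measurable
  have L01: "0 \<le> L s" "L s \<le> 1" for s
  proof -
    have "integrable std_gaussian (\<lambda>x. \<bar>U (x + s) - U x\<bar>)"
      by (rule gauss_integrable_bounded[where B = 1]) (measurable, simp only: abs_abs Ud)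
    then show "0 \<le> L s" "L s \<le> 1"
      unfolding L_def
      by (intro Bochner_Integration.integral_nonneg abs_ge_zero, intro gauss.integral_le_const AE_I2 Ud)
  qed
  have lim: "(\<lambda>m. \<integral>t. L (\<eta> m * t) \<partial>std_gaussian) \<longlonglongrightarrow> (\<integral>t. 0 \<partial>std_gaussian)"
  proof (rule integral_dominated_convergence[where w = "\<lambda>_. 1"])
    show "AE t in std_gaussian. (\<lambda>m. L (\<eta> m * t)) \<longlonglongrightarrow> 0"
    proof (rule AE_I2)
      fix t
      have "(\<lambda>m. \<eta> m * t) \<longlonglongrightarrow> 0 * t" by (intro tendsto_intros \<eta>)
      then show "(\<lambda>m. L (\<eta> m * t)) \<longlonglongrightarrow> 0"
        unfolding L_def by (intro gauss_L1_translation[OF U U01]) simp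
    qed
    show "AE t in std_gaussian. norm (L (\<eta> m * t)) \<le> 1" for m
      using L01 by (intro AE_I2) auto
  qed auto
  have bound: "(\<integral>x. \<bar>gauss_smooth s U x - U x\<bar> \<partial>std_gaussian) \<le> (\<integral>t. L (s * t) \<partial>std_gaussian)" for s
  proof -
    interpret GG: pair_prob_space std_gaussian std_gaussian ..
    have intU: "integrable std_gaussian (\<lambda>t. U (x + s * t) - U x)" "integrable std_gaussian (\<lambda>t. U (x + s * t))" for x
      by (rule gauss_integrable_bounded[where B = 1], measurable, simp only: Ud)
        (rule gauss_integrable_bounded[where B = 1], measurable, simp only: abs_of_nonneg U0)
    have pair: "integrable (std_gaussian \<Otimes>\<^sub>M std_gaussian) (\<lambda>(x, t). \<bar>U (x + s * t) - U x\<bar>)"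
      by (rule GG.P.integrable_const_bound[where B = 1]) (simp_all add: case_prod_beta Ud del: abs_le_iff)
    have "\<bar>gauss_smooth s U x - U x\<bar> \<le> (\<integral>t. \<bar>U (x + s * t) - U x\<bar> \<partial>std_gaussian)" for x
    proof -
      have "gauss_smooth s U x - U x = (\<integral>t. U (x + s * t) - U x \<partial>std_gaussian)"
        unfolding gauss_smooth_def using intU gauss.prob_space by simp
      then show ?thesis by simp
    qed
    then have "(\<integral>x. \<bar>gauss_smooth s U x - U x\<bar> \<partial>std_gaussian)
        \<le> (\<integral>x. \<integral>t. \<bar>U (x + s * t) - U x\<bar> \<partial>std_gaussian \<partial>std_gaussian)"
    proof (intro integral_mono)
      show "integrable std_gaussian (\<lambda>x. \<bar>gauss_smooth s U x - U x\<bar>)"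
      proof (rule gauss_integrable_bounded[where B = 1])
        show "\<bar>\<bar>gauss_smooth s U x - U x\<bar>\<bar> \<le> 1" for x using S[of s x] U0[of x] by auto
      qed measurable
      show "integrable std_gaussian (\<lambda>x. \<integral>t. \<bar>U (x + s * t) - U x\<bar> \<partial>std_gaussian)"
        using GG.integrable_fst[OF pair] .
    qed
    also have "\<dots> = (\<integral>t. L (s * t) \<partial>std_gaussian)"
      unfolding L_def using GG.Fubini_integral[OF pair] by simp
    finally show ?thesis .
  qed
  show "(\<lambda>m. \<integral>x. \<bar>gauss_smooth (\<eta> m) U x - U x\<bar> \<partial>std_gaussian) \<longlonglongrightarrow> 0"
  proof (rule tendsto_sandwich[OF _ _ tendsto_const])
    show "(\<lambda>m. \<integral>t. L (\<eta> m * t) \<partial>std_gaussian) \<longlonglongrightarrow> 0" using lim by simp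
  qed (use bound in \<open>auto intro!: always_eventually Bochner_Integration.integral_nonneg\<close>)
qed

section \<open>Replacing the activation function in all rows\<close>

definition gauss_rows :: "nat \<Rightarrow> nat \<Rightarrow> (nat \<Rightarrow> nat \<Rightarrow> real) measure" where
  "gauss_rows M N = PiM {..<M} (\<lambda>_. gauss_vec N)"

text \<open>
Grouping the independent entries by rows shows that the rows are independent Gaussian vectors. The index
sets have to be nonempty because the characterisation of independence by product measures requires it.
\<close>

lemma distr_iid_gaussian_matrix:
  assumes G: "iid_gaussian_matrix P M N G" and M: "0 < M" and N: "0 < N"
  shows "(\<lambda>\<omega>. \<lambda>a\<in>{..<M}. \<lambda>i\<in>{..<N}. G a i \<omega>) \<in> measurable P (gauss_rows M N)"
    and "distr P (gauss_rows M N) (\<lambda>\<omega>. \<lambda>a\<in>{..<M}. \<lambda>i\<in>{..<N}. G a i \<omega>) = gauss_rows M N"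
proof -
  interpret P: prob_space P using G by (simp add: iid_gaussian_matrix_def)
  have ind: "P.indep_vars (\<lambda>_. borel) (\<lambda>(a, i). G a i) ({..<M} \<times> {..<N})"
    and dist: "\<And>a i. a < M \<Longrightarrow> i < N \<Longrightarrow> distributed P lborel (G a i) std_normal_density"
    using G by (auto simp: iid_gaussian_matrix_def)
  have rv: "G a i \<in> borel_measurable P" if "a < M" "i < N" for a i
    using distributed_measurable[OF dist[OF that]] by simp
  have law: "distr P borel (G a i) = std_gaussian" if "a < M" "i < N" for a i
    using distributed_distr_eq_density[OF dist[OF that]] by (simp cong: distr_cong)
  define R where "R = (\<lambda>a \<omega>. \<lambda>i\<in>{..<N}. G a i \<omega>)"
  have R [measurable]: "R a \<in> measurable P (gauss_vec N)" if "a < M" for a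
    unfolding R_def gauss_vec_def by (intro measurable_restrict) (use rv that in auto)
  have R_law: "distr P (gauss_vec N) (R a) = gauss_vec N" if a: "a < M" for a
  proof -
    let ?K = "{a} \<times> {..<N}"
    have "P.indep_vars (\<lambda>_. borel) (\<lambda>(a, i). G a i) ?K"
      by (rule P.indep_vars_subset[OF ind]) (use a in auto)
    then have K_law: "distr P (PiM ?K (\<lambda>_. borel)) (\<lambda>\<omega>. \<lambda>p\<in>?K. (\<lambda>(a, i). G a i) p \<omega>)
        = PiM ?K (\<lambda>p. distr P borel ((\<lambda>(a, i). G a i) p))"
      using N rv a by (subst (asm) P.indep_vars_iff_distr_eq_PiM') auto
    also have "\<dots> = PiM ?K (\<lambda>_. std_gaussian)"
      using law a by (intro PiM_cong) auto
    finally have K_law: "distr P (PiM ?K (\<lambda>_. borel)) (\<lambda>\<omega>. \<lambda>p\<in>?K. (\<lambda>(a, i). G a i) p \<omega>)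
        = PiM ?K (\<lambda>_. std_gaussian)" .
    have mK: "(\<lambda>\<omega>. \<lambda>p\<in>?K. (\<lambda>(a, i). G a i) p \<omega>) \<in> measurable P (PiM ?K (\<lambda>_. borel))"
      by (intro measurable_restrict) (use rv a in auto)
    have mR: "(\<lambda>x. \<lambda>i\<in>{..<N}. x (a, i)) \<in> measurable (PiM ?K (\<lambda>_. borel :: real measure)) (gauss_vec N)"
    proof -
      have "(\<lambda>x. \<lambda>i\<in>{..<N}. x (a, i)) \<in> measurable (PiM ?K (\<lambda>_. borel)) (PiM {..<N} (\<lambda>_. borel :: real measure))"
        by (intro measurable_restrict measurable_component_singleton) auto
      then show ?thesis
        by (subst measurable_cong_sets[OF refl sets_gauss_vec])
    qed
    have "R a = (\<lambda>x. \<lambda>i\<in>{..<N}. x (a, i)) \<circ> (\<lambda>\<omega>. \<lambda>p\<in>?K. (\<lambda>(a, i). G a i) p \<omega>)"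
      by (auto simp: R_def fun_eq_iff restrict_def)
    then have "distr P (gauss_vec N) (R a)
        = distr (PiM ?K (\<lambda>_. std_gaussian)) (gauss_vec N) (\<lambda>x. \<lambda>i\<in>{..<N}. x (a, i))"
      unfolding K_law[symmetric] using distr_distr[OF mR mK] by simp
    also have "\<dots> = gauss_vec N"
      unfolding gauss_vec_def
      by (rule distr_PiM_reindex) (auto simp: inj_on_def prob_space_std_gaussian)
    finally show ?thesis .
  qed
  have "P.indep_vars (\<lambda>a. PiM ({a} \<times> {..<N}) (\<lambda>_. borel))
      (\<lambda>a \<omega>. restrict (\<lambda>p. (\<lambda>(a, i). G a i) p \<omega>) ({a} \<times> {..<N})) {..<M}"
    by (rule P.indep_vars_restrict[OF ind]) (auto simp: disjoint_family_on_def)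
  then have "P.indep_vars (\<lambda>_. gauss_vec N)
      (\<lambda>a \<omega>. (\<lambda>x. \<lambda>i\<in>{..<N}. x (a, i)) (restrict (\<lambda>p. (\<lambda>(a, i). G a i) p \<omega>) ({a} \<times> {..<N}))) {..<M}"
  proof (rule P.indep_vars_compose2)
    fix a
    have "(\<lambda>x. \<lambda>i\<in>{..<N}. x (a, i)) \<in> measurable (PiM ({a} \<times> {..<N}) (\<lambda>_. borel)) (PiM {..<N} (\<lambda>_. borel :: real measure))"
      by (intro measurable_restrict measurable_component_singleton) auto
    then show "(\<lambda>x. \<lambda>i\<in>{..<N}. x (a, i)) \<in> measurable (PiM ({a} \<times> {..<N}) (\<lambda>_. borel :: real measure)) (gauss_vec N)"
      by (subst measurable_cong_sets[OF refl sets_gauss_vec])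
  qed
  also have "(\<lambda>a \<omega>. (\<lambda>x. \<lambda>i\<in>{..<N}. x (a, i)) (restrict (\<lambda>p. (\<lambda>(a, i). G a i) p \<omega>) ({a} \<times> {..<N}))) = R"
    by (auto simp: R_def fun_eq_iff restrict_def)
  finally have indR: "P.indep_vars (\<lambda>_. gauss_vec N) R {..<M}" .
  have eq: "(\<lambda>\<omega>. \<lambda>a\<in>{..<M}. \<lambda>i\<in>{..<N}. G a i \<omega>) = (\<lambda>\<omega>. \<lambda>a\<in>{..<M}. R a \<omega>)"
    by (simp add: R_def)
  show "(\<lambda>\<omega>. \<lambda>a\<in>{..<M}. \<lambda>i\<in>{..<N}. G a i \<omega>) \<in> measurable P (gauss_rows M N)"
    unfolding eq gauss_rows_def by (intro measurable_restrict) (use R in auto)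
  have "distr P (gauss_rows M N) (\<lambda>\<omega>. \<lambda>a\<in>{..<M}. R a \<omega>) = PiM {..<M} (\<lambda>a. distr P (gauss_vec N) (R a))"
    unfolding gauss_rows_def using M R indR
    by (subst (asm) P.indep_vars_iff_distr_eq_PiM') auto
  also have "\<dots> = gauss_rows M N"
    unfolding gauss_rows_def using R_law by (intro PiM_cong) auto
  finally show "distr P (gauss_rows M N) (\<lambda>\<omega>. \<lambda>a\<in>{..<M}. \<lambda>i\<in>{..<N}. G a i \<omega>) = gauss_rows M N"
    unfolding eq .
qed

text \<open>
The partition function with \<open>V\<close> in the first \<open>k\<close> rows and \<open>U\<close> in the others, which interpolates between the two
partition functions of interest.
\<close>

definition hybrid_partition ::
  "(real \<Rightarrow> real) \<Rightarrow> (real \<Rightarrow> real) \<Rightarrow> nat \<Rightarrow> nat \<Rightarrow> nat \<Rightarrow> (nat \<Rightarrow> nat \<Rightarrow> real) \<Rightarrow> real" where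
  "hybrid_partition V U M N k g =
     (\<Sum>J\<in>sign_vectors N. \<Prod>a<M. (if a < k then V else U) (dot N (g a) J / sqrt N))"

lemma measurable_hybrid_partition [measurable]:
  assumes [measurable]: "V \<in> borel_measurable borel" "U \<in> borel_measurable borel"
  shows "hybrid_partition V U M N k \<in> borel_measurable (gauss_rows M N)"
proof -
  have "(\<lambda>g. dot N (g a) J) \<in> borel_measurable (gauss_rows M N)" if "a < M" for a J
  proof -
    have "(\<lambda>g. g a) \<in> measurable (gauss_rows M N) (gauss_vec N)"
      unfolding gauss_rows_def by (rule measurable_component_singleton) (use that in simp)
    then show ?thesis by (rule measurable_compose[OF _ measurable_dot])
  qed
  then have "(\<lambda>g. (if a < k then V else U) (dot N (g a) J / sqrt N)) \<in> borel_measurable (gauss_rows M N)"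
    if "a < M" for a J
    using that by (cases "a < k") simp_all
  then show ?thesis
    unfolding hybrid_partition_def[abs_def]
    by (intro borel_measurable_sum borel_measurable_prod) auto
qed

lemma hybrid_partition_le:
  assumes "\<And>x. V x \<in> {0..1}" "\<And>x. U x \<in> {0..1}"
  shows "hybrid_partition V U M N k g / 2 ^ N \<le> 1"
proof -
  have "hybrid_partition V U M N k g \<le> (\<Sum>J\<in>sign_vectors N. 1)"
    unfolding hybrid_partition_def using assms by (intro sum_mono prod_le_1) auto
  then show ?thesis by (simp add: card_sign_vectors)
qed

text \<open>
Integrate over row \<open>k\<close> first. With the other rows fixed, the products over them are weights in the unit
interval, and the bound for a single row applies.
\<close>

lemma hybrid_partition_step:
  fixes n N K M k :: nat
  assumes V [measurable]: "V \<in> borel_measurable borel" and V01: "\<And>x. V x \<in> {0..1}"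
    and U [measurable]: "U \<in> borel_measurable borel" and U01: "\<And>x. U x \<in> {0..1}"
    and bV: "b \<le> gauss_mass V" and bU: "b \<le> gauss_mass U" and k: "k < M"
    and n: "0 < n" "1024 * n \<le> N" and K: "K \<le> n" and A: "0 \<le> A" "A \<le> N / 4096" and nA: "n * exp (- A) \<le> 1 / 2"
  shows "(\<integral>g. \<bar>trunc_log A (hybrid_partition V U M N (Suc k) g / 2 ^ N)
          - trunc_log A (hybrid_partition V U M N k g / 2 ^ N)\<bar> \<partial>gauss_rows M N)
      \<le> row_error A b N K n (\<integral>x. \<bar>V x - U x\<bar> \<partial>std_gaussian)" (is "_ \<le> ?R")
proof -
  interpret S: product_sigma_finite "\<lambda>_ :: nat. gauss_vec N" by standard
  define I where "I = {..<M} - {k}"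
  have I: "finite I" "k \<notin> I" "insert k I = {..<M}" using k by (auto simp: I_def)
  interpret R: prob_space "gauss_rows M N"
    unfolding gauss_rows_def by (intro prob_space_PiM prob_space_gauss_vec)
  interpret Q: prob_space "PiM I (\<lambda>_. gauss_vec N)"
    by (intro prob_space_PiM prob_space_gauss_vec)
  define f where "f = (\<lambda>g. \<bar>trunc_log A (hybrid_partition V U M N (Suc k) g / 2 ^ N)
          - trunc_log A (hybrid_partition V U M N k g / 2 ^ N)\<bar>)"
  have fm [measurable]: "f \<in> borel_measurable (gauss_rows M N)" unfolding f_def by measurable
  have f: "0 \<le> f g" "f g \<le> A" for g
  proof -
    have "trunc_log A (hybrid_partition V U M N j g / 2 ^ N) \<in> {- A..0}" for j
      by (intro trunc_log_bounds A hybrid_partition_le V01 U01)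
    from this[of k] this[of "Suc k"] show "0 \<le> f g" "f g \<le> A" by (auto simp: f_def)
  qed
  have int: "integrable (gauss_rows M N) f"
    by (rule R.integrable_const_bound[where B = A]) (use f in auto)
  then have int': "integrable (PiM (insert k I) (\<lambda>_. gauss_vec N)) f"
    by (simp add: I gauss_rows_def)
  have inner: "(\<integral>y. f (x(k := y)) \<partial>gauss_vec N) \<le> ?R" for x
  proof -
    define w where "w = (\<lambda>J. \<Prod>a\<in>I. (if a < k then V else U) (dot N (x a) J / sqrt N))"
    have w: "w J \<in> {0..1}" for J
    proof -
      have "0 \<le> (if a < k then V else U) z \<and> (if a < k then V else U) z \<le> 1" for a z
        using V01[of z] U01[of z] by auto
      then show ?thesis unfolding w_def by (auto intro!: prod_nonneg prod_le_1)
    qed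
    have prod: "(\<Prod>a<M. (if a < j then V else U) (dot N ((x(k := y)) a) J / sqrt N))
        = w J * (if k < j then V else U) (dot N y J / sqrt N)" if "j = k \<or> j = Suc k" for j y J
    proof -
      have "(\<Prod>a\<in>I. (if a < j then V else U) (dot N ((x(k := y)) a) J / sqrt N)) = w J"
        unfolding w_def using I(2) that by (intro prod.cong) (auto simp: less_Suc_eq)
      then show ?thesis
        unfolding I(3)[symmetric] using I(1,2) by (simp add: mult.commute)
    qed
    have "f (x(k := y)) = \<bar>trunc_log A ((\<Sum>J\<in>sign_vectors N. w J * V (dot N y J / sqrt N)) / 2 ^ N)
          - trunc_log A ((\<Sum>J\<in>sign_vectors N. w J * U (dot N y J / sqrt N)) / 2 ^ N)\<bar>" for y
      unfolding f_def hybrid_partition_def by (simp add: prod del: fun_upd_apply)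
    then show ?thesis
      using trunc_log_row_replacement[OF V V01 U U01 bV bU w n K A nA] by simp
  qed
  have "(\<integral>g. f g \<partial>gauss_rows M N) = (\<integral>x. \<integral>y. f (x(k := y)) \<partial>gauss_vec N \<partial>PiM I (\<lambda>_. gauss_vec N))"
    using S.product_integral_insert[OF I(1,2) int'] by (simp add: I(3) gauss_rows_def)
  also have "\<dots> \<le> ?R"
  proof (rule Q.integral_le_const)
    show "AE x in PiM I (\<lambda>_. gauss_vec N). (\<integral>y. f (x(k := y)) \<partial>gauss_vec N) \<le> ?R"
      using inner by simp
    show "integrable (PiM I (\<lambda>_. gauss_vec N)) (\<lambda>x. \<integral>y. f (x(k := y)) \<partial>gauss_vec N)"
    proof (rule Q.integrable_const_bound[where B = A])
      have upd: "(\<lambda>(x, y). x(k := y)) \<in> measurable (PiM I (\<lambda>_. gauss_vec N) \<Otimes>\<^sub>M gauss_vec N) (gauss_rows M N)"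
        unfolding gauss_rows_def I(3)[symmetric] by (rule measurable_add_dim)
      have "(\<lambda>(x, y). f (x(k := y))) = (\<lambda>z. f (case z of (x, y) \<Rightarrow> x(k := y)))"
        by (simp add: fun_eq_iff split_beta)
      then have fu: "(\<lambda>(x, y). f (x(k := y))) \<in> borel_measurable (PiM I (\<lambda>_. gauss_vec N) \<Otimes>\<^sub>M gauss_vec N)"
        using measurable_compose[OF upd fm] by (simp only:)
      then show "(\<lambda>x. \<integral>y. f (x(k := y)) \<partial>gauss_vec N) \<in> borel_measurable (PiM I (\<lambda>_. gauss_vec N))"
        by (rule gauss_vec.borel_measurable_lebesgue_integral)
      show "AE x in PiM I (\<lambda>_. gauss_vec N). norm (\<integral>y. f (x(k := y)) \<partial>gauss_vec N) \<le> A"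
      proof (rule AE_I2)
        fix x assume x: "x \<in> space (PiM I (\<lambda>_. gauss_vec N))"
        have "(\<lambda>y. f (x(k := y))) \<in> borel_measurable (gauss_vec N)"
          using measurable_Pair2[OF fu x] by simp
        then have "integrable (gauss_vec N) (\<lambda>y. f (x(k := y)))"
          by (rule gauss_vec.integrable_const_bound[where B = A, rotated]) (use f in auto)
        then have "(\<integral>y. f (x(k := y)) \<partial>gauss_vec N) \<le> A"
          by (rule gauss_vec.integral_le_const) (use f in auto)
        moreover have "0 \<le> (\<integral>y. f (x(k := y)) \<partial>gauss_vec N)"
          using f by (intro Bochner_Integration.integral_nonneg) auto
        ultimately show "norm (\<integral>y. f (x(k := y)) \<partial>gauss_vec N) \<le> A" by simp
      qed
    qed
  qed
  finally show ?thesis by (simp add: f_def)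
qed

lemma partition_function_replacement:
  fixes n N K M :: nat
  assumes V [measurable]: "V \<in> borel_measurable borel" and V01: "\<And>x. V x \<in> {0..1}"
    and U [measurable]: "U \<in> borel_measurable borel" and U01: "\<And>x. U x \<in> {0..1}"
    and bV: "b \<le> gauss_mass V" and bU: "b \<le> gauss_mass U"
    and n: "0 < n" "1024 * n \<le> N" and K: "K \<le> n" and A: "0 \<le> A" "A \<le> N / 4096" and nA: "n * exp (- A) \<le> 1 / 2"
    and G: "iid_gaussian_matrix P M N G"
  shows "\<bar>\<integral>\<omega>. trunc_log A (partition_function V M N (\<lambda>a i. G a i \<omega>) / 2 ^ N)
          - trunc_log A (partition_function U M N (\<lambda>a i. G a i \<omega>) / 2 ^ N) \<partial>P\<bar>
      \<le> M * row_error A b N K n (\<integral>x. \<bar>V x - U x\<bar> \<partial>std_gaussian)" (is "?lhs \<le> _ * ?R")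
proof (cases "M = 0")
  case True
  then show ?thesis by (simp add: partition_function_def)
next
  case False
  then have M: "0 < M" by simp
  have N: "0 < N" using n by simp
  interpret R: prob_space "gauss_rows M N"
    unfolding gauss_rows_def by (intro prob_space_PiM prob_space_gauss_vec)
  define g where "g = (\<lambda>\<omega>. \<lambda>a\<in>{..<M}. \<lambda>i\<in>{..<N}. G a i \<omega>)"
  note g_meas = distr_iid_gaussian_matrix(1)[OF G M N, folded g_def]
    and g_law = distr_iid_gaussian_matrix(2)[OF G M N, folded g_def]
  define T where "T = (\<lambda>k m. trunc_log A (hybrid_partition V U M N k m / 2 ^ N))"
  have [measurable]: "T k \<in> borel_measurable (gauss_rows M N)" for k
    unfolding T_def by measurable
  have T01: "T k m \<in> {- A..0}" for k m
    unfolding T_def by (intro trunc_log_bounds A hybrid_partition_le V01 U01)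
  have intT: "integrable (gauss_rows M N) (T k)" for k
  proof (rule R.integrable_const_bound[where B = A])
    show "AE m in gauss_rows M N. norm (T k m) \<le> A" using T01 by (auto simp: abs_le_iff minus_le_iff)
  qed measurable
  have dot_g: "dot N (g \<omega> a) J = (\<Sum>i<N. G a i \<omega> * J i)" if "a < M" for a J \<omega>
    using that by (simp add: dot_def g_def)
  have pf: "partition_function V M N (\<lambda>a i. G a i \<omega>) = hybrid_partition V U M N M (g \<omega>)"
    "partition_function U M N (\<lambda>a i. G a i \<omega>) = hybrid_partition V U M N 0 (g \<omega>)" for \<omega>
    unfolding partition_function_def hybrid_partition_def
    by (auto intro!: sum.cong prod.cong simp: dot_g)
  have "(\<integral>\<omega>. trunc_log A (partition_function V M N (\<lambda>a i. G a i \<omega>) / 2 ^ N)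
          - trunc_log A (partition_function U M N (\<lambda>a i. G a i \<omega>) / 2 ^ N) \<partial>P)
      = (\<integral>\<omega>. T M (g \<omega>) - T 0 (g \<omega>) \<partial>P)"
    unfolding pf T_def ..
  also have "\<dots> = (\<integral>m. T M m - T 0 m \<partial>distr P (gauss_rows M N) g)"
    using g_meas by (intro integral_distr[symmetric]) auto
  also have "\<dots> = (\<integral>m. T M m - T 0 m \<partial>gauss_rows M N)"
    unfolding g_law ..
  finally have eq: "(\<integral>\<omega>. trunc_log A (partition_function V M N (\<lambda>a i. G a i \<omega>) / 2 ^ N)
          - trunc_log A (partition_function U M N (\<lambda>a i. G a i \<omega>) / 2 ^ N) \<partial>P)
      = (\<integral>m. T M m - T 0 m \<partial>gauss_rows M N)" .
  have "(\<integral>m. T M m - T 0 m \<partial>gauss_rows M N) = (\<integral>m. (\<Sum>k<M. T (Suc k) m - T k m) \<partial>gauss_rows M N)"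
  proof -
    have "(\<Sum>k<M. T (Suc k) m - T k m) = T M m - T 0 m" for m
      by (rule sum_lessThan_telescope)
    then show ?thesis by simp
  qed
  also have "\<dots> = (\<Sum>k<M. \<integral>m. T (Suc k) m - T k m \<partial>gauss_rows M N)"
    using intT by (intro Bochner_Integration.integral_sum) auto
  finally have "?lhs = \<bar>\<Sum>k<M. \<integral>m. T (Suc k) m - T k m \<partial>gauss_rows M N\<bar>"
    unfolding eq by simp
  also have "\<dots> \<le> (\<Sum>k<M. \<bar>\<integral>m. T (Suc k) m - T k m \<partial>gauss_rows M N\<bar>)"
    by (rule sum_abs)
  also have "\<dots> \<le> (\<Sum>k<M. ?R)"
  proof (rule sum_mono)
    fix k assume "k \<in> {..<M}"
    then have k: "k < M" by simp
    have "\<bar>\<integral>m. T (Suc k) m - T k m \<partial>gauss_rows M N\<bar> \<le> (\<integral>m. \<bar>T (Suc k) m - T k m\<bar> \<partial>gauss_rows M N)"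
      by (rule integral_abs_bound)
    also have "\<dots> \<le> ?R"
      unfolding T_def by (rule hybrid_partition_step[OF V V01 U U01 bV bU k n K A nA])
    finally show "\<bar>\<integral>m. T (Suc k) m - T k m \<partial>gauss_rows M N\<bar> \<le> ?R" .
  qed
  also have "\<dots> = M * ?R" by simp
  finally show ?thesis .
qed

section \<open>The limit\<close>

text \<open>
The part of the \<open>k\<close>-th summand of \<open>row_error\<close> that does not depend on \<open>N\<close>.
\<close>

definition replica_tail :: "real \<Rightarrow> nat \<Rightarrow> real" where
  "replica_tail b k = 2 * (exp (- b * sqrt k) + 2 / real k ^ 3) / k"

lemma replica_tail_nonneg: "0 \<le> replica_tail b k"
  by (simp add: replica_tail_def)

lemma summable_replica_tail:
  assumes b: "0 < b"
  shows "summable (replica_tail b)"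
proof (rule summable_comparison_test'[where N = 1])
  show "summable (\<lambda>k. (4 / b\<^sup>2 + 4) * inverse ((real k)\<^sup>2))"
    by (intro summable_mult inverse_power_summable) simp
  fix k :: nat assume k: "k \<ge> 1"
  have "(b * sqrt k)\<^sup>2 / 2 \<le> exp (b * sqrt k)"
  proof -
    have "0 \<le> b * sqrt k" using b by simp
    from exp_lower_Taylor_quadratic[OF this] this show ?thesis by linarith
  qed
  then have "b\<^sup>2 * k / 2 \<le> exp (b * sqrt k)" by (simp add: power_mult_distrib)
  then have "inverse (exp (b * sqrt k)) \<le> inverse (b\<^sup>2 * k / 2)"
    using b k by (intro le_imp_inverse_le) auto
  then have 1: "exp (- b * sqrt k) \<le> 2 / (b\<^sup>2 * k)" by (simp add: exp_minus)
  have "(1::real) \<le> real k ^ 2" using k by simp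
  then have "real k * 1 \<le> real k * real k ^ 2" by (intro mult_left_mono) auto
  then have "real k \<le> real k ^ 3" by (simp add: power_numeral_reduce)
  then have 2: "2 / real k ^ 3 \<le> 2 / real k" using k by (intro divide_left_mono) auto
  have "replica_tail b k \<le> 2 * (2 / (b\<^sup>2 * k) + 2 / real k) / k"
    unfolding replica_tail_def using 1 2 by (intro divide_right_mono mult_left_mono add_mono) auto
  also have "\<dots> = (4 / b\<^sup>2 + 4) * inverse ((real k)\<^sup>2)"
    using b k by (simp add: field_simps power2_eq_square)
  finally show "norm (replica_tail b k) \<le> (4 / b\<^sup>2 + 4) * inverse ((real k)\<^sup>2)"
    using replica_tail_nonneg[of b k] by simp
qed

text \<open>
The first two terms do not depend on \<open>N\<close> except through \<open>n\<close>; the last one collects what vanishes in the limit.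
\<close>

lemma row_error_le:
  assumes A: "0 \<le> A"
  shows "row_error A b N K n \<epsilon> \<le> K * \<epsilon> + (\<Sum>k\<in>{K<..n}. replica_tail b k)
      + (2 * real n * exp (- (N / 512)) + 4 * A * replica_error b N n)"
proof -
  have "(\<Sum>k\<in>{K<..n}. 2 * replica_error b N k / k) = (\<Sum>k\<in>{K<..n}. replica_tail b k + 2 * exp (- (N / 512)))"
    by (intro sum.cong) (auto simp: replica_error_def replica_tail_def field_simps)
  also have "\<dots> = (\<Sum>k\<in>{K<..n}. replica_tail b k) + (n - K) * (2 * exp (- (N / 512)))"
    by (simp add: sum.distrib)
  also have "(n - K) * (2 * exp (- (N / 512))) \<le> n * (2 * exp (- (N / 512)))"
    by (intro mult_right_mono) auto
  finally show ?thesis by (simp add: row_error_def)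
qed

lemma tendsto_power_mult_exp_neg:
  fixes c :: real
  assumes c: "0 < c" and X: "filterlim X at_top F"
  shows "((\<lambda>i. X i ^ p * exp (- c * X i)) \<longlongrightarrow> 0) F"
proof -
  have "filterlim (\<lambda>i. c * X i) at_top F"
    by (rule filterlim_tendsto_pos_mult_at_top[OF tendsto_const c X])
  then have "((\<lambda>i. (c * X i) ^ p / exp (c * X i)) \<longlongrightarrow> 0) F"
    by (rule filterlim_compose[OF tendsto_power_div_exp_0])
  then have "((\<lambda>i. inverse (c ^ p) * ((c * X i) ^ p / exp (c * X i))) \<longlongrightarrow> inverse (c ^ p) * 0) F"
    by (intro tendsto_intros)
  moreover have "inverse (c ^ p) * ((c * x) ^ p / exp (c * x)) = x ^ p * exp (- c * x)" for x
    using c by (simp add: power_mult_distrib exp_minus field_simps)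
  ultimately show ?thesis by simp
qed

lemma filterlim_div_at_top: "0 < d \<Longrightarrow> filterlim (\<lambda>N::nat. N div d) at_top sequentially"
  unfolding filterlim_at_top
proof
  fix Z :: nat assume d: "0 < d"
  show "eventually (\<lambda>N. Z \<le> N div d) sequentially"
    using eventually_ge_at_top[of "Z * d"]
    by eventually_elim (use d in \<open>simp add: less_eq_div_iff_mult_less_eq\<close>)
qed

text \<open>
The term \<open>2 / k ^ 3\<close> in the moment bound at \<open>k = N div 1024\<close> compensates the factor \<open>N \<tau>\<close> from the
truncation level.
\<close>

lemma row_error_remainder_tendsto_0:
  assumes b: "0 < b" and \<tau>: "0 \<le> \<tau>"
  shows "(\<lambda>N. 2 * real (N div 1024) * exp (- (N / 512))
      + 4 * (real N * \<tau>) * replica_error b N (N div 1024)) \<longlonglongrightarrow> 0"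
proof -
  define n where "n = (\<lambda>N::nat. N div 1024)"
  have n: "filterlim n at_top sequentially" unfolding n_def by (rule filterlim_div_at_top) simp
  have rn: "filterlim (\<lambda>N. real (n N)) at_top sequentially"
    by (rule filterlim_compose[OF filterlim_real_sequentially n])
  have rN: "filterlim (\<lambda>N. real N) at_top sequentially" by (rule filterlim_real_sequentially)
  have nN: "real (n N) \<le> real N" for N unfolding n_def by simp
  have Nn: "real N \<le> 2048 * real (n N)" if "1024 \<le> N" for N
  proof -
    have "1 \<le> n N" using that by (simp add: n_def)
    moreover have "N < 1024 * n N + 1024" 
      using div_mult_mod_eq[of N 1024] mod_less_divisor[of 1024 N] unfolding n_def by linarith
    ultimately have "N \<le> 2048 * n N" by linarith
    then show ?thesis by linarith
  qed
  have L1: "(\<lambda>N. real N ^ 1 * exp (- (1 / 512) * real N)) \<longlonglongrightarrow> 0"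
    "(\<lambda>N. real N ^ 2 * exp (- (1 / 512) * real N)) \<longlonglongrightarrow> 0"
    by (intro tendsto_power_mult_exp_neg rN; simp)+
  have L2: "(\<lambda>N. sqrt (real (n N)) ^ 2 * exp (- b * sqrt (real (n N)))) \<longlonglongrightarrow> 0"
    by (intro tendsto_power_mult_exp_neg b filterlim_compose[OF sqrt_at_top rn])
  have L3: "(\<lambda>N. inverse (real (n N)) ^ 2) \<longlonglongrightarrow> 0 ^ 2"
    by (intro tendsto_power filterlim_compose[OF tendsto_inverse_0_at_top rn] tendsto_inverse_0_at_top rn)
  define B where "B = (\<lambda>N. 2 * (real N ^ 1 * exp (- (1 / 512) * real N))
    + 4 * \<tau> * (2048 * (sqrt (real (n N)) ^ 2 * exp (- b * sqrt (real (n N)))) + 4096 * inverse (real (n N)) ^ 2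
      + real N ^ 2 * exp (- (1 / 512) * real N)))"
  have "B \<longlonglongrightarrow> 2 * 0 + 4 * \<tau> * (2048 * 0 + 4096 * 0 ^ 2 + 0)"
    unfolding B_def by (intro tendsto_intros L1 L2 L3)
  then have B0: "B \<longlonglongrightarrow> 0" by simp
  show ?thesis
  proof (rule tendsto_sandwich[OF _ _ tendsto_const B0])
    show "eventually (\<lambda>N. 0 \<le> 2 * real (N div 1024) * exp (- (N / 512))
      + 4 * (real N * \<tau>) * replica_error b N (N div 1024)) sequentially"
      using \<tau> by (intro always_eventually allI add_nonneg_nonneg mult_nonneg_nonneg replica_error_nonneg) auto
    show "eventually (\<lambda>N. 2 * real (N div 1024) * exp (- (N / 512))
      + 4 * (real N * \<tau>) * replica_error b N (N div 1024) \<le> B N) sequentially"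
      using eventually_ge_at_top[of 1024]
    proof eventually_elim
      case (elim N)
      have n1: "1 \<le> real (n N)" using elim by (simp add: n_def)
      have e: "exp (- (1 / 512) * real N) = exp (- (N / 512))" by simp
      have a1: "real N * exp (- b * sqrt (n N)) \<le> 2048 * (sqrt (real (n N)) ^ 2 * exp (- b * sqrt (real (n N))))"
        using mult_right_mono[OF Nn[OF elim], of "exp (- b * sqrt (n N))"] by simp
      have a2: "real N * (2 / real (n N) ^ 3) \<le> 4096 * inverse (real (n N)) ^ 2"
      proof -
        have "real N * (2 / real (n N) ^ 3) \<le> 2048 * real (n N) * (2 / real (n N) ^ 3)"
          using Nn[OF elim] by (intro mult_right_mono) auto
        also have "\<dots> = 4096 * inverse (real (n N)) ^ 2"
          using n1 by (simp add: field_simps power_numeral_reduce)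
        finally show ?thesis .
      qed
      have a3: "real N * (n N * exp (- (N / 512))) \<le> real N ^ 2 * exp (- (1 / 512) * real N)"
        unfolding e power2_eq_square mult.assoc using nN[of N] by (intro mult_left_mono mult_right_mono) auto
      have "real N * replica_error b N (n N) = real N * exp (- b * sqrt (n N)) + real N * (2 / real (n N) ^ 3)
          + real N * (n N * exp (- (N / 512)))"
        by (simp add: replica_error_def algebra_simps)
      then have "real N * replica_error b N (n N) \<le> 2048 * (sqrt (real (n N)) ^ 2 * exp (- b * sqrt (real (n N))))
          + 4096 * inverse (real (n N)) ^ 2 + real N ^ 2 * exp (- (1 / 512) * real N)"
        using a1 a2 a3 by linarith
      then have a4: "4 * \<tau> * (real N * replica_error b N (n N)) \<le> 4 * \<tau> * (2048 * (sqrt (real (n N)) ^ 2 * exp (- b * sqrt (real (n N))))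
          + 4096 * inverse (real (n N)) ^ 2 + real N ^ 2 * exp (- (1 / 512) * real N))"
        using \<tau> by (intro mult_left_mono) auto
      have a5: "2 * real (n N) * exp (- (N / 512)) \<le> 2 * (real N ^ 1 * exp (- (1 / 512) * real N))"
        unfolding e mult.assoc power_one_right using nN[of N] by (intro mult_left_mono mult_right_mono) auto
      show ?case
        using add_mono[OF a5 a4] unfolding B_def n_def[symmetric] by (simp add: mult_ac n_def)
    qed
  qed
qed

lemma exp_minus_12_le: "exp (- 12 :: real) \<le> 1 / 4096"
proof -
  have "(2::real) ^ 12 \<le> exp 1 ^ 12"
    using exp_ge_add_one_self[of "1::real"] by (intro power_mono) auto
  also have "\<dots> = exp 12" by (simp add: exp_of_nat_mult[of 12 "1::real", simplified, symmetric])
  finally have "4096 \<le> exp (12::real)" by simp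
  then have "inverse (exp (12::real)) \<le> inverse 4096" by (intro le_imp_inverse_le) auto
  then show ?thesis by (simp add: exp_minus)
qed

theorem proposition1p8:
  fixes U :: "real \<Rightarrow> real"
    and M :: "nat \<Rightarrow> nat"
    and P :: "nat \<Rightarrow> 'w measure"
    and G :: "nat \<Rightarrow> nat \<Rightarrow> nat \<Rightarrow> 'w \<Rightarrow> real"
    and \<tau> :: real
  assumes U_meas: "U \<in> borel_measurable borel"
    and U_range: "\<And>x. U x \<in> {0..1}"
    and U_nondeg: "(\<integral>\<xi>. \<xi> * U \<xi> \<partial>std_gaussian) \<noteq> 0"
    and M_le: "\<And>N. M N \<le> N"
    and G_iid: "\<And>N. iid_gaussian_matrix (P N) (M N) N (G N)"
    and \<tau>_eq: "\<tau> = exp (- 12)"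
  shows "((\<lambda>\<eta>. limsup (\<lambda>N. ereal (1 / real N *
            \<bar>\<integral>\<omega>. trunc_log (real N * \<tau>)
                  (partition_function (gauss_smooth \<eta> U) (M N) N (\<lambda>a i. G N a i \<omega>) / 2 ^ N)
                - trunc_log (real N * \<tau>)
                  (partition_function U (M N) N (\<lambda>a i. G N a i \<omega>) / 2 ^ N) \<partial>P N\<bar>)))
          \<longlongrightarrow> 0) (at_right 0)"
proof -
  define D where "D = (\<lambda>\<eta> N. 1 / real N *
            \<bar>\<integral>\<omega>. trunc_log (real N * \<tau>)
                  (partition_function (gauss_smooth \<eta> U) (M N) N (\<lambda>a i. G N a i \<omega>) / 2 ^ N)
                - trunc_log (real N * \<tau>)
                  (partition_function U (M N) N (\<lambda>a i. G N a i \<omega>) / 2 ^ N) \<partial>P N\<bar>)"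
  have D0: "0 \<le> D \<eta> N" for \<eta> N by (simp add: D_def)
  have \<tau>: "0 < \<tau>" "\<tau> \<le> 1 / 4096" using exp_minus_12_le by (auto simp: \<tau>_eq)
  (* Half of the mass of U is a lower bound for U and, once eta is small, also for its smoothing. *)
  define b where "b = gauss_mass U / 2"
  have bU: "0 < gauss_mass U" by (rule gauss_mass_pos[OF U_meas U_range U_nondeg])
  then have b: "0 < b" by (simp add: b_def)
  define \<epsilon> where "\<epsilon> = (\<lambda>\<eta>. \<integral>x. \<bar>gauss_smooth \<eta> U x - U x\<bar> \<partial>std_gaussian)"
  have \<epsilon>_lim: "(\<epsilon> \<longlongrightarrow> 0) (at_right 0)"
    unfolding \<epsilon>_def by (rule gauss_smooth_L1[OF U_meas U_range])
  have \<epsilon>0: "0 \<le> \<epsilon> \<eta>" for \<eta>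
    unfolding \<epsilon>_def by (intro Bochner_Integration.integral_nonneg) auto
  (* The largest number of replicas for which the moment bound is available. *)
  define n where "n = (\<lambda>N::nat. N div 1024)"
  have n_lim: "filterlim n at_top sequentially" unfolding n_def by (rule filterlim_div_at_top) simp
  have key: "eventually (\<lambda>\<eta>. limsup (\<lambda>N. ereal (D \<eta> N)) \<le> ereal e) (at_right 0)" if e: "0 < e" for e
  proof -
    (* Each of the three contributions to the error gets one third of e: K makes the tail of the
       series small, then eta the Lipschitz part, and then N the remainder. *)
    obtain K where K: "\<And>m n. K \<le> m \<Longrightarrow> norm (sum (replica_tail b) {m..<n}) < e / 3"
      using summable_replica_tail[OF b] e unfolding summable_Cauchy by (metis divide_pos_pos zero_less_numeral)
    have tail: "(\<Sum>k\<in>{K<..m}. replica_tail b k) \<le> e / 3" for m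
    proof -
      have "{K<..m} = {Suc K..<Suc m}" by auto
      then show ?thesis using K[of "Suc K" "Suc m"] by simp
    qed
    have "((\<lambda>\<eta>. K * \<epsilon> \<eta>) \<longlongrightarrow> real K * 0) (at_right 0)" by (intro tendsto_intros \<epsilon>_lim)
    then have "eventually (\<lambda>\<eta>. K * \<epsilon> \<eta> < e / 3) (at_right 0)"
      using e by (intro order_tendstoD(2)) auto
    moreover have "eventually (\<lambda>\<eta>. \<epsilon> \<eta> < b) (at_right 0)"
      using \<epsilon>_lim b by (rule order_tendstoD(2))
    ultimately show ?thesis
    proof eventually_elim
      case (elim \<eta>)
      have V: "gauss_smooth \<eta> U \<in> borel_measurable borel" by (rule measurable_gauss_smooth[OF U_meas])
      have V01: "gauss_smooth \<eta> U x \<in> {0..1}" for x by (rule gauss_smooth_bounds[OF U_meas U_range])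
      have bV: "b \<le> gauss_mass (gauss_smooth \<eta> U)"
        using gauss_mass_diff[OF V V01 U_meas U_range] elim(2) by (simp add: \<epsilon>_def b_def)
      have bU': "b \<le> gauss_mass U" using bU by (simp add: b_def)
      have "eventually (\<lambda>N. real N ^ 1 * exp (- \<tau> * real N) < 1 / 2) sequentially"
        by (rule order_tendstoD(2)[OF tendsto_power_mult_exp_neg[OF \<tau>(1) filterlim_real_sequentially]]) simp
      moreover have "eventually (\<lambda>N. 2 * real (n N) * exp (- (N / 512))
          + 4 * (real N * \<tau>) * replica_error b N (n N) < e / 3) sequentially"
        unfolding n_def using row_error_remainder_tendsto_0[OF b, of \<tau>] \<tau> e by (intro order_tendstoD(2)) auto
      moreover have "eventually (\<lambda>N. max 1 K \<le> n N) sequentially"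
        using n_lim unfolding filterlim_at_top by blast
      ultimately have "eventually (\<lambda>N. D \<eta> N \<le> e) sequentially"
      proof eventually_elim
        case N: (elim N)
        let ?A = "real N * \<tau>"
        let ?R = "row_error ?A b N K (n N) (\<epsilon> \<eta>)"
        have n: "0 < n N" "K \<le> n N" "1024 * n N \<le> N" using N(3) by (auto simp: n_def)
        have A: "0 \<le> ?A" "?A \<le> N / 4096"
        proof -
          show "0 \<le> ?A" using \<tau>(1) by simp
          show "?A \<le> N / 4096" using mult_left_mono[OF \<tau>(2), of "real N"] by simp
        qed
        have "n N * exp (- ?A) \<le> real N * exp (- ?A)"
          using n by (intro mult_right_mono) auto
        also have "\<dots> \<le> 1 / 2" using N(1) by (simp add: mult.commute)
        finally have nA: "n N * exp (- ?A) \<le> 1 / 2" .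
        have "?R \<le> K * \<epsilon> \<eta> + (\<Sum>k\<in>{K<..n N}. replica_tail b k)
            + (2 * real (n N) * exp (- (N / 512)) + 4 * ?A * replica_error b N (n N))"
          by (rule row_error_le[OF A(1)])
        also have "\<dots> \<le> e / 3 + e / 3 + e / 3"
          using elim(1) tail[of "n N"] N(2) by (intro add_mono) auto
        finally have R: "?R \<le> e" by simp
        have N0: "0 < real N" using n by simp
        have "D \<eta> N \<le> 1 / real N * (M N * ?R)"
          unfolding D_def \<epsilon>_def using N0
          by (intro mult_left_mono partition_function_replacement[OF V V01 U_meas U_range bV bU' n(1,3,2) A nA G_iid]) auto
        also have "\<dots> \<le> 1 / real N * (real N * e)"
          using M_le[of N] R e N0 by (intro mult_left_mono order_trans[OF mult_left_mono[OF R] mult_right_mono]) auto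
        also have "\<dots> = e" using N0 by simp
        finally show ?case .
      qed
      then show ?case by (intro Limsup_bounded) simp
    qed
  qed
  have nonneg: "0 \<le> limsup (\<lambda>N. ereal (D \<eta> N))" for \<eta>
    by (rule le_Limsup) (use D0 in auto)
  have "((\<lambda>\<eta>. limsup (\<lambda>N. ereal (D \<eta> N))) \<longlongrightarrow> 0) (at_right 0)"
  proof (rule order_tendstoI)
    fix a :: ereal assume "a < 0"
    then show "eventually (\<lambda>\<eta>. a < limsup (\<lambda>N. ereal (D \<eta> N))) (at_right 0)"
      using nonneg by (intro always_eventually allI) (rule less_le_trans)
  next
    fix a :: ereal assume "0 < a"
    then obtain e where e: "0 < ereal e" "ereal e < a" using ereal_dense2 by blast
    then have "eventually (\<lambda>\<eta>. limsup (\<lambda>N. ereal (D \<eta> N)) \<le> ereal e) (at_right 0)" by (intro key) simp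
    then show "eventually (\<lambda>\<eta>. limsup (\<lambda>N. ereal (D \<eta> N)) < a) (at_right 0)"
      by eventually_elim (use e in order)
  qed
  then show ?thesis unfolding D_def .
qed

end
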